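(* The sequence $(\mathbb{P}_N)_{N\ge 1}$ of probability measures on $\mathcal{P}(\mathbb{T}^d)$ converges weakly to a probability measure $\mathbb{P}$ on the Borel space $\mathcal{P}(\mathbb{T}^d)$ equipped with the $1$-Wasserstein distance. The measure $\mathbb{P}$ satisfies the following items. (i) $\mathbb{P}$ has full support and, for $\mathbb{P}$-almost every $m\in\mathcal{P}(\mathbb{T}^d)$, $m$ has a continuously differentiable strictly positive density. (ii) For any $N\ge 1$, the image of $\mathbb{P}$ by the projection mapping $$\pi_N^{(1)}: m\in\mathcal{P}(\mathbb{T}^d)\mapsto \bigl(\widehat m^k\,\widehat f_N^k\bigr)_{k\in F_N^+}$$ is absolutely continuous with respect to the Lebesgue measure on $\mathcal{O}_N$. Similarly, the image of the subprobability measure $\mathbf{1}_{\{(\widehat m^k)_{k\in F_N^+}\in\mathcal{O}_N\}}\cdot\mathbb{P}$ by the projection mapping $$\pi_N^{(2)}: m\in\mathcal{P}(\mathbb{T}^d)\mapsto \bigl(\widehat m^k\bigr)_{k\in F_N^+}\in\mathbb{R}^{2|F_N^+|}$$ is supported by $\mathcal{O}_N$ and is absolutely continuous with respect to the Lebesgue measure on $\mathcal{O}_N$. (iii) $$\lim_{N\to\infty}\ \sup_{\phi:\mathbb{R}^{D_N}\to[-1,1]}\Bigl|\int_{\mathcal{P}(\mathbb{T}^d)}\phi\bigl((\widehat m^k)_{k\in F_N^+}\bigr)\,d(\mathbb{P}-\mathbb{P}_N)(m)\Bigr|=0,$$ where $D_N=2|F_N^+|$ and, for any $N\ge1$, the function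 $\phi$ in the supremum is required to be measurable.
   Context: $\mathbb{T}^d=\mathbb{R}^d/\mathbb{Z}^d$, $d\ge1$; $\mathcal{P}(\mathbb{T}^d)$ is the set of Borel probability measures on $\mathbb{T}^d$, equipped with the $1$-Wasserstein distance $d_{W_1}(m,m')=\sup\{|\int\phi\,d(m-m')|:\phi\ 1\text{-Lipschitz}\}$ (a compact metric space) and its Borel $\sigma$-algebra. Fourier notation: $e_k(x)=e^{\mathrm{i}2\pi k\cdot x}$, $\widehat m^k=\int_{\mathbb{T}^d}e_k\,dm$ for a measure $m$, and $\widehat h^k=\int_{\mathbb{T}^d}h\,e_k\,dx$ for a function $h$. $|k|$ is the Euclidean norm. $F_N=\{-N+1,\dots,N-1\}^d$; $F_N^+$ is the set of $k\in F_N\setminus\{0\}$ whose first non-zero coordinate is positive. Complex numbers are identified with vectors of $\mathbb{R}^2$, so $\mathbb{C}^{|F_N^+|}\simeq\mathbb{R}^{2|F_N^+|}$. $$\mathcal{O}_N=\Bigl\{(\widehat m^k)_{k\in F_N^+}\in\mathbb{C}^{|F_N^+|}:\ \inf_{x\in\mathbb{T}^d}\Bigl[1+2\Re\sum_{k\in F_N^+}\widehat m^k e_{-k}(x)\Bigr]>0\Bigr\},$$ an open subset of $\mathbb{R}^{2|F_N^+|}$, and $\mathscr{I}_N:\mathcal{O}_N\to\mathcal{P}(\mathbb{T}^d)$ maps $(\widehat m^k)_{k\in F_N^+}$ to the probability measure with density $1+2\sum_{k\in F_N^+}\Re[\widehat m^ke_{-k}]$. Fejér kernel: $f_N(\theta)=N^{-d}\bigl|\sum_{k\in\{1,\dots,N\}^d}e^{\mathrm{i}2\pi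 k\cdot\theta}\bigr|^2$, so $\widehat f_N^k=\prod_{j=1}^d(1-|k_j|/N)$ for $k\in F_N$ and $\widehat f_N^k=0$ otherwise. Fix a real $p\ge5$. $\Gamma_N$ is the probability measure on $\mathcal{O}_N$ with density (with respect to Lebesgue measure) $\frac1{Z_N}\mathbf{1}_{\mathcal{O}_N}\exp\bigl(-\sum_{k\in F_N^+}|k|^{2pd}|\widehat m^k|^2\bigr)$, $Z_N$ being the normalization constant, and $\mathbb{P}_N=\Gamma_N\circ\mathscr{I}_N^{-1}$ is its image on $\mathcal{P}(\mathbb{T}^d)$ by $\mathscr{I}_N$. *)

theory Defs
  imports "HOL-Probability.Probability"
begin

section \<open>The flat torus\<close>

text \<open>The torus is the quotient of Euclidean space by the integer lattice, with the quotient metric;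
  its dimension \<open>d \<ge> 1\<close> is \<^term>\<open>CARD('n)\<close>.\<close>

definition torus_rel :: "real ^ 'n \<Rightarrow> real ^ 'n \<Rightarrow> bool" where
  "torus_rel a b \<longleftrightarrow> (\<forall>i. a $ i - b $ i \<in> \<int>)"

lemma equivp_torus_rel: "equivp torus_rel"
proof (rule equivpI)
  show "reflp torus_rel"
    by (simp add: reflp_def torus_rel_def)
  show "symp torus_rel"
    unfolding symp_def torus_rel_def by (metis Ints_minus minus_diff_eq)
  show "transp torus_rel"
    unfolding transp_def torus_rel_def by (metis Ints_add diff_add_cancel add_diff_eq)
qed

quotient_type (overloaded) 'n torus = "(real, 'n::finite) vec" / torus_rel
  by (rule equivp_torus_rel)

lemma abs_torus_eq_iff: "abs_torus a = abs_torus b \<longleftrightarrow> (\<forall>i. a $ i - b $ i \<in> \<int>)"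
  using torus.abs_eq_iff[of a b] by (simp add: torus_rel_def)

lemma abs_torus_surj: "\<exists>a. abs_torus a = x"
  by (metis Quotient_abs_rep Quotient_torus)

instantiation torus :: (finite) metric_space
begin

definition dist_torus :: "'a torus \<Rightarrow> 'a torus \<Rightarrow> real" where
  "dist_torus x y = Inf {dist a b |a b. abs_torus a = x \<and> abs_torus b = y}"

definition uniformity_torus :: "('a torus \<times> 'a torus) filter" where
  "uniformity_torus = (INF e\<in>{0<..}. principal {(x, y). dist x y < e})"

definition open_torus :: "'a torus set \<Rightarrow> bool" where
  "open_torus U \<longleftrightarrow> (\<forall>x\<in>U. eventually (\<lambda>(x', y). x' = x \<longrightarrow> y \<in> U) uniformity)"

lemma dist_torus_le:
  fixes a b :: "real ^ 'a"
  shows "dist (abs_torus a) (abs_torus b) \<le> dist a b"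
  unfolding dist_torus_def by (rule cInf_lower) (auto intro!: bdd_belowI[of _ 0])

lemma dist_torus_greatest:
  fixes x y :: "'a torus"
  assumes "\<And>a b. abs_torus a = x \<Longrightarrow> abs_torus b = y \<Longrightarrow> c \<le> dist a b"
  shows "c \<le> dist x y"
proof -
  obtain a b where "abs_torus a = x" "abs_torus b = y"
    using abs_torus_surj by metis
  then show ?thesis
    unfolding dist_torus_def using assms by (intro cInf_greatest) auto
qed

instance
proof
  fix x y z :: "'a torus"
  obtain a b where ab: "abs_torus a = x" "abs_torus b = y"
    using abs_torus_surj by metis
  have nonneg: "0 \<le> dist x y"
    by (rule dist_torus_greatest) simp
  show "dist x y = 0 \<longleftrightarrow> x = y"
  proof
    assume "x = y"
    then show "dist x y = 0"
      using dist_torus_le[of a a] nonneg ab by simp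
  next
    assume 0: "dist x y = 0"
    show "x = y"
    proof (rule ccontr)
      assume "x \<noteq> y"
      then obtain i where i: "a $ i - b $ i \<notin> \<int>"
        using ab abs_torus_eq_iff by metis
      define t where "t = a $ i - b $ i"
      define \<delta> where "\<delta> = min (frac t) (1 - frac t)"
      have "frac t \<noteq> 0"
        using i by (simp add: t_def frac_eq_0_iff)
      then have "frac t > 0"
        using frac_ge_0[of t] by linarith
      then have "\<delta> > 0"
        using frac_lt_1[of t] by (simp add: \<delta>_def)
      moreover have "\<delta> \<le> dist x y"
      proof (rule dist_torus_greatest)
        fix a' b' :: "real ^ 'a"
        assume "abs_torus a' = x" "abs_torus b' = y"
        then have "a' $ i - a $ i \<in> \<int>" "b' $ i - b $ i \<in> \<int>"
          using ab abs_torus_eq_iff by metis+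
        then obtain k l :: int where "a' $ i - a $ i = k" "b' $ i - b $ i = l"
          by (auto elim!: Ints_cases)
        then have eq: "a' $ i - b' $ i = frac t + of_int (\<lfloor>t\<rfloor> + k - l)"
          by (simp add: t_def frac_def)
        have "\<delta> \<le> \<bar>a' $ i - b' $ i\<bar>"
        proof (cases "\<lfloor>t\<rfloor> + k - l \<ge> 0")
          case True
          then have "real_of_int (\<lfloor>t\<rfloor> + k - l) \<ge> 0"
            by linarith
          then show ?thesis
            unfolding eq using frac_ge_0[of t] by (simp add: \<delta>_def)
        next
          case False
          then have "real_of_int (\<lfloor>t\<rfloor> + k - l) \<le> -1"
            by linarith
          then show ?thesis
            unfolding eq using frac_lt_1[of t] by (simp add: \<delta>_def)
        qed
        also have "\<dots> \<le> dist a' b'"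
          using dist_vec_nth_le[of a' i b'] by (simp add: dist_real_def)
        finally show "\<delta> \<le> dist a' b'" .
      qed
      ultimately show False
        using 0 by simp
    qed
  qed
  show "dist x y \<le> dist x z + dist y z"
  proof -
    have "dist x y - dist a' c \<le> dist y z" if a': "abs_torus a' = x" and c: "abs_torus c = z" for a' c
    proof (rule dist_torus_greatest)
      fix b' c' assume b': "abs_torus b' = y" and c': "abs_torus c' = z"
      have "abs_torus (b' + (c - c')) = y"
      proof -
        have "abs_torus c = abs_torus c'" using c c' by simp
        then have "abs_torus (b' + (c - c')) = abs_torus b'"
          unfolding abs_torus_eq_iff by simp
        then show ?thesis using b' by simp
      qed
      then have "dist x y \<le> dist a' (b' + (c - c'))"
        using dist_torus_le[of a' "b' + (c - c')"] a' by simp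
      also have "\<dots> \<le> dist a' c + dist (b' + (c - c')) c"
        by (rule dist_triangle2)
      also have "dist (b' + (c - c')) c = dist b' c'"
        by (simp add: dist_norm algebra_simps)
      finally show "dist x y - dist a' c \<le> dist b' c'" by simp
    qed
    then have "dist x y - dist y z \<le> dist x z"
      by (intro dist_torus_greatest) (smt (verit))
    then show ?thesis by simp
  qed
qed (fact uniformity_torus_def open_torus_def)+

end

lemma abs_torus_unit_cube: "\<exists>a. abs_torus a = x \<and> (\<forall>i. 0 \<le> a $ i \<and> a $ i < 1)"
proof -
  obtain a where a: "abs_torus a = x"
    using abs_torus_surj by blast
  have "abs_torus (\<chi> i. frac (a $ i)) = abs_torus a"
    unfolding abs_torus_eq_iff by (simp add: frac_def)
  then show ?thesis
    using a frac_ge_0 frac_lt_1 by (intro exI[of _ "\<chi> i. frac (a $ i)"]) auto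
qed

lemma dist_torus_bounded:
  fixes x y :: "'n::finite torus"
  shows "dist x y \<le> real CARD('n)"
proof -
  obtain a b where a: "abs_torus a = x" "\<And>i. 0 \<le> a $ i \<and> a $ i < 1"
    and b: "abs_torus b = y" "\<And>i. 0 \<le> b $ i \<and> b $ i < 1"
    using abs_torus_unit_cube by metis
  have "dist x y \<le> norm (a - b)"
    using dist_torus_le[of a b] a b by (simp add: dist_norm)
  also have "\<dots> \<le> (\<Sum>i\<in>UNIV. \<bar>(a - b) $ i\<bar>)"
    by (rule norm_le_l1_cart)
  also have "\<dots> \<le> (\<Sum>i\<in>(UNIV::'n set). 1)"
  proof (rule sum_mono)
    fix i show "\<bar>(a - b) $ i\<bar> \<le> 1"
      using a(2)[of i] b(2)[of i] unfolding vector_minus_component by linarith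
  qed
  finally show ?thesis by simp
qed

definition torus_lebesgue :: "'n::finite torus measure" where
  "torus_lebesgue =
     distr (restrict_space lborel {a :: real ^ 'n. \<forall>i. 0 \<le> a $ i \<and> a $ i < 1}) borel abs_torus"

definition C1_torus :: "('n::finite torus \<Rightarrow> real) \<Rightarrow> bool" where
  "C1_torus h \<longleftrightarrow> (\<exists>g :: real ^ 'n \<Rightarrow> real ^ 'n. continuous_on UNIV g \<and>
     (\<forall>a. ((\<lambda>b. h (abs_torus b)) has_derivative (\<lambda>v. g a \<bullet> v)) (at a)))"


section \<open>Probability measures on the torus with the 1-Wasserstein distance\<close>

typedef (overloaded) 'n torus_prob =
  "{m :: 'n::finite torus measure. prob_space m \<and> sets m = sets borel}"
  morphisms measure_of_torus_prob Abs_torus_prob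
proof -
  have "prob_space (return borel (x :: 'n torus))" for x
    by (rule prob_space_return) simp
  then show ?thesis
    by (intro exI[of _ "return borel undefined"]) simp
qed

lemma prob_space_torus_prob: "prob_space (measure_of_torus_prob m)"
  using measure_of_torus_prob[of m] by simp

lemma sets_torus_prob [simp, measurable_cong]: "sets (measure_of_torus_prob m) = sets borel"
  using measure_of_torus_prob[of m] by simp

lemma space_torus_prob [simp]: "space (measure_of_torus_prob m) = UNIV"
  using sets_eq_imp_space_eq[OF sets_torus_prob] by simp

lemma integrable_torus_prob:
  fixes \<phi> :: "'n::finite torus \<Rightarrow> real"
  assumes "L-lipschitz_on UNIV \<phi>"
  shows "integrable (measure_of_torus_prob m) \<phi>"
proof -
  interpret prob_space "measure_of_torus_prob m" by (rule prob_space_torus_prob)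
  have "continuous_on UNIV \<phi>"
    using assms by (rule lipschitz_on_continuous_on)
  then have "\<phi> \<in> borel_measurable borel"
    by (rule borel_measurable_continuous_onI)
  then have meas: "\<phi> \<in> borel_measurable (measure_of_torus_prob m)"
    by simp
  have "norm (\<phi> x) \<le> \<bar>\<phi> undefined\<bar> + L * real CARD('n)" for x
  proof -
    have "\<bar>\<phi> x - \<phi> undefined\<bar> \<le> L * dist x undefined"
      using lipschitz_onD[OF assms, of x undefined] by (simp add: dist_real_def)
    also have "\<dots> \<le> L * real CARD('n)"
      using dist_torus_bounded lipschitz_on_nonneg[OF assms] by (intro mult_left_mono) auto
    finally show ?thesis by (simp add: abs_le_iff) linarith
  qed
  then show ?thesis
    by (intro integrable_const_bound[OF _ meas]) auto
qed

definition W1_torus :: "'n::finite torus measure \<Rightarrow> 'n torus measure \<Rightarrow> real" where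
  "W1_torus m m' = (SUP \<phi>\<in>{\<phi>. 1-lipschitz_on UNIV \<phi>}. \<bar>integral\<^sup>L m \<phi> - integral\<^sup>L m' \<phi>\<bar>)"

lemma abs_integral_diff_torus_prob_le:
  fixes \<phi> :: "'n::finite torus \<Rightarrow> real"
  assumes "1-lipschitz_on UNIV \<phi>"
  shows "\<bar>integral\<^sup>L (measure_of_torus_prob m) \<phi> - integral\<^sup>L (measure_of_torus_prob m') \<phi>\<bar>
           \<le> 2 * real CARD('n)"
proof -
  have "\<bar>integral\<^sup>L (measure_of_torus_prob m) \<phi> - \<phi> undefined\<bar> \<le> real CARD('n)" for m :: "'n torus_prob"
  proof -
    interpret prob_space "measure_of_torus_prob m" by (rule prob_space_torus_prob)
    have *: "\<bar>\<phi> x - \<phi> undefined\<bar> \<le> real CARD('n)" for x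
      using lipschitz_onD[OF assms, of x undefined] dist_torus_bounded[of x undefined]
      by (simp add: dist_real_def)
    have i: "integrable (measure_of_torus_prob m) \<phi>"
      by (rule integrable_torus_prob[OF assms])
    have "\<phi> undefined - real CARD('n) \<le> \<phi> x" "\<phi> x \<le> \<phi> undefined + real CARD('n)" for x
      using *[of x] by linarith+
    then have "integral\<^sup>L (measure_of_torus_prob m) \<phi> \<ge> \<phi> undefined - real CARD('n)"
      "integral\<^sup>L (measure_of_torus_prob m) \<phi> \<le> \<phi> undefined + real CARD('n)"
      using i by (auto intro!: integral_ge_const integral_le_const)
    then show ?thesis by linarith
  qed
  from this[of m] this[of m'] show ?thesis by linarith
qed

lemma bdd_above_W1_torus:
  "bdd_above ((\<lambda>\<phi>. \<bar>integral\<^sup>L (measure_of_torus_prob m) \<phi> - integral\<^sup>L (measure_of_torus_prob m') \<phi>\<bar>)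
     ` {\<phi> :: 'n::finite torus \<Rightarrow> real. 1-lipschitz_on UNIV \<phi>})"
  using abs_integral_diff_torus_prob_le by (intro bdd_aboveI2) auto

lemma one_lipschitz_const: "1-lipschitz_on UNIV (\<lambda>_. c)"
  by (rule lipschitz_onI) auto

lemma measure_eq_if_lipschitz_integrals_eq:
  fixes m m' :: "'n::finite torus_prob"
  assumes eq: "\<And>\<phi> :: 'n torus \<Rightarrow> real. 1-lipschitz_on UNIV \<phi> \<Longrightarrow>
    integral\<^sup>L (measure_of_torus_prob m) \<phi> = integral\<^sup>L (measure_of_torus_prob m') \<phi>"
  shows "m = m'"
proof -
  define \<phi> where "\<phi> = (\<lambda>C n (x :: 'n torus). min (1 / real (Suc n)) (infdist x C))"
  have lip: "1-lipschitz_on UNIV (\<phi> C n)" for C n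
  proof (rule lipschitz_onI)
    fix x y
    show "dist (\<phi> C n x) (\<phi> C n y) \<le> 1 * dist x y"
      using infdist_triangle_abs[of x C y] by (auto simp: \<phi>_def dist_real_def min_def)
  qed simp
  define \<psi> where "\<psi> = (\<lambda>C n x. 1 - real (Suc n) * \<phi> C n x)"
  have \<psi>_eq: "integral\<^sup>L (measure_of_torus_prob m) (\<psi> C n) = integral\<^sup>L (measure_of_torus_prob m') (\<psi> C n)" for C n
  proof -
    interpret M: prob_space "measure_of_torus_prob m" by (rule prob_space_torus_prob)
    interpret M': prob_space "measure_of_torus_prob m'" by (rule prob_space_torus_prob)
    show ?thesis
      unfolding \<psi>_def using eq[OF lip[of C n]]
      by (simp add: integrable_torus_prob[OF lip] M.prob_space[simplified] M'.prob_space[simplified])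
  qed
  have lim: "(\<lambda>n. integral\<^sup>L (measure_of_torus_prob m) (\<psi> C n)) \<longlonglongrightarrow> measure (measure_of_torus_prob m) C"
    if C: "closed C" "C \<noteq> {}" for C and m :: "'n torus_prob"
  proof -
    interpret M: prob_space "measure_of_torus_prob m" by (rule prob_space_torus_prob)
    have meas: "\<psi> C n \<in> borel_measurable (measure_of_torus_prob m)" for n
      unfolding \<psi>_def using borel_measurable_integrable[OF integrable_torus_prob[OF lip]] by measurable
    have Cm: "C \<in> sets (measure_of_torus_prob m)"
      using C by simp
    have b: "norm (\<psi> C n x) \<le> 1" for n x
    proof -
      have "0 \<le> \<phi> C n x" "\<phi> C n x \<le> 1 / real (Suc n)"
        by (auto simp: \<phi>_def infdist_nonneg)
      then have "0 \<le> real (Suc n) * \<phi> C n x" "real (Suc n) * \<phi> C n x \<le> 1"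
        by (auto simp: field_simps)
      then show ?thesis by (simp add: \<psi>_def)
    qed
    have p: "(\<lambda>n. \<psi> C n x) \<longlonglongrightarrow> indicator C x" for x
    proof (cases "x \<in> C")
      case True
      then show ?thesis by (simp add: \<psi>_def \<phi>_def)
    next
      case False
      then have pos: "infdist x C > 0"
        using C infdist_pos_not_in_closed by blast
      have "(\<lambda>n. 1 / real (Suc n)) \<longlonglongrightarrow> 0"
        by (rule lim_1_over_n[THEN LIMSEQ_Suc])
      then have "\<forall>\<^sub>F n in sequentially. 1 / real (Suc n) < infdist x C"
        using pos by (rule order_tendstoD)
      then have "\<forall>\<^sub>F n in sequentially. \<psi> C n x = indicator C x"
        by eventually_elim (use False in \<open>simp add: \<psi>_def \<phi>_def\<close>)
      then show ?thesis by (rule tendsto_eventually)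
    qed
    have "(\<lambda>n. integral\<^sup>L (measure_of_torus_prob m) (\<psi> C n)) \<longlonglongrightarrow>
      integral\<^sup>L (measure_of_torus_prob m) (indicator C)"
      by (rule integral_dominated_convergence[where w="\<lambda>_. 1"]) (use meas Cm b p in auto)
    then show ?thesis by simp
  qed
  have closed_eq: "emeasure (measure_of_torus_prob m) C = emeasure (measure_of_torus_prob m') C"
    if "closed C" for C
  proof (cases "C = {}")
    case False
    interpret M: prob_space "measure_of_torus_prob m" by (rule prob_space_torus_prob)
    interpret M': prob_space "measure_of_torus_prob m'" by (rule prob_space_torus_prob)
    have "measure (measure_of_torus_prob m) C = measure (measure_of_torus_prob m') C"
      using lim[OF that False, of m] lim[OF that False, of m'] LIMSEQ_unique by (simp add: \<psi>_eq)
    then show ?thesis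
      by (simp add: M.emeasure_eq_measure M'.emeasure_eq_measure)
  qed simp
  have "measure_of_torus_prob m = measure_of_torus_prob m'"
  proof (rule measure_eqI_generator_eq[where E="Collect closed" and \<Omega>=UNIV and A="\<lambda>_. UNIV"])
    interpret M: prob_space "measure_of_torus_prob m" by (rule prob_space_torus_prob)
    show "emeasure (measure_of_torus_prob m) UNIV \<noteq> \<infinity>"
      using M.emeasure_space_1 by simp
    show "sets (measure_of_torus_prob m) = sigma_sets UNIV (Collect closed)"
      "sets (measure_of_torus_prob m') = sigma_sets UNIV (Collect closed)"
      by (simp_all add: borel_eq_closed)
  qed (auto simp: Int_stable_def closed_eq)
  then show ?thesis
    by (simp add: measure_of_torus_prob_inject)
qed

instantiation torus_prob :: (finite) metric_space
begin

definition dist_torus_prob :: "'a torus_prob \<Rightarrow> 'a torus_prob \<Rightarrow> real" where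
  "dist_torus_prob m m' = W1_torus (measure_of_torus_prob m) (measure_of_torus_prob m')"

definition uniformity_torus_prob :: "('a torus_prob \<times> 'a torus_prob) filter" where
  "uniformity_torus_prob = (INF e\<in>{0<..}. principal {(x, y). dist x y < e})"

definition open_torus_prob :: "'a torus_prob set \<Rightarrow> bool" where
  "open_torus_prob U \<longleftrightarrow> (\<forall>x\<in>U. eventually (\<lambda>(x', y). x' = x \<longrightarrow> y \<in> U) uniformity)"

lemma dist_torus_prob_ge:
  fixes m m' :: "'a torus_prob"
  assumes "1-lipschitz_on UNIV \<phi>"
  shows "\<bar>integral\<^sup>L (measure_of_torus_prob m) \<phi> - integral\<^sup>L (measure_of_torus_prob m') \<phi>\<bar> \<le> dist m m'"
  unfolding dist_torus_prob_def W1_torus_def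
  using assms by (intro cSUP_upper bdd_above_W1_torus) simp

lemma dist_torus_prob_le:
  fixes m m' :: "'a torus_prob"
  assumes "\<And>\<phi>. 1-lipschitz_on UNIV \<phi> \<Longrightarrow>
    \<bar>integral\<^sup>L (measure_of_torus_prob m) \<phi> - integral\<^sup>L (measure_of_torus_prob m') \<phi>\<bar> \<le> c"
  shows "dist m m' \<le> c"
  unfolding dist_torus_prob_def W1_torus_def
  using assms one_lipschitz_const by (intro cSUP_least) auto

instance
proof
  fix m m' m'' :: "'a torus_prob"
  show "dist m m' = 0 \<longleftrightarrow> m = m'"
  proof
    assume "m = m'"
    then show "dist m m' = 0"
      using dist_torus_prob_le[of m m' 0] dist_torus_prob_ge[OF one_lipschitz_const, of m 0 m'] by simp
  next
    assume "dist m m' = 0"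
    then show "m = m'"
      using dist_torus_prob_ge[of _ m m'] by (intro measure_eq_if_lipschitz_integrals_eq) force
  qed
  show "dist m m' \<le> dist m m'' + dist m' m''"
  proof (rule dist_torus_prob_le)
    fix \<phi> :: "'a torus \<Rightarrow> real" assume "1-lipschitz_on UNIV \<phi>"
    from dist_torus_prob_ge[OF this, of m m''] dist_torus_prob_ge[OF this, of m' m'']
    show "\<bar>integral\<^sup>L (measure_of_torus_prob m) \<phi> - integral\<^sup>L (measure_of_torus_prob m') \<phi>\<bar>
      \<le> dist m m'' + dist m' m''" by linarith
  qed
qed (fact uniformity_torus_prob_def open_torus_prob_def)+

end

definition weakly_converges :: "(nat \<Rightarrow> 'a::metric_space measure) \<Rightarrow> 'a measure \<Rightarrow> bool" where
  "weakly_converges \<mu> \<nu> \<longleftrightarrow>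
     (\<forall>f :: 'a \<Rightarrow> real. continuous_on UNIV f \<and> bounded (range f) \<longrightarrow>
        (\<lambda>n. integral\<^sup>L (\<mu> n) f) \<longlonglongrightarrow> integral\<^sup>L \<nu> f)"

definition measure_support :: "'a::topological_space measure \<Rightarrow> 'a set" where
  "measure_support \<mu> = {x. \<forall>U. open U \<and> x \<in> U \<longrightarrow> emeasure \<mu> U > 0}"


section \<open>Fourier coefficients\<close>

lift_definition echar :: "int ^ 'n \<Rightarrow> 'n::finite torus \<Rightarrow> complex" is
  "\<lambda>k a. exp (\<i> * 2 * pi * (\<Sum>i\<in>UNIV. real_of_int (k $ i) * a $ i))"
proof -
  fix k :: "int ^ 'n" and a b :: "real ^ 'n"
  assume "torus_rel a b"
  then have "\<forall>i. \<exists>l::int. a $ i = b $ i + l"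
    unfolding torus_rel_def by (metis Ints_cases add_diff_cancel_left' diff_add_cancel add.commute)
  then obtain l :: "'n \<Rightarrow> int" where l: "\<And>i. a $ i = b $ i + l i"
    by metis
  have "(\<Sum>i\<in>UNIV. real_of_int (k $ i) * a $ i) =
      (\<Sum>i\<in>UNIV. real_of_int (k $ i) * b $ i) + of_int (\<Sum>i\<in>UNIV. k $ i * l i)"
    by (simp add: l algebra_simps sum.distrib)
  then show "exp (\<i> * 2 * pi * (\<Sum>i\<in>UNIV. real_of_int (k $ i) * a $ i)) =
    exp (\<i> * 2 * pi * (\<Sum>i\<in>UNIV. real_of_int (k $ i) * b $ i))"
    unfolding exp_eq by (intro exI[of _ "\<Sum>i\<in>UNIV. k $ i * l i"]) (simp add: algebra_simps)
qed

definition fourier_measure :: "'n::finite torus measure \<Rightarrow> int ^ 'n \<Rightarrow> complex" where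
  "fourier_measure m k = (\<integral>x. echar k x \<partial>m)"

definition fourier_fun :: "('n::finite torus \<Rightarrow> complex) \<Rightarrow> int ^ 'n \<Rightarrow> complex" where
  "fourier_fun h k = (\<integral>x. h x * echar k x \<partial>torus_lebesgue)"

definition fejer :: "nat \<Rightarrow> 'n::finite torus \<Rightarrow> real" where
  "fejer N \<theta> = (cmod (\<Sum>k\<in>{k :: int ^ 'n. \<forall>i. k $ i \<in> {1..int N}}. echar k \<theta>))\<^sup>2 / real N ^ CARD('n)"

definition F_set :: "nat \<Rightarrow> (int ^ 'n) set" where
  "F_set N = {k. \<forall>i. k $ i \<in> {- int N + 1..int N - 1}}"

text \<open>The linear order on the index type is the enumeration of the coordinates: below, \<open>j\<close> is the
  position of the first non-zero coordinate of \<open>k\<close>.\<close>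

definition Fplus :: "nat \<Rightarrow> (int ^ 'n::{finite,linorder}) set" where
  "Fplus N = {k \<in> F_set N - {0}. \<exists>j. 0 < k $ j \<and> (\<forall>i<j. k $ i = 0)}"

definition int_vec_norm :: "int ^ 'n::finite \<Rightarrow> real" where
  "int_vec_norm k = norm (\<chi> i. real_of_int (k $ i))"


section \<open>The measures on Fourier coefficients and their images\<close>

text \<open>Lebesgue measure on \<open>\<complex>\<close>-valued families indexed by \<^term>\<open>Fplus N\<close>, that is, on a real vector
  space of dimension \<open>2 |Fplus N|\<close>; \<^term>\<open>lborel\<close> on \<open>\<complex>\<close> is planar Lebesgue measure.
  The elements of the space are the functions that are \<^const>\<open>undefined\<close> outside \<^term>\<open>Fplus N\<close>.\<close>

definition coeff_lebesgue :: "nat \<Rightarrow> (int ^ 'n::{finite,linorder} \<Rightarrow> complex) measure" where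
  "coeff_lebesgue N = Pi\<^sub>M (Fplus N) (\<lambda>_. lborel)"

definition trig_poly :: "nat \<Rightarrow> (int ^ 'n::{finite,linorder} \<Rightarrow> complex) \<Rightarrow> 'n torus \<Rightarrow> real" where
  "trig_poly N z x = 1 + 2 * Re (\<Sum>k\<in>Fplus N. z k * echar (- k) x)"

definition O_set :: "nat \<Rightarrow> (int ^ 'n::{finite,linorder} \<Rightarrow> complex) set" where
  "O_set N = {z \<in> space (coeff_lebesgue N). (INF x. trig_poly N z x) > 0}"

definition O_lebesgue :: "nat \<Rightarrow> (int ^ 'n::{finite,linorder} \<Rightarrow> complex) measure" where
  "O_lebesgue N = restrict_space (coeff_lebesgue N) (O_set N)"

text \<open>Only meaningful for \<^term>\<open>z \<in> O_set N\<close>; elsewhere the density may be negative somewhere and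
  the value is unspecified. The measures pushed forward by this map live on \<^term>\<open>O_set N\<close>.\<close>

definition I_map :: "nat \<Rightarrow> (int ^ 'n::{finite,linorder} \<Rightarrow> complex) \<Rightarrow> 'n torus_prob" where
  "I_map N z = Abs_torus_prob (density torus_lebesgue (\<lambda>x. ennreal (trig_poly N z x)))"

definition Gauss_weight :: "real \<Rightarrow> nat \<Rightarrow> (int ^ 'n::{finite,linorder} \<Rightarrow> complex) \<Rightarrow> real" where
  "Gauss_weight p N z =
     exp (- (\<Sum>k\<in>Fplus N. int_vec_norm k powr (2 * p * real CARD('n)) * (cmod (z k))\<^sup>2))"

definition Gauss_Z :: "'n::{finite,linorder} itself \<Rightarrow> real \<Rightarrow> nat \<Rightarrow> real" where
  "Gauss_Z _ p N = (\<integral>z. Gauss_weight p N z \<partial>(O_lebesgue N :: (int ^ 'n::{finite,linorder} \<Rightarrow> complex) measure))"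

definition Gamma_N :: "real \<Rightarrow> nat \<Rightarrow> (int ^ 'n::{finite,linorder} \<Rightarrow> complex) measure" where
  "Gamma_N p N =
     density (O_lebesgue N) (\<lambda>z. ennreal (Gauss_weight p N z / Gauss_Z TYPE('n) p N))"

definition P_N :: "real \<Rightarrow> nat \<Rightarrow> 'n::{finite,linorder} torus_prob measure" where
  "P_N p N = distr (Gamma_N p N) borel (I_map N)"

definition pi1 :: "nat \<Rightarrow> 'n::{finite,linorder} torus_prob \<Rightarrow> int ^ 'n::{finite,linorder} \<Rightarrow> complex" where
  "pi1 N m = (\<lambda>k\<in>Fplus N.
     fourier_measure (measure_of_torus_prob m) k * fourier_fun (\<lambda>x. of_real (fejer N x)) k)"

definition pi2 :: "nat \<Rightarrow> 'n::{finite,linorder} torus_prob \<Rightarrow> int ^ 'n::{finite,linorder} \<Rightarrow> complex" where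
  "pi2 N m = (\<lambda>k\<in>Fplus N. fourier_measure (measure_of_torus_prob m) k)"

text \<open>Lebesgue measure on \<^term>\<open>O_set N\<close>, viewed as a measure on the whole coefficient space;
  the complement of \<^term>\<open>O_set N\<close> is a null set.\<close>

definition coeff_lebesgue_on_O :: "nat \<Rightarrow> (int ^ 'n::{finite,linorder} \<Rightarrow> complex) measure" where
  "coeff_lebesgue_on_O N = density (coeff_lebesgue N) (indicator (O_set N))"

end

theory Submission
  imports Defs
begin

text \<open>
  Let \<open>z\<close> be a family of independent centred complex Gaussians, \<open>z k\<close> with density proportional to
  \<open>exp (- |k| powr (2 p d) |z k|\<^sup>2)\<close>. Then \<open>\<bbbP>\<^sub>N\<close> is the law of the density
  \<open>u\<^sub>N = 1 + 2 Re (\<Sum> z k e\<^bsub>-k\<^esub>)\<close>, the sum being over \<open>F\<^sub>N\<^sup>+\<close>, conditioned on \<open>u\<^sub>N > 0\<close>. Since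
  \<open>\<Sum> |k| |z k| < \<infinity>\<close> almost surely, \<open>u\<^sub>N\<close> converges in \<open>C\<^sup>1\<close> to a limit \<open>u\<close>, and \<open>\<bbbP>\<close> is the law of
  \<open>u\<close> conditioned on \<open>u > 0\<close>.
  The event \<open>min u = 0\<close> is null: with all coordinates but one frozen, the values of the remaining
  coordinate for which \<open>u \<ge> 0\<close> form a convex subset of the plane, and \<open>min u = 0\<close> only on its frontier.
  Hence the indicator of \<open>u\<^sub>N > 0\<close> converges almost surely to that of \<open>u > 0\<close>, which gives the weak
  convergence as well as (iii). For the full support, every measure is close to a positive
  trigonometric polynomial of mean one (Stone-Weierstrass), and \<open>u\<close> is uniformly close to that
  polynomial with positive probability, because finitely many coordinates and the tail are independent.
  For (ii), convolution with the Fejer kernel preserves positive lower bounds, so \<^const>\<open>pi1\<close> takes its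
  values in \<open>O\<^sub>N\<close>, and finitely many rescaled Gaussian coordinates have a density.
\<close>

section \<open>Characters of the torus\<close>

text \<open>Positivity of u_(N+1) need not imply positivity of u_N, so the conditioned laws do not
  form a consistent family. Realising all of them, and the limit, by one random family z makes them
  comparable. The Fourier coefficients of the measure attached to z return z itself; on functions of
  the first coefficients, P_N and P therefore differ only through the two conditioning events. This
  is why (iii) is uniform over all measurable test functions.

  The exponent enters through a first moment: with d the dimension, the mean of |z k| is a constant
  times |k|^(-p d), and at most a constant times n^d frequencies lie in the n-th cubic layer. The
  mean contribution of that layer to the sum of |k| |z k| is thus of order n^(1 + d - p d), which p
  \<ge> 5 makes summable.

  Measurability shapes many definitions: u, its minimum and its law are limits that exist only
  almost surely, so the maps are extended by a default value and the events are written through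
  limits of functions of finitely many coefficients.\<close>

type_synonym 'n frequency = "(int, 'n) vec"

type_synonym 'n coefficients = "'n frequency \<Rightarrow> complex"

lemma abs_torus_lipschitz: "1-lipschitz_on UNIV (abs_torus :: real ^ 'n::finite \<Rightarrow> 'n torus)"
  by (rule lipschitz_onI) (auto simp: dist_torus_le)

lemma continuous_on_abs_torus [continuous_intros]:
  "continuous_on A f \<Longrightarrow> continuous_on A (\<lambda>x. abs_torus (f x :: real ^ 'n::finite))"
  using lipschitz_on_continuous_on[OF abs_torus_lipschitz] continuous_on_compose2[of UNIV abs_torus A f]
  by auto

lemma measurable_abs_torus [measurable]: "abs_torus \<in> borel_measurable (borel :: (real ^ 'n::finite) measure)"
  by (intro borel_measurable_continuous_onI continuous_intros)

lemma compact_torus: "compact (UNIV :: 'n::finite torus set)"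
proof -
  have "compact (abs_torus ` cbox (0 :: real ^ 'n) 1)"
    by (intro compact_continuous_image continuous_intros) auto
  moreover have "x \<in> abs_torus ` cbox (0 :: real ^ 'n) 1" for x :: "'n torus"
  proof -
    obtain a where "abs_torus a = x" "\<forall>i. 0 \<le> a $ i \<and> a $ i < 1"
      using abs_torus_unit_cube by blast
    then show ?thesis
      by (intro image_eqI[of _ _ a]) (auto simp: mem_box_cart less_imp_le)
  qed
  ultimately show ?thesis
    by (metis UNIV_eq_I)
qed

text \<open>The quotient distance is an infimum over representatives, so a bound valid for all pairs
  of representatives passes to it after division by \<open>L\<close>. If \<open>L = 0\<close>, one
  pair of representatives already shows that the images coincide.\<close>

lemma lipschitz_on_torusI:
  fixes f :: "'n::finite torus \<Rightarrow> 'b::metric_space"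
  assumes "0 \<le> L" "\<And>a b. dist (f (abs_torus a)) (f (abs_torus b)) \<le> L * dist a b"
  shows "L-lipschitz_on UNIV f"
proof (rule lipschitz_onI)
  fix x y :: "'n torus"
  show "dist (f x) (f y) \<le> L * dist x y"
  proof (cases "L = 0")
    case True
    obtain a b where "abs_torus a = x" "abs_torus b = y"
      using abs_torus_surj by metis
    then show ?thesis
      using assms(2)[of a b] True by simp
  next
    case False
    with assms(1) have "L > 0" by simp
    moreover from this have "dist (f x) (f y) / L \<le> dist x y"
      using assms(2) by (intro dist_torus_greatest) (auto simp: field_simps)
    ultimately show ?thesis
      by (simp add: field_simps)
  qed
qed (use assms in auto)

definition kvec :: "int ^ 'n \<Rightarrow> real ^ 'n::finite" where
  "kvec k = (\<chi> i. real_of_int (k $ i))"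

lemma int_vec_norm_kvec: "int_vec_norm k = norm (kvec k)"
  by (simp add: int_vec_norm_def kvec_def)

lemma kvec_simps [simp]:
  "kvec 0 = 0" "kvec (k + l) = kvec k + kvec l" "kvec (- k) = - kvec k" "kvec (k - l) = kvec k - kvec l"
  "kvec k = 0 \<longleftrightarrow> k = 0"
  by (auto simp: kvec_def vec_eq_iff)

lemma echar_abs_torus: "echar k (abs_torus a) = cis (2 * pi * (kvec k \<bullet> a))"
proof -
  have "\<i> * 2 * complex_of_real pi * complex_of_real (\<Sum>i\<in>UNIV. real_of_int (k $ i) * a $ i)
      = \<i> * complex_of_real (2 * pi * (kvec k \<bullet> a))"
    by (simp add: inner_vec_def kvec_def mult_ac)
  then show ?thesis
    unfolding echar.abs_eq cis_conv_exp by (rule arg_cong)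
qed

lemma torus_cases: obtains a where "x = abs_torus a"
  using abs_torus_surj by metis

lemma norm_echar [simp]: "cmod (echar k x) = 1"
  by (cases x rule: torus_cases) (simp add: echar_abs_torus)

lemma echar_0 [simp]: "echar 0 x = 1"
  by (cases x rule: torus_cases) (simp add: echar_abs_torus)

lemma echar_add: "echar (k + l) x = echar k x * echar l x"
  by (cases x rule: torus_cases) (simp add: echar_abs_torus cis_mult inner_add_left algebra_simps)

lemma cnj_echar: "cnj (echar k x) = echar (- k) x"
  by (cases x rule: torus_cases) (simp add: echar_abs_torus cis_cnj)

lemma dist_cis_le: "dist (cis s) (cis t) \<le> \<bar>s - t\<bar>"
proof -
  have "cmod (cis s - cis t) = cmod (cis t * (cis (s - t) - 1))"
    by (simp add: algebra_simps cis_mult)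
  also have "\<dots> = 2 * \<bar>sin ((s - t) / 2)\<bar>"
    using dist_exp_i_1[of "s - t"] by (simp add: norm_mult cis_conv_exp)
  also have "\<dots> \<le> \<bar>s - t\<bar>"
    using abs_sin_x_le_abs_x[of "(s - t) / 2"] by simp
  finally show ?thesis
    by (simp add: dist_norm)
qed

text \<open>Makes the characters continuous and Borel on the quotient, and later the Fourier
  coefficients Lipschitz in the Wasserstein distance.\<close>

lemma echar_lipschitz: "(2 * pi * int_vec_norm k)-lipschitz_on UNIV (echar k)"
proof (rule lipschitz_on_torusI)
  fix a b
  have "dist (echar k (abs_torus a)) (echar k (abs_torus b)) \<le> 2 * pi * \<bar>kvec k \<bullet> (a - b)\<bar>"
    using dist_cis_le[of "2 * pi * (kvec k \<bullet> a)" "2 * pi * (kvec k \<bullet> b)"]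
    by (simp add: echar_abs_torus inner_diff_right abs_mult flip: right_diff_distrib)
  also have "\<dots> \<le> 2 * pi * (norm (kvec k) * norm (a - b))"
    by (intro mult_left_mono Cauchy_Schwarz_ineq2) auto
  finally show "dist (echar k (abs_torus a)) (echar k (abs_torus b)) \<le> 2 * pi * int_vec_norm k * dist a b"
    by (simp add: int_vec_norm_kvec dist_norm mult_ac)
qed (auto simp: int_vec_norm_kvec)

lemma continuous_on_echar [continuous_intros]: "continuous_on A (echar k)"
  using lipschitz_on_continuous_on[OF echar_lipschitz] continuous_on_subset by blast

lemma measurable_echar [measurable]: "echar k \<in> borel_measurable borel"
  by (intro borel_measurable_continuous_onI continuous_intros)

section \<open>Lebesgue measure on the torus and orthogonality of the characters\<close>

definition unit_cube :: "(real ^ 'n::finite) set" where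
  "unit_cube = {a. \<forall>i. 0 \<le> a $ i \<and> a $ i < 1}"

lemma unit_cube_measurable [measurable]: "unit_cube \<in> sets borel"
  unfolding unit_cube_def by measurable

lemma emeasure_unit_cube: "emeasure lborel (unit_cube :: (real ^ 'n::finite) set) = 1"
proof -
  have le: "emeasure lborel (unit_cube :: (real ^ 'n) set) \<le> emeasure lborel (cbox (0 :: real ^ 'n) 1)"
    by (intro emeasure_mono) (auto simp: unit_cube_def mem_box_cart less_imp_le)
  have ge: "emeasure lborel (box (0 :: real ^ 'n) 1) \<le> emeasure lborel (unit_cube :: (real ^ 'n) set)"
    by (intro emeasure_mono) (auto simp: unit_cube_def mem_box_cart less_imp_le)
  have one: "(1 :: real ^ 'n) \<bullet> b = 1" if "b \<in> Basis" for b
    using that by (auto simp: Basis_vec_def inner_axis)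
  have cbox: "emeasure lborel (cbox (0 :: real ^ 'n) 1) = 1"
    by (subst emeasure_lborel_cbox) (auto simp: one)
  have box: "emeasure lborel (box (0 :: real ^ 'n) 1) = 1"
    by (subst emeasure_lborel_box) (auto simp: one)
  from le ge cbox box show ?thesis
    by simp
qed

lemma sets_torus_lebesgue [simp, measurable_cong]: "sets torus_lebesgue = sets borel"
  and space_torus_lebesgue [simp]: "space torus_lebesgue = UNIV"
  by (simp_all add: torus_lebesgue_def)

lemma prob_space_torus_lebesgue: "prob_space (torus_lebesgue :: 'n::finite torus measure)"
  unfolding torus_lebesgue_def unit_cube_def[symmetric]
proof (rule prob_space.prob_space_distr)
  show "prob_space (restrict_space lborel (unit_cube :: (real ^ 'n) set))"
    by (rule prob_spaceI) (simp add: emeasure_restrict_space emeasure_unit_cube space_restrict_space)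
qed (simp add: measurable_restrict_space1)

interpretation torus_lebesgue: prob_space torus_lebesgue
  by (rule prob_space_torus_lebesgue)

lemma integral_torus:
  fixes f :: "'n::finite torus \<Rightarrow> 'b::{banach, second_countable_topology}"
  assumes [measurable]: "f \<in> borel_measurable borel"
  shows "(\<integral>x. f x \<partial>torus_lebesgue) = (\<integral>a. indicator unit_cube a *\<^sub>R f (abs_torus a) \<partial>lborel)"
  unfolding torus_lebesgue_def unit_cube_def[symmetric]
  by (subst integral_distr) (auto simp: integral_restrict_space measurable_restrict_space1)

text \<open>The antiderivative takes equal values at both ends of a full period. It is applied on
  the closed interval; the half-open one, which fits the unit cube, differs by a single
  point.\<close>

lemma integral_cis_unit:
  fixes m :: int
  shows "(\<integral>t. indicator {0..<1::real} t *\<^sub>R cis (2 * pi * (of_int m * t)) \<partial>lborel) = (if m = 0 then 1 else 0)"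
    and "integrable lborel (\<lambda>t. indicator {0..<1::real} t *\<^sub>R cis (2 * pi * (of_int m * t)))"
proof -
  have cont: "continuous_on {0..1} (\<lambda>t. cis (2 * pi * (of_int m * t)))"
    by (intro continuous_intros)
  have ae: "AE t in lborel. indicator {0..1::real} t *\<^sub>R cis (2 * pi * (of_int m * t)) =
      indicator {0..<1::real} t *\<^sub>R cis (2 * pi * (of_int m * t))"
    using AE_lborel_singleton[of "1::real"] by eventually_elim (auto simp: indicator_def)
  have meas: "(\<lambda>t. cis (2 * pi * (of_int m * t))) \<in> borel_measurable (borel :: real measure)"
    by (intro borel_measurable_continuous_onI continuous_intros)
  have int: "integrable lborel (\<lambda>t. indicator {0..1::real} t *\<^sub>R cis (2 * pi * (of_int m * t)))"
    using borel_integrable_compact[OF _ cont] by simp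
  show "integrable lborel (\<lambda>t. indicator {0..<1::real} t *\<^sub>R cis (2 * pi * (of_int m * t)))"
    by (rule integrable_cong_AE_imp[OF int]) (use meas ae in auto)
  have "(\<integral>t. indicator {0..<1::real} t *\<^sub>R cis (2 * pi * (of_int m * t)) \<partial>lborel) =
     (\<integral>t. indicator {0..1::real} t *\<^sub>R cis (2 * pi * (of_int m * t)) \<partial>lborel)"
    by (rule integral_cong_AE) (use meas ae in auto)
  also have "\<dots> = (if m = 0 then 1 else 0)"
  proof (cases "m = 0")
    case False
    define c where "c = 2 * complex_of_real pi * of_int m * \<i>"
    have cis: "cis (2 * pi * (of_int m * t)) = exp (of_real t * c)" for t
      by (simp add: cis_conv_exp c_def mult_ac)
    define F where "F t = exp (of_real t * c) / c" for t :: real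
    have "(\<integral>t. indicator {0..1::real} t *\<^sub>R cis (2 * pi * (of_int m * t)) \<partial>lborel) = F 1 - F 0"
    proof (rule integral_FTC_Icc)
      fix x :: real
      have "c \<noteq> 0"
        using False by (simp add: c_def)
      then have "((\<lambda>z. exp (z * c) / c) has_field_derivative cis (2 * pi * (of_int m * x))) (at (of_real x))"
        unfolding cis by (auto intro!: derivative_eq_intros)
      from has_vector_derivative_real_field[OF this]
      show "(F has_vector_derivative cis (2 * pi * (of_int m * x))) (at x within {0..1})"
        unfolding F_def by (rule has_vector_derivative_at_within)
    qed (use cont in auto)
    also have "F 1 = F 0"
      using cis_multiple_2pi[of "of_int m"] cis[of 1] cis[of 0] by (simp add: F_def)
    finally show ?thesis
      using False by simp
  qed simp
  finally show "(\<integral>t. indicator {0..<1::real} t *\<^sub>R cis (2 * pi * (of_int m * t)) \<partial>lborel) = (if m = 0 then 1 else 0)" .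
qed

interpretation lborel_product: product_sigma_finite "\<lambda>_. lborel :: 'a::euclidean_space measure" ..

text \<open>On the unit cube the character splits into one factor per coordinate, and the product
  form of \<open>lborel\<close> reduces the claim to intervals.\<close>

lemma integral_echar:
  fixes k :: "int ^ 'n::finite"
  shows "(\<integral>x. echar k x \<partial>torus_lebesgue) = (if k = 0 then 1 else 0)"
proof -
  \<comment> \<open>\<open>lborel\<close> is a product over \<open>Basis\<close>, not over the index
    type, so the frequency has to be read off from basis vectors.\<close>
  define m :: "real ^ 'n \<Rightarrow> int" where "m b = k $ (THE i. b = axis i 1)" for b
  have m: "m (axis i 1) = k $ i" for i
    by (simp add: m_def axis_eq_axis)
  have m': "kvec k \<bullet> b = of_int (m b)" if "b \<in> Basis" for b
    using that by (auto simp: Basis_vec_def m inner_axis kvec_def)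
  define \<phi> where "\<phi> b t = indicator {0..<1::real} t *\<^sub>R cis (2 * pi * (of_int (m b) * t))" for b t
  have F: "indicator unit_cube a *\<^sub>R cis (2 * pi * (kvec k \<bullet> a)) = (\<Prod>b\<in>Basis. \<phi> b (a \<bullet> b))" for a
  proof (cases "a \<in> unit_cube")
    case True
    then have "a \<bullet> b \<in> {0..<1}" if "b \<in> Basis" for b
      using that by (auto simp: unit_cube_def Basis_vec_def inner_axis)
    then have "(\<Prod>b\<in>Basis. \<phi> b (a \<bullet> b)) = (\<Prod>b\<in>Basis. cis (2 * pi * (of_int (m b) * (a \<bullet> b))))"
      by (intro prod.cong) (auto simp: \<phi>_def)
    also have "\<dots> = cis (\<Sum>b\<in>Basis. 2 * pi * (of_int (m b) * (a \<bullet> b)))"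
      by (simp add: cis_conv_exp exp_sum sum_distrib_left)
    also have "(\<Sum>b\<in>Basis. 2 * pi * (of_int (m b) * (a \<bullet> b))) = 2 * pi * (kvec k \<bullet> a)"
      by (subst euclidean_inner) (simp add: sum_distrib_left m')
    finally show ?thesis
      using True by simp
  next
    case False
    then obtain i where "a $ i \<notin> {0..<1}"
      by (auto simp: unit_cube_def not_le)
    then have "\<phi> (axis i 1) (a \<bullet> axis i 1) = 0" "axis i 1 \<in> (Basis :: (real ^ 'n) set)"
      by (auto simp: \<phi>_def inner_axis Basis_vec_def)
    then show ?thesis
      using False by (metis (no_types, lifting) finite_Basis indicator_simps(2) prod_zero scaleR_zero_left)
  qed
  have "(\<integral>x. echar k x \<partial>torus_lebesgue) = (\<integral>a. indicator unit_cube a *\<^sub>R cis (2 * pi * (kvec k \<bullet> a)) \<partial>lborel)"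
    by (subst integral_torus) (auto simp: echar_abs_torus)
  also have "\<dots> = (\<integral>a. (\<Prod>b\<in>Basis. \<phi> b (a \<bullet> b)) \<partial>lborel)"
    by (simp add: F)
  also have "\<dots> = (\<integral>g. (\<Prod>b\<in>Basis. \<phi> b (g b)) \<partial>(\<Pi>\<^sub>M b\<in>(Basis::(real ^ 'n) set). lborel))"
    by (subst lborel_eq, subst integral_distr) (auto simp: \<phi>_def cis_conv_exp intro!: Bochner_Integration.integral_cong prod.cong)
  also have "\<dots> = (\<Prod>b\<in>(Basis::(real ^ 'n) set). \<integral>t. \<phi> b t \<partial>lborel)"
    by (rule lborel_product.product_integral_prod) (auto simp: \<phi>_def integral_cis_unit)
  also have "\<dots> = (\<Prod>b\<in>(Basis::(real ^ 'n) set). if m b = 0 then 1 else 0)"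
    unfolding \<phi>_def integral_cis_unit ..
  also have "\<dots> = (if k = 0 then 1 else 0)"
  proof (cases "k = 0")
    case True
    then show ?thesis by (simp add: m_def)
  next
    case False
    then obtain i where "k $ i \<noteq> 0"
      by (auto simp: vec_eq_iff)
    then have "m (axis i 1) \<noteq> 0" "axis i 1 \<in> (Basis :: (real ^ 'n) set)"
      by (auto simp: m Basis_vec_def)
    then show ?thesis
      using False by (auto intro!: prod_zero)
  qed
  finally show ?thesis .
qed

lemma bounded_continuous_torus:
  fixes f :: "'n::finite torus \<Rightarrow> 'b::real_normed_vector"
  assumes "continuous_on UNIV f"
  obtains B where "B > 0" "\<And>x. norm (f x) \<le> B"
  using compact_imp_bounded[OF compact_continuous_image[OF assms compact_torus]]
  by (auto simp: bounded_pos)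

lemma integrable_continuous_torus:
  fixes f :: "'n::finite torus \<Rightarrow> 'b::{banach, second_countable_topology}"
  assumes "continuous_on UNIV f" "finite_measure M" "sets M = sets borel"
  shows "integrable M f"
proof -
  interpret finite_measure M by fact
  obtain B where "\<And>x. norm (f x) \<le> B"
    using bounded_continuous_torus[OF assms(1)] by blast
  then show ?thesis
    using borel_measurable_continuous_onI[OF assms(1)]
    by (intro integrable_const_bound[of _ B]) (auto simp: measurable_cong_sets[OF assms(3) refl])
qed

lemma integrable_torus_lebesgue:
  fixes f :: "'n::finite torus \<Rightarrow> 'b::{banach, second_countable_topology}"
  assumes "continuous_on UNIV f"
  shows "integrable torus_lebesgue f"
  by (rule integrable_continuous_torus[OF assms]) (auto intro: torus_lebesgue.finite_measure_axioms)

lemma integrable_torus_prob_continuous: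
  fixes f :: "'n::finite torus \<Rightarrow> 'b::{banach, second_countable_topology}"
  assumes "continuous_on UNIV f"
  shows "integrable (measure_of_torus_prob m) f"
  using prob_space_torus_prob[of m]
  by (intro integrable_continuous_torus[OF assms]) (auto simp: prob_space_def)

text \<open>A representative in the half-open cube may lie on the boundary, but it is in the closure
  of the open cube. Every ball around it therefore meets the open cube in a non-empty open set,
  which has positive volume.\<close>

lemma emeasure_torus_lebesgue_open:
  fixes U :: "'n::finite torus set"
  assumes "open U" "U \<noteq> {}"
  shows "emeasure torus_lebesgue U > 0"
proof -
  obtain x where x: "x \<in> U"
    using assms by blast
  obtain a where a: "abs_torus a = x" "\<forall>i. 0 \<le> a $ i \<and> a $ i < 1"
    using abs_torus_unit_cube by blast
  have "open (abs_torus -` U)"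
    using assms by (intro open_vimage continuous_intros) auto
  moreover have "a \<in> abs_torus -` U"
    using a x by simp
  ultimately obtain e where e: "e > 0" "ball a e \<subseteq> abs_torus -` U"
    by (rule openE)
  have "(\<chi> i. 1 / 2) \<in> box (0 :: real ^ 'n) 1"
    by (simp add: mem_box_cart)
  then have "closure (box 0 1) = cbox (0 :: real ^ 'n) 1"
    by (intro closure_box) blast
  moreover have "a \<in> cbox 0 1"
    using a by (simp add: mem_box_cart less_imp_le)
  ultimately have "a \<in> closure (box 0 1)"
    by simp
  moreover have "a \<in> ball a e"
    using e by simp
  ultimately have "ball a e \<inter> box 0 1 \<noteq> {}"
    using open_Int_closure_eq_empty[OF open_ball[of a e], of "box 0 1"] by blast
  then have "box 0 1 \<inter> ball a e \<noteq> {}"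
    by (simp add: Int_commute)
  then have "\<not> negligible (box 0 1 \<inter> ball a e)"
    by (intro open_not_negligible) auto
  then have "emeasure lborel (box 0 1 \<inter> ball a e) > 0"
    by (simp add: negligible_iff_null_sets null_sets_completion_iff null_sets_def zero_less_iff_neq_zero)
  also have "emeasure lborel (box 0 1 \<inter> ball a e) \<le> emeasure lborel (abs_torus -` U \<inter> unit_cube)"
  proof (rule emeasure_mono)
    show "box 0 1 \<inter> ball a e \<subseteq> abs_torus -` U \<inter> unit_cube"
      using e by (auto simp: unit_cube_def mem_box_cart less_imp_le)
    have "abs_torus -` U \<in> sets (borel :: (real ^ 'n) measure)"
      by (rule borel_open) fact
    then show "abs_torus -` U \<inter> unit_cube \<in> sets lborel"
      by simp
  qed
  also have "\<dots> = emeasure torus_lebesgue U"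
  proof -
    have "abs_torus \<in> restrict_space lborel unit_cube \<rightarrow>\<^sub>M (borel :: 'n torus measure)"
      by (rule measurable_restrict_space1) simp
    moreover have "U \<in> sets borel"
      using assms by simp
    ultimately show ?thesis
      unfolding torus_lebesgue_def unit_cube_def[symmetric]
      by (simp add: emeasure_distr emeasure_restrict_space space_restrict_space)
  qed
  finally show ?thesis .
qed

section \<open>Trigonometric polynomials and densities\<close>

lemma finite_F_set [simp, intro]: "finite (F_set N :: (int ^ 'n::finite) set)"
proof -
  have "F_set N \<subseteq> vec_lambda ` (UNIV \<rightarrow>\<^sub>E {- int N + 1..int N - 1} :: ('n \<Rightarrow> int) set)"
  proof
    fix k :: "int ^ 'n" assume "k \<in> F_set N"
    then show "k \<in> vec_lambda ` (UNIV \<rightarrow>\<^sub>E {- int N + 1..int N - 1})"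
      by (intro image_eqI[of _ _ "vec_nth k"]) (auto simp: F_set_def)
  qed
  then show ?thesis
    by (rule finite_subset) (auto intro!: finite_PiE)
qed

lemma finite_Fplus [simp, intro]: "finite (Fplus N)"
  unfolding Fplus_def by (rule finite_subset[OF _ finite_F_set[of N]]) auto

lemma F_set_mono: "N \<le> M \<Longrightarrow> F_set N \<subseteq> F_set M"
  unfolding F_set_def by (auto, (smt (verit, best) of_nat_mono)+)

lemma Fplus_mono: "N \<le> M \<Longrightarrow> Fplus N \<subseteq> Fplus M"
  using F_set_mono[of N M] by (auto simp: Fplus_def)

lemma uminus_F_set: "- k \<in> F_set N \<longleftrightarrow> k \<in> F_set N"
proof -
  have "- k \<in> F_set N" if "k \<in> F_set N" for k :: "int ^ 'n"
    unfolding F_set_def mem_Collect_eq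
  proof
    fix i
    from that have "k $ i \<in> {- int N + 1..int N - 1}"
      by (auto simp: F_set_def)
    then show "(- k) $ i \<in> {- int N + 1..int N - 1}"
      by auto
  qed
  from this[of k] this[of "- k"] show ?thesis by auto
qed

lemma F_set_cases: "\<exists>N. (k :: int ^ 'n::finite) \<in> F_set N"
proof -
  define B where "B = (\<Sum>i\<in>UNIV. \<bar>k $ i\<bar>)"
  have B: "\<bar>k $ i\<bar> \<le> B" for i
    unfolding B_def by (rule member_le_sum) auto
  then have "B \<ge> 0"
    by (meson abs_ge_zero order_trans)
  have "k \<in> F_set (nat B + 1)"
    unfolding F_set_def mem_Collect_eq
  proof
    fix i
    from B[of i] \<open>B \<ge> 0\<close> show "k $ i \<in> {- int (nat B + 1) + 1..int (nat B + 1) - 1}"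
      by (auto simp: abs_le_iff)
  qed
  then show ?thesis ..
qed

text \<open>The first non-zero coordinates of \<open>k\<close> and \<open>- k\<close> sit at the
  same place with opposite signs, whatever the two levels. With \<open>Fplus_or_uminus\<close> this
  makes the positive frequencies a half-system.\<close>

lemma Fplus_not_uminus:
  assumes "k \<in> Fplus N" shows "- k \<notin> Fplus M"
proof
  assume "- k \<in> Fplus M"
  then obtain j where j: "0 < (- k) $ j" "\<forall>i<j. (- k) $ i = 0"
    by (auto simp: Fplus_def)
  obtain j' where j': "0 < k $ j'" "\<forall>i<j'. k $ i = 0"
    using assms by (auto simp: Fplus_def)
  have "j < j' \<or> j = j' \<or> j' < j" by auto
  with j j' show False by auto
qed

lemma Fplus_nonzero: "k \<in> Fplus N \<Longrightarrow> k \<noteq> 0"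
  by (auto simp: Fplus_def)

lemma Fplus_or_uminus:
  fixes k :: "'n::{finite,linorder} frequency"
  assumes "k \<in> F_set N" "k \<noteq> 0"
  shows "k \<in> Fplus N \<or> - k \<in> Fplus N"
proof -
  define j where "j = Min {i. k $ i \<noteq> 0}"
  have ne: "{i. k $ i \<noteq> 0} \<noteq> {}"
    using assms(2) by (auto simp: vec_eq_iff)
  have "k $ j \<noteq> 0"
    using Min_in[OF _ ne] by (auto simp: j_def)
  moreover have "k $ i = 0" if "i < j" for i
    using that Min_le[of "{i. k $ i \<noteq> 0}" i] by (fastforce simp: j_def)
  ultimately consider "0 < k $ j \<and> (\<forall>i<j. k $ i = 0)" | "0 < (- k) $ j \<and> (\<forall>i<j. (- k) $ i = 0)"
    by fastforce
  then show ?thesis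
  proof cases
    case 1
    then have "k \<in> Fplus N"
      using assms unfolding Fplus_def by blast
    then show ?thesis ..
  next
    case 2
    then have "- k \<in> Fplus N"
      using assms uminus_F_set[of k N] unfolding Fplus_def by auto
    then show ?thesis ..
  qed
qed

text \<open>\<open>F_set 0\<close> is empty; the frequency 0 belongs to \<open>F_set N\<close> from
  \<open>N = 1\<close> on.\<close>

lemma F_set_decompose:
  fixes N :: nat
  assumes "N \<ge> 1"
  shows "F_set N = insert 0 (Fplus N \<union> uminus ` Fplus N :: 'n::{finite,linorder} frequency set)"
proof
  show "F_set N \<subseteq> insert 0 (Fplus N \<union> uminus ` Fplus N :: 'n frequency set)"
  proof
    fix k :: "'n frequency" assume "k \<in> F_set N"
    then have "k = 0 \<or> k \<in> Fplus N \<or> - k \<in> Fplus N"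
      using Fplus_or_uminus by blast
    moreover have "k \<in> uminus ` Fplus N" if "- k \<in> Fplus N"
      using imageI[OF that, of uminus] by simp
    ultimately show "k \<in> insert 0 (Fplus N \<union> uminus ` Fplus N)"
      by blast
  qed
  have "0 \<in> F_set N"
    using assms by (auto simp: F_set_def)
  then show "insert 0 (Fplus N \<union> uminus ` Fplus N :: 'n frequency set) \<subseteq> F_set N"
    using uminus_F_set[of _ N] unfolding Fplus_def by blast
qed

text \<open>Twice the real part is the sum with the conjugate; this two-sided form is the one on
  which orthogonality acts.\<close>

lemma of_real_trig_poly:
  "complex_of_real (trig_poly N z x) = 1 + (\<Sum>k\<in>Fplus N. z k * echar (- k) x + cnj (z k) * echar k x)"
proof -
  define S where "S = (\<Sum>k\<in>Fplus N. z k * echar (- k) x)"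
  have "cnj S = (\<Sum>k\<in>Fplus N. cnj (z k) * echar k x)"
    by (simp add: S_def cnj_echar)
  then show ?thesis
    unfolding trig_poly_def S_def[symmetric] sum.distrib
    using complex_add_cnj[of S] by (simp add: add.assoc)
qed

lemma trig_poly_eq_sum: "trig_poly N z x = 1 + (\<Sum>k\<in>Fplus N. 2 * Re (z k * echar (- k) x))"
  unfolding trig_poly_def Re_sum sum_distrib_left ..

lemma trig_poly_cong: "(\<And>k. k \<in> Fplus N \<Longrightarrow> z k = w k) \<Longrightarrow> trig_poly N z x = trig_poly N w x"
  unfolding trig_poly_def by simp

lemma trig_poly_restrict [simp]: "trig_poly N (restrict z (Fplus N)) = trig_poly N z"
  by (auto intro!: trig_poly_cong)

lemma continuous_on_trig_poly [continuous_intros]: "continuous_on A (trig_poly N z)"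
  unfolding trig_poly_def[abs_def] by (intro continuous_intros)

lemma abs_trig_poly_summand_le: "\<bar>2 * Re (w * echar k x)\<bar> \<le> 2 * cmod w"
  using abs_Re_le_cmod[of "w * echar k x"] by (simp add: norm_mult)

lemma trig_poly_diff_le:
  "\<bar>trig_poly N z x - trig_poly N w x\<bar> \<le> (\<Sum>k\<in>Fplus N. 2 * cmod (z k - w k))"
proof -
  have "trig_poly N z x - trig_poly N w x = (\<Sum>k\<in>Fplus N. 2 * Re ((z k - w k) * echar (- k) x))"
    by (simp add: trig_poly_eq_sum sum_subtractf[symmetric] left_diff_distrib right_diff_distrib)
  also have "\<bar>\<dots>\<bar> \<le> (\<Sum>k\<in>Fplus N. 2 * cmod (z k - w k))"
    by (rule order_trans[OF sum_abs sum_mono]) (rule abs_trig_poly_summand_le)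
  finally show ?thesis .
qed

lemma trig_poly_mono_diff:
  assumes "N \<le> M"
  shows "trig_poly M z x - trig_poly N z x = (\<Sum>k\<in>Fplus M - Fplus N. 2 * Re (z k * echar (- k) x))"
  using sum_diff[OF finite_Fplus Fplus_mono[OF assms], of "\<lambda>k. 2 * Re (z k * echar (- k) x)"]
  unfolding trig_poly_eq_sum by linarith

lemma trig_poly_pad:
  assumes "N \<le> M" "\<And>k. k \<notin> Fplus N \<Longrightarrow> z k = 0"
  shows "trig_poly M z = trig_poly N z"
  using trig_poly_mono_diff[OF assms(1), of z] assms(2) by auto

lemma integral_trig_poly_echar:
  "(\<integral>x. echar k x * complex_of_real (trig_poly N z x) \<partial>torus_lebesgue) =
     (if k = 0 then 1 else 0) + (\<Sum>j\<in>Fplus N. (if k = j then z j else 0) + (if k = - j then cnj (z j) else 0))"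
proof -
  have "echar k x * complex_of_real (trig_poly N z x) =
      echar k x + (\<Sum>j\<in>Fplus N. z j * echar (k - j) x + cnj (z j) * echar (k + j) x)" for x
    using echar_add[of k "- _" x]
    by (simp add: of_real_trig_poly distrib_left sum_distrib_left echar_add mult_ac)
  then have "(\<integral>x. echar k x * complex_of_real (trig_poly N z x) \<partial>torus_lebesgue) =
     (\<integral>x. echar k x \<partial>torus_lebesgue) +
     (\<Sum>j\<in>Fplus N. z j * (\<integral>x. echar (k - j) x \<partial>torus_lebesgue) + cnj (z j) * (\<integral>x. echar (k + j) x \<partial>torus_lebesgue))"
    by (simp add: integrable_torus_lebesgue continuous_intros)
  then show ?thesis
    unfolding integral_echar
    by (simp add: if_distrib[where f="\<lambda>x. _ * x"] add_eq_0_iff2 cong: if_cong)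
qed

text \<open>Orthogonality leaves the terms with \<open>k = j\<close> and those with
  \<open>k = - j\<close>; the latter cannot occur within a half-system.\<close>

lemma fourier_trig_poly:
  assumes "k \<in> Fplus N"
  shows "(\<integral>x. echar k x * complex_of_real (trig_poly N z x) \<partial>torus_lebesgue) = z k"
proof -
  have "k \<noteq> - j" if "j \<in> Fplus N" for j
    using Fplus_not_uminus[OF that, of N] assms by auto
  then have "(\<Sum>j\<in>Fplus N. (if k = j then z j else 0) + (if k = - j then cnj (z j) else 0)) =
      (\<Sum>j\<in>Fplus N. (if k = j then z j else 0))"
    by (intro sum.cong) auto
  then show ?thesis
    using assms Fplus_nonzero[OF assms] by (simp add: integral_trig_poly_echar)
qed

lemma integral_trig_poly: "(\<integral>x. trig_poly N z x \<partial>torus_lebesgue) = 1"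
proof -
  have "j \<noteq> 0" if "j \<in> Fplus N" for j :: "int ^ 'a::{finite,linorder}"
    using that by (rule Fplus_nonzero)
  then have "(\<integral>x. complex_of_real (trig_poly N z x) \<partial>torus_lebesgue) = 1"
    using integral_trig_poly_echar[of 0 N z] by (simp add: eq_commute[of 0] cong: sum.cong)
  then show ?thesis
    by (simp only: integral_complex_of_real of_real_eq_1_iff)
qed

section \<open>Measures with a continuous density and continuity of Fourier coefficients\<close>

definition torus_density :: "('n::finite torus \<Rightarrow> real) \<Rightarrow> bool" where
  "torus_density u \<longleftrightarrow> continuous_on UNIV u \<and> (\<forall>x. 0 \<le> u x) \<and> (\<integral>x. u x \<partial>torus_lebesgue) = 1"

text \<open>The construction of \<open>I_map\<close> for an arbitrary density, so that the limit
  measures are built in the same way. It is meaningful for instance under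
  \<open>torus_density\<close>; without a probability density the value is unspecified.\<close>

definition density_prob :: "('n::finite torus \<Rightarrow> real) \<Rightarrow> 'n torus_prob" where
  "density_prob u = Abs_torus_prob (density torus_lebesgue (\<lambda>x. ennreal (u x)))"

lemma torus_densityD:
  assumes "torus_density u"
  shows "continuous_on UNIV u" "0 \<le> u x" "(\<integral>x. u x \<partial>torus_lebesgue) = 1" "u \<in> borel_measurable borel"
  using assms by (auto simp: torus_density_def intro!: borel_measurable_continuous_onI)

lemma measure_of_density_prob:
  assumes "torus_density u"
  shows "measure_of_torus_prob (density_prob u) = density torus_lebesgue (\<lambda>x. ennreal (u x))"
proof -
  note u = torus_densityD[OF assms]
  have "prob_space (density torus_lebesgue (\<lambda>x. ennreal (u x)))"
  proof (rule prob_spaceI)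
    have "(\<integral>\<^sup>+x. ennreal (u x) \<partial>torus_lebesgue) = 1"
      using u by (subst nn_integral_eq_integral) (auto intro: integrable_torus_lebesgue)
    then show "emeasure (density torus_lebesgue (\<lambda>x. ennreal (u x)))
        (space (density torus_lebesgue (\<lambda>x. ennreal (u x)))) = 1"
      using u(4) by (simp add: emeasure_density)
  qed
  then show ?thesis
    unfolding density_prob_def by (intro Abs_torus_prob_inverse) simp
qed

lemma integral_density_prob:
  fixes f :: "'n::finite torus \<Rightarrow> 'b::{banach, second_countable_topology}"
  assumes "torus_density u" "f \<in> borel_measurable borel"
  shows "(\<integral>x. f x \<partial>measure_of_torus_prob (density_prob u)) = (\<integral>x. u x *\<^sub>R f x \<partial>torus_lebesgue)"
  unfolding measure_of_density_prob[OF assms(1)]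
  using torus_densityD[OF assms(1)] assms(2) by (intro integral_density) auto

lemma fourier_density_prob:
  assumes "torus_density u"
  shows "fourier_measure (measure_of_torus_prob (density_prob u)) k =
    (\<integral>x. echar k x * complex_of_real (u x) \<partial>torus_lebesgue)"
  unfolding fourier_measure_def
  by (subst integral_density_prob[OF assms]) (auto simp: scaleR_conv_of_real mult_ac)

text \<open>Both densities have integral one, so a test function may be shifted by a constant
  without changing the difference of the integrals. After the shift it is bounded by the bound
  \<open>CARD('n)\<close> on the diameter.\<close>

lemma dist_density_prob_le:
  fixes u v :: "'n::finite torus \<Rightarrow> real"
  assumes u: "torus_density u" and v: "torus_density v" and le: "\<And>x. \<bar>u x - v x\<bar> \<le> e"
  shows "dist (density_prob u) (density_prob v) \<le> real CARD('n) * e"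
proof (rule dist_torus_prob_le)
  fix \<phi> :: "'n torus \<Rightarrow> real" assume \<phi>: "1-lipschitz_on UNIV \<phi>"
  have c\<phi>: "continuous_on UNIV \<phi>"
    using \<phi> by (rule lipschitz_on_continuous_on)
  note cu = torus_densityD(1)[OF u] and cv = torus_densityD(1)[OF v]
  define c where "c = \<phi> undefined"
  have *: "\<bar>\<phi> x - c\<bar> \<le> real CARD('n)" for x
    using lipschitz_onD[OF \<phi>, of x undefined] dist_torus_bounded[of x undefined]
    by (simp add: dist_real_def c_def)
  have [simp]: "integrable torus_lebesgue f" if "continuous_on UNIV f" for f :: "'n torus \<Rightarrow> real"
    using that by (rule integrable_torus_lebesgue)
  have m: "\<phi> \<in> borel_measurable borel"
    using c\<phi> by (rule borel_measurable_continuous_onI)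
  have "(\<integral>x. \<phi> x \<partial>measure_of_torus_prob (density_prob u)) - (\<integral>x. \<phi> x \<partial>measure_of_torus_prob (density_prob v))
     = (\<integral>x. u x * \<phi> x \<partial>torus_lebesgue) - (\<integral>x. v x * \<phi> x \<partial>torus_lebesgue)"
    by (simp add: integral_density_prob u v m)
  also have "\<dots> = (\<integral>x. (u x - v x) * (\<phi> x - c) \<partial>torus_lebesgue)"
  proof -
    have "(\<integral>x. (u x - v x) * (\<phi> x - c) \<partial>torus_lebesgue) =
      (\<integral>x. u x * \<phi> x - v x * \<phi> x - c * (u x - v x) \<partial>torus_lebesgue)"
      by (simp add: algebra_simps)
    also have "\<dots> = (\<integral>x. u x * \<phi> x \<partial>torus_lebesgue) - (\<integral>x. v x * \<phi> x \<partial>torus_lebesgue) -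
        c * ((\<integral>x. u x \<partial>torus_lebesgue) - (\<integral>x. v x \<partial>torus_lebesgue))"
      using cu cv c\<phi> by (simp add: continuous_intros)
    finally show ?thesis
      using torus_densityD(3)[OF u] torus_densityD(3)[OF v] by simp
  qed
  also have "\<bar>\<dots>\<bar> \<le> (\<integral>x. real CARD('n) * e \<partial>(torus_lebesgue :: 'n torus measure))"
  proof -
    have bnd: "\<bar>(u x - v x) * (\<phi> x - c)\<bar> \<le> real CARD('n) * e" for x
      using mult_mono[OF le[of x] *[of x]] order_trans[OF abs_ge_zero le[of x]]
      by (simp add: abs_mult mult_ac)
    have "(\<integral>x. \<bar>(u x - v x) * (\<phi> x - c)\<bar> \<partial>torus_lebesgue) \<le> (\<integral>x. real CARD('n) * e \<partial>(torus_lebesgue :: 'n torus measure))"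
      by (rule Bochner_Integration.integral_mono) (use bnd cu cv c\<phi> in \<open>auto intro!: integrable_torus_lebesgue continuous_intros\<close>)
    then show ?thesis
      using integral_abs_bound[of torus_lebesgue "\<lambda>x. (u x - v x) * (\<phi> x - c)"] by linarith
  qed
  finally show "\<bar>(\<integral>x. \<phi> x \<partial>measure_of_torus_prob (density_prob u)) -
      (\<integral>x. \<phi> x \<partial>measure_of_torus_prob (density_prob v))\<bar> \<le> real CARD('n) * e"
    by (simp add: torus_lebesgue.prob_space[simplified])
qed

lemma abs_integral_diff_le_lipschitz:
  fixes \<phi> :: "'n::finite torus \<Rightarrow> real"
  assumes "L > 0" "L-lipschitz_on UNIV \<phi>"
  shows "\<bar>(\<integral>x. \<phi> x \<partial>measure_of_torus_prob m) - (\<integral>x. \<phi> x \<partial>measure_of_torus_prob m')\<bar> \<le> L * dist m m'"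
proof -
  have "1-lipschitz_on UNIV (\<lambda>x. \<phi> x / L)"
  proof (rule lipschitz_onI)
    fix x y
    have "\<bar>\<phi> x - \<phi> y\<bar> \<le> L * dist x y"
      using lipschitz_onD[OF assms(2), of x y] by (simp add: dist_real_def)
    then show "dist (\<phi> x / L) (\<phi> y / L) \<le> 1 * dist x y"
      using assms(1) by (simp add: dist_real_def field_simps flip: diff_divide_distrib)
  qed simp
  from dist_torus_prob_ge[OF this, of m m'] show ?thesis
    using assms(1) by (simp add: field_simps flip: diff_divide_distrib)
qed

lemma continuous_on_fourier_measure: "continuous_on UNIV (\<lambda>m. fourier_measure (measure_of_torus_prob m) k)"
proof -
  \<comment> \<open>The summand 1 keeps the constant positive when \<open>k = 0\<close>: test
    functions are divided by it.\<close>
  define L where "L = 2 * pi * int_vec_norm k + 1"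
  have L: "L > 0"
    by (simp add: L_def int_vec_norm_def add_nonneg_pos)
  have lip: "L-lipschitz_on UNIV (\<lambda>x. Re (echar k x))" "L-lipschitz_on UNIV (\<lambda>x. Im (echar k x))"
  proof -
    have *: "L-lipschitz_on UNIV (echar k)"
      by (rule lipschitz_on_le[OF echar_lipschitz]) (simp add: L_def)
    show "L-lipschitz_on UNIV (\<lambda>x. Re (echar k x))" "L-lipschitz_on UNIV (\<lambda>x. Im (echar k x))"
      using L order_trans[OF abs_Re_le_cmod lipschitz_onD[OF *, unfolded dist_norm]]
        order_trans[OF abs_Im_le_cmod lipschitz_onD[OF *, unfolded dist_norm]]
      by (auto intro!: lipschitz_onI simp: dist_real_def dist_norm)
  qed
  have "continuous_on UNIV (\<lambda>m. \<integral>x. \<phi> x \<partial>measure_of_torus_prob m)" if "L-lipschitz_on UNIV \<phi>" for \<phi> :: "'a torus \<Rightarrow> real"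
    using abs_integral_diff_le_lipschitz[OF L that] L
    by (intro lipschitz_on_continuous_on[of L] lipschitz_onI) (auto simp: dist_real_def)
  from this[OF lip(1)] this[OF lip(2)]
  have "continuous_on UNIV (\<lambda>m. Complex (\<integral>x. Re (echar k x) \<partial>measure_of_torus_prob m)
      (\<integral>x. Im (echar k x) \<partial>measure_of_torus_prob m))"
    unfolding Complex_eq by (intro continuous_intros)
  moreover have "Complex (\<integral>x. Re (echar k x) \<partial>measure_of_torus_prob m) (\<integral>x. Im (echar k x) \<partial>measure_of_torus_prob m)
      = fourier_measure (measure_of_torus_prob m) k" for m
    unfolding fourier_measure_def
    by (rule complex_eqI) (simp_all add: integrable_torus_prob_continuous continuous_intros)
  ultimately show ?thesis
    by simp
qed

lemma measurable_fourier_measure [measurable]: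
  "(\<lambda>m. fourier_measure (measure_of_torus_prob m) k) \<in> borel_measurable borel"
  by (intro borel_measurable_continuous_onI continuous_on_fourier_measure)

lemma sets_coeff_lebesgue: "sets (coeff_lebesgue N) = sets (Pi\<^sub>M (Fplus N) (\<lambda>_. borel))"
  unfolding coeff_lebesgue_def by (intro sets_PiM_cong) auto

lemma measurable_pi2 [measurable]: "pi2 N \<in> borel \<rightarrow>\<^sub>M coeff_lebesgue N"
  unfolding measurable_cong_sets[OF refl sets_coeff_lebesgue] pi2_def[abs_def] by measurable

lemma measurable_pi1 [measurable]: "pi1 N \<in> borel \<rightarrow>\<^sub>M coeff_lebesgue N"
  unfolding measurable_cong_sets[OF refl sets_coeff_lebesgue] pi1_def[abs_def] by measurable

section \<open>Minima over the torus and the set of positive polynomials\<close>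

lemma INF_torus_attained:
  fixes u :: "'n::finite torus \<Rightarrow> real"
  assumes "continuous_on UNIV u"
  obtains x0 where "(INF x. u x) = u x0" "\<And>x. u x0 \<le> u x"
proof -
  obtain x0 where "\<And>x. u x0 \<le> u x"
    using continuous_attains_inf[OF compact_torus _ assms] by auto
  moreover from this have "(INF x. u x) = u x0"
    by (intro cInf_eq_minimum) auto
  ultimately show ?thesis
    using that by blast
qed

lemma INF_torus_diff_le:
  fixes u v :: "'n::finite torus \<Rightarrow> real"
  assumes "continuous_on UNIV u" "continuous_on UNIV v" "\<And>x. \<bar>u x - v x\<bar> \<le> e"
  shows "\<bar>(INF x. u x) - (INF x. v x)\<bar> \<le> e"
proof -
  obtain x where x: "(INF x. u x) = u x" "\<And>y. u x \<le> u y"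
    using INF_torus_attained[OF assms(1)] by blast
  obtain y where y: "(INF x. v x) = v y" "\<And>z. v y \<le> v z"
    using INF_torus_attained[OF assms(2)] by blast
  show ?thesis
    using assms(3)[of x] assms(3)[of y] x(2)[of y] y(2)[of x] unfolding x(1) y(1) by linarith
qed

lemma INF_torus_pos_iff:
  fixes u :: "'n::finite torus \<Rightarrow> real"
  assumes "continuous_on UNIV u"
  shows "0 < (INF x. u x) \<longleftrightarrow> (\<forall>x. 0 < u x)"
  by (rule INF_torus_attained[OF assms]) (metis less_le_trans)

lemma O_set_iff: "z \<in> O_set N \<longleftrightarrow> z \<in> space (coeff_lebesgue N) \<and> (\<forall>x. 0 < trig_poly N z x)"
  unfolding O_set_def by (simp add: INF_torus_pos_iff continuous_intros)

lemma I_map_eq: "I_map N z = density_prob (trig_poly N z)"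
  by (simp add: I_map_def density_prob_def)

lemma torus_density_trig_poly: "(\<And>x. 0 < trig_poly N z x) \<Longrightarrow> torus_density (trig_poly N z)"
  by (auto simp: torus_density_def integral_trig_poly continuous_intros less_imp_le)

text \<open>On positive polynomials \<open>pi2 N\<close> inverts \<open>I_map N\<close>. Test
  functions of the coefficients of the measure thus become functions of the Gaussian coefficients
  themselves.\<close>

lemma pi2_I_map:
  assumes "\<And>x. 0 < trig_poly N z x"
  shows "pi2 N (I_map N z) = restrict z (Fplus N)"
  unfolding pi2_def I_map_eq fourier_density_prob[OF torus_density_trig_poly[OF assms]]
  by (auto simp: fourier_trig_poly)

section \<open>The Fejer kernel\<close>

definition pos_box :: "nat \<Rightarrow> (int ^ 'n::finite) set" where
  "pos_box N = {k. \<forall>i. k $ i \<in> {1..int N}}"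

lemma pos_box_eq: "(pos_box N :: (int ^ 'n::finite) set) = vec_lambda ` (UNIV \<rightarrow>\<^sub>E {1..int N})"
proof
  show "pos_box N \<subseteq> vec_lambda ` (UNIV \<rightarrow>\<^sub>E {1..int N} :: ('n \<Rightarrow> int) set)"
  proof
    fix k :: "int ^ 'n" assume "k \<in> pos_box N"
    then show "k \<in> vec_lambda ` (UNIV \<rightarrow>\<^sub>E {1..int N})"
      by (intro image_eqI[of _ _ "vec_nth k"]) (auto simp: pos_box_def)
  qed
qed (auto simp: pos_box_def PiE_iff)

lemma finite_pos_box [simp, intro]: "finite (pos_box N)"
  unfolding pos_box_eq by (intro finite_imageI finite_PiE) auto

lemma card_pos_box: "card (pos_box N :: (int ^ 'n::finite) set) = N ^ CARD('n)"
  unfolding pos_box_eq by (subst card_image) (auto simp: card_PiE inj_on_def vec_lambda_inject)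

text \<open>Normalised autocorrelation of the indicator of \<open>pos_box N\<close>, that is, a
  Fourier coefficient of the Fejer kernel. Counting coordinate by coordinate gives the product of
  the factors 1 - |j_i| / N when \<open>j\<close> is in \<open>F_set N\<close>.\<close>

definition fejer_coeff :: "nat \<Rightarrow> int ^ 'n::finite \<Rightarrow> real" where
  "fejer_coeff N j = real (card {(a, b). a \<in> pos_box N \<and> b \<in> pos_box N \<and> a - b = j}) / real N ^ CARD('n)"

text \<open>This is \<open>f\<^sub>N(x - y)\<close>, written with characters of \<open>x\<close> and \<open>y\<close> so that no group structure on the
  torus is needed.\<close>

definition fejer_kernel :: "nat \<Rightarrow> 'n::finite torus \<Rightarrow> 'n torus \<Rightarrow> real" where
  "fejer_kernel N x y = (cmod (\<Sum>a\<in>pos_box N. echar a y * echar (- a) x))\<^sup>2 / real N ^ CARD('n)"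

lemma finite_pos_box_pairs: "finite {(a, b). a \<in> pos_box N \<and> b \<in> pos_box N \<and> P a b}"
  by (rule finite_subset[of _ "pos_box N \<times> pos_box N"]) auto

lemma fejer_coeff_uminus: "fejer_coeff N (- j) = fejer_coeff N j"
proof -
  have "bij_betw prod.swap {(a, b). a \<in> pos_box N \<and> b \<in> pos_box N \<and> a - b = - j}
    {(a, b). a \<in> pos_box N \<and> b \<in> pos_box N \<and> a - b = j}"
    by (rule bij_betwI[where g = prod.swap]) (auto simp: algebra_simps)
  from bij_betw_same_card[OF this] show ?thesis
    by (simp add: fejer_coeff_def)
qed

lemma fejer_coeff_0:
  assumes "N \<ge> 1"
  shows "fejer_coeff N (0 :: int ^ 'n::finite) = 1"
proof -
  have "{(a, b). a \<in> pos_box N \<and> b \<in> pos_box N \<and> a - b = 0} = (\<lambda>a. (a, a)) ` (pos_box N :: (int ^ 'n) set)"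
    by auto
  then show ?thesis
    using assms by (simp add: fejer_coeff_def card_image inj_on_def card_pos_box)
qed

lemma fejer_coeff_pos:
  fixes j :: "int ^ 'n::finite"
  assumes "N \<ge> 1" "j \<in> F_set N"
  shows "fejer_coeff N j > 0"
proof -
  \<comment> \<open>In each coordinate, the pair with difference \<open>j $ i\<close> whose smaller
    entry is 1; the larger one is at most \<open>N\<close> because |j_i| < N.\<close>
  define a b :: "int ^ 'n" where "a = (\<chi> i. if j $ i \<ge> 0 then j $ i + 1 else 1)"
    and "b = (\<chi> i. if j $ i \<ge> 0 then 1 else 1 - j $ i)"
  have j: "- int N + 1 \<le> j $ i" "j $ i \<le> int N - 1" for i
    using assms(2) by (auto simp: F_set_def)
  have "a \<in> pos_box N" "b \<in> pos_box N" "a - b = j"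
    using j assms(1) by (auto simp: pos_box_def a_def b_def vec_eq_iff) (smt (verit) j)+
  then have "(a, b) \<in> {(a, b). a \<in> pos_box N \<and> b \<in> pos_box N \<and> a - b = j}"
    by auto
  then have "card {(a, b). a \<in> pos_box N \<and> b \<in> pos_box N \<and> a - b = j} > 0"
    using finite_pos_box_pairs[of N "\<lambda>a b. a - b = j"] by (auto simp: card_gt_0_iff)
  then show ?thesis
    using assms(1) by (simp add: fejer_coeff_def)
qed

text \<open>The squared modulus is a double sum over pairs of box frequencies; grouping the pairs by
  their difference produces the coefficients.\<close>

lemma of_real_fejer_kernel:
  fixes x y :: "'n::finite torus"
  shows "complex_of_real (fejer_kernel N x y) =
    (\<Sum>j\<in>F_set N. complex_of_real (fejer_coeff N j) * (echar j y * echar (- j) x))"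
proof -
  define T where "T j = echar j y * echar (- j) x" for j
  have T: "T a * cnj (T b) = T (a - b)" for a b
    using echar_add[of a "- b" y] echar_add[of "- a" b x] by (simp add: T_def cnj_echar algebra_simps)
  let ?B = "pos_box N :: (int ^ 'n) set"
  have "complex_of_real ((cmod (\<Sum>a\<in>?B. T a))\<^sup>2) = (\<Sum>(a, b)\<in>?B \<times> ?B. T (a - b))"
    by (simp only: complex_norm_square cnj_sum sum_product sum.cartesian_product T)
  also have "\<dots> = (\<Sum>j\<in>F_set N. \<Sum>(a, b)\<in>{p \<in> ?B \<times> ?B. fst p - snd p = j}. T (a - b))"
  proof -
    have "(\<lambda>p. fst p - snd p) ` (?B \<times> ?B) \<subseteq> F_set N"
    proof (rule image_subsetI)
      fix p assume p: "p \<in> ?B \<times> ?B"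
      show "fst p - snd p \<in> F_set N"
        unfolding F_set_def mem_Collect_eq
      proof
        fix i
        from p have "fst p $ i \<in> {1..int N}" "snd p $ i \<in> {1..int N}"
          by (auto simp: pos_box_def)
        then show "(fst p - snd p) $ i \<in> {- int N + 1..int N - 1}"
          by auto
      qed
    qed
    from sum.group[OF _ _ this, of "\<lambda>(a, b). T (a - b)"] show ?thesis
      by simp
  qed
  also have "\<dots> = (\<Sum>j\<in>F_set N. of_nat (card {(a, b). a \<in> ?B \<and> b \<in> ?B \<and> a - b = j}) * T j)"
  proof (rule sum.cong[OF refl])
    fix j :: "int ^ 'n"
    have "{p \<in> ?B \<times> ?B. fst p - snd p = j} = {(a, b). a \<in> ?B \<and> b \<in> ?B \<and> a - b = j}"
      by auto
    moreover have "(\<Sum>(a, b)\<in>{(a, b). a \<in> ?B \<and> b \<in> ?B \<and> a - b = j}. T (a - b)) =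
      (\<Sum>(a, b)\<in>{(a, b). a \<in> ?B \<and> b \<in> ?B \<and> a - b = j}. T j)"
      by (intro sum.cong) auto
    ultimately show "(\<Sum>(a, b)\<in>{p \<in> ?B \<times> ?B. fst p - snd p = j}. T (a - b)) =
        of_nat (card {(a, b). a \<in> ?B \<and> b \<in> ?B \<and> a - b = j}) * T j"
      by simp
  qed
  finally show ?thesis
    by (simp add: fejer_kernel_def T_def fejer_coeff_def sum_divide_distrib field_simps)
qed

lemma fejer_eq_kernel: "fejer N \<theta> = fejer_kernel N (abs_torus 0) \<theta>"
proof -
  have "echar k (abs_torus 0) = 1" for k :: "int ^ 'a"
    by (simp add: echar_abs_torus)
  then show ?thesis
    by (simp add: fejer_def fejer_kernel_def pos_box_def)
qed

lemma fourier_fejer: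
  assumes "k \<in> F_set N"
  shows "fourier_fun (\<lambda>x. of_real (fejer N x)) k = of_real (fejer_coeff N k)"
proof -
  have e: "echar k (abs_torus 0) = 1" for k :: "int ^ 'a"
    by (simp add: echar_abs_torus)
  have "complex_of_real (fejer N x) * echar k x = (\<Sum>j\<in>F_set N. complex_of_real (fejer_coeff N j) * echar (j + k) x)" for x
    unfolding fejer_eq_kernel of_real_fejer_kernel sum_distrib_right
    by (intro sum.cong) (simp_all add: e echar_add)
  then have "fourier_fun (\<lambda>x. of_real (fejer N x)) k =
      (\<Sum>j\<in>F_set N. complex_of_real (fejer_coeff N j) * (\<integral>x. echar (j + k) x \<partial>torus_lebesgue))"
    by (simp add: fourier_fun_def integrable_torus_lebesgue continuous_intros)
  also have "\<dots> = (\<Sum>j\<in>F_set N. if j = - k then complex_of_real (fejer_coeff N j) else 0)"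
    by (intro sum.cong refl) (simp add: integral_echar eq_neg_iff_add_eq_0)
  also have "\<dots> = complex_of_real (fejer_coeff N k)"
    using assms by (simp add: uminus_F_set fejer_coeff_uminus)
  finally show ?thesis .
qed

lemma fourier_measure_uminus: "fourier_measure m (- k) = cnj (fourier_measure m k)"
  unfolding fourier_measure_def using Bochner_Integration.integral_cnj[of m "echar k"] by (simp only: cnj_echar)

lemma continuous_on_fejer_kernel: "continuous_on UNIV (fejer_kernel N x)"
  unfolding fejer_kernel_def[abs_def] divide_inverse by (intro continuous_intros)

text \<open>The polynomial with coefficients \<open>pi1 N m\<close> is the Fejer mean of
  \<open>m\<close>. The constant 1 in \<open>trig_poly\<close> is the frequency 0, where the kernel
  has coefficient 1 and \<open>m\<close> has mass 1.\<close>

lemma trig_poly_pi1: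
  assumes N: "N \<ge> 1"
  shows "trig_poly N (pi1 N m) x = (\<integral>y. fejer_kernel N x y \<partial>measure_of_torus_prob m)"
proof -
  let ?m = "measure_of_torus_prob m"
  interpret prob_space ?m by (rule prob_space_torus_prob)
  define S where "S j = complex_of_real (fejer_coeff N j) * (fourier_measure ?m j * echar (- j) x)" for j
  have "complex_of_real (\<integral>y. fejer_kernel N x y \<partial>?m) = (\<Sum>j\<in>F_set N. S j)"
    unfolding integral_complex_of_real[symmetric] of_real_fejer_kernel S_def fourier_measure_def
    by (simp add: integrable_torus_prob_continuous continuous_intros)
  also have "\<dots> = S 0 + ((\<Sum>j\<in>Fplus N. S j) + (\<Sum>j\<in>Fplus N. S (- j)))"
  proof -
    have "(\<Sum>j\<in>uminus ` Fplus N. S j) = (\<Sum>j\<in>Fplus N. S (- j))"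
      by (subst sum.reindex) (auto simp: inj_on_def)
    moreover have "Fplus N \<inter> uminus ` Fplus N = {}"
      using Fplus_not_uminus[of _ N N] by auto
    moreover have "0 \<notin> Fplus N \<union> uminus ` Fplus N"
      using Fplus_nonzero[of _ N] by auto
    ultimately show ?thesis
      unfolding F_set_decompose[OF N]
      using sum.union_disjoint[OF finite_Fplus finite_imageI[OF finite_Fplus[of N]], of N uminus S]
      by (subst sum.insert) auto
  qed
  also have "S 0 = 1"
    using fejer_coeff_0[OF N] prob_space by (simp add: S_def fourier_measure_def)
  also have "1 + ((\<Sum>j\<in>Fplus N. S j) + (\<Sum>j\<in>Fplus N. S (- j))) = complex_of_real (trig_poly N (pi1 N m) x)"
    unfolding of_real_trig_poly sum.distrib[symmetric]
    by (intro arg_cong2[of _ _ _ _ "(+)"] sum.cong refl)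
       (auto simp: S_def pi1_def fourier_fejer fejer_coeff_uminus fourier_measure_uminus Fplus_def mult_ac)
  finally show ?thesis
    by (simp only: of_real_eq_iff)
qed

lemma pi1_density_prob_in_O_set:
  fixes u :: "'n::{finite,linorder} torus \<Rightarrow> real"
  assumes "N \<ge> 1" "torus_density u" "\<And>x. u x > 0"
  shows "pi1 N (density_prob u) \<in> O_set N"
  unfolding O_set_iff
proof (intro conjI allI)
  show "pi1 N (density_prob u) \<in> space (coeff_lebesgue N)"
    by (auto simp: coeff_lebesgue_def space_PiM pi1_def)
  fix x :: "'n torus"
  have meas: "fejer_kernel N x \<in> borel_measurable borel"
    by (intro borel_measurable_continuous_onI continuous_on_fejer_kernel)
  note cu = torus_densityD(1)[OF assms(2)]
  obtain x0 where x0: "\<And>y. u x0 \<le> u y"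
    using INF_torus_attained[OF cu] by blast
  \<comment> \<open>The uniform measure has vanishing coefficients on \<open>Fplus N\<close>;
    \<open>trig_poly_pi1\<close> applied to it shows that the kernel has integral 1.\<close>
  have one: "torus_density (\<lambda>_ :: 'n torus. 1)"
    by (simp add: torus_density_def torus_lebesgue.prob_space[simplified])
  have "fourier_measure (measure_of_torus_prob (density_prob (\<lambda>_ :: 'n torus. 1))) k = 0" if "k \<in> Fplus N" for k
    using Fplus_nonzero[OF that] by (simp add: fourier_density_prob[OF one] integral_echar)
  then have "trig_poly N (pi1 N (density_prob (\<lambda>_ :: 'n torus. 1))) x = 1"
    by (simp add: trig_poly_def pi1_def)
  then have 1: "(\<integral>y. fejer_kernel N x y \<partial>torus_lebesgue) = 1"
    unfolding trig_poly_pi1[OF assms(1)] using meas by (simp add: integral_density_prob[OF one])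
  have "(\<integral>y. u x0 * fejer_kernel N x y \<partial>torus_lebesgue) \<le> (\<integral>y. u y * fejer_kernel N x y \<partial>torus_lebesgue)"
    by (intro Bochner_Integration.integral_mono integrable_torus_lebesgue continuous_intros continuous_on_fejer_kernel cu
        mult_right_mono x0) (simp add: fejer_kernel_def)
  also have "\<dots> = trig_poly N (pi1 N (density_prob u)) x"
    unfolding trig_poly_pi1[OF assms(1)] using meas by (simp add: integral_density_prob[OF assms(2)])
  finally show "0 < trig_poly N (pi1 N (density_prob u)) x"
    using 1 assms(3)[of x0] by simp
qed

section \<open>Density of trigonometric polynomials\<close>

text \<open>Complex trigonometric polynomials as an inductive closure, so that products and
  conjugates are handled by rule induction. The functions \<open>trig_poly N z\<close> are no
  algebra, as their mean is always 1.\<close>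

inductive trig_span :: "('n::finite torus \<Rightarrow> complex) \<Rightarrow> bool" where
  monom: "trig_span (\<lambda>x. c * echar k x)"
| add: "trig_span F \<Longrightarrow> trig_span G \<Longrightarrow> trig_span (\<lambda>x. F x + G x)"

lemma trig_span_mult_monom: "trig_span F \<Longrightarrow> trig_span (\<lambda>x. F x * (c * echar k x))"
proof (induction rule: trig_span.induct)
  case (monom d l)
  show ?case
    using trig_span.monom[of "d * c" "l + k"] by (simp add: echar_add mult_ac)
next
  case (add F G)
  then show ?case
    by (simp add: distrib_right trig_span.add)
qed

lemma trig_span_mult: "trig_span G \<Longrightarrow> trig_span F \<Longrightarrow> trig_span (\<lambda>x. F x * G x)"
  by (induction rule: trig_span.induct)
     (auto simp: distrib_left intro: trig_span.add trig_span_mult_monom)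

lemma trig_span_cnj: "trig_span F \<Longrightarrow> trig_span (\<lambda>x. cnj (F x))"
  by (induction rule: trig_span.induct) (auto simp: cnj_echar intro: trig_span.intros)

lemma trig_span_const: "trig_span (\<lambda>x. c)"
  using trig_span.monom[of c 0] by simp

lemma continuous_on_trig_span: "trig_span F \<Longrightarrow> continuous_on A F"
  by (induction rule: trig_span.induct) (auto intro!: continuous_intros)

text \<open>Representatives of distinct points differ by a non-integer in some coordinate; the unit
  frequency in that coordinate tells the points apart.\<close>

lemma echar_separates:
  fixes x y :: "'n::finite torus"
  assumes "x \<noteq> y"
  shows "\<exists>k. echar k x \<noteq> echar k y"
proof -
  obtain a b where ab: "x = abs_torus a" "y = abs_torus b"
    by (metis torus_cases)
  then obtain i where i: "a $ i - b $ i \<notin> \<int>"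
    using assms by (auto simp: abs_torus_eq_iff)
  have k: "kvec (axis i 1) \<bullet> c = c $ i" for c :: "real ^ 'n"
  proof -
    have "kvec (axis i 1) = (axis i 1 :: real ^ 'n)"
      by (auto simp: kvec_def vec_eq_iff axis_def)
    then show ?thesis
      by (simp add: inner_axis' )
  qed
  have "echar (axis i 1) x \<noteq> echar (axis i 1) y"
  proof
    assume "echar (axis i 1) x = echar (axis i 1) y"
    then have "exp (\<i> * complex_of_real (2 * pi * a $ i)) = exp (\<i> * complex_of_real (2 * pi * b $ i))"
      by (simp add: ab echar_abs_torus k cis_conv_exp)
    then obtain n :: int where "\<i> * complex_of_real (2 * pi * a $ i) = \<i> * complex_of_real (2 * pi * b $ i) + of_int (2 * n) * complex_of_real pi * \<i>"
      unfolding exp_eq by (auto simp: mult_ac)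
    then have "Im (\<i> * complex_of_real (2 * pi * a $ i)) = Im (\<i> * complex_of_real (2 * pi * b $ i) + of_int (2 * n) * complex_of_real pi * \<i>)"
      by (rule arg_cong)
    then have "2 * pi * a $ i = 2 * pi * b $ i + 2 * pi * of_int n"
      by simp
    then have "2 * pi * (a $ i - b $ i) = 2 * pi * of_int n"
      by (simp only: right_diff_distrib)
    then have "a $ i - b $ i = of_int n"
      by simp
    with i show False by simp
  qed
  then show ?thesis by blast
qed

text \<open>Taking real parts folds \<open>- k\<close> onto \<open>k\<close>. The mean is stored in
  \<open>c\<close>, with \<open>c - 1\<close> compensating the constant 1 of
  \<open>trig_poly\<close>. The coefficients vanish outside \<open>Fplus N\<close>, which lets two
  polynomials be raised to a common level.\<close>

lemma Re_trig_span:
  fixes F :: "'n::{finite,linorder} torus \<Rightarrow> complex"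
  assumes "trig_span F"
  shows "\<exists>N z c. (\<forall>k. k \<notin> Fplus N \<longrightarrow> z k = 0) \<and> (\<forall>x. Re (F x) = c - 1 + trig_poly N z x)"
  using assms
proof (induction rule: trig_span.induct)
  case (monom d k)
  obtain N where N: "k \<in> F_set N"
    using F_set_cases by blast
  consider "k = 0" | "k \<in> Fplus N" | "- k \<in> Fplus N"
    using Fplus_or_uminus[OF N] by blast
  then show ?case
  proof cases
    case 1
    then show ?thesis
      by (intro exI[of _ N] exI[of _ "\<lambda>_. 0"] exI[of _ "Re d"]) (simp add: trig_poly_def)
  next
    \<comment> \<open>\<open>trig_poly\<close> doubles the real part and uses
      \<open>echar (- k)\<close>; hence the factor 1/2 and the conjugate.\<close>
    case 2
    then have "(\<Sum>l\<in>Fplus N. (if l = k then cnj d / 2 else 0) * echar (- l) x) = cnj d / 2 * echar (- k) x" for x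
      by (simp add: if_distrib[of "\<lambda>a. a * _"] cong: if_cong)
    moreover have "Re (d * echar k x) = Re (cnj d * echar (- k) x)" for x
      by (simp add: cnj_echar[symmetric])
    ultimately have "trig_poly N (\<lambda>l. if l = k then cnj d / 2 else 0) x = 1 + Re (d * echar k x)" for x
      by (simp only: trig_poly_def) simp
    then show ?thesis
      using 2 by (intro exI[of _ N] exI[of _ "\<lambda>l. if l = k then cnj d / 2 else 0"] exI[of _ 0]) auto
  next
    case 3
    then have "(\<Sum>l\<in>Fplus N. (if l = - k then d / 2 else 0) * echar (- l) x) = d / 2 * echar k x" for x
      by (simp add: if_distrib[of "\<lambda>a. a * _"] cong: if_cong)
    then have "trig_poly N (\<lambda>l. if l = - k then d / 2 else 0) x = 1 + Re (d * echar k x)" for x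
      by (simp only: trig_poly_def) simp
    then show ?thesis
      using 3 by (intro exI[of _ N] exI[of _ "\<lambda>l. if l = - k then d / 2 else 0"] exI[of _ 0]) auto
  qed
next
  case (add F G)
  then obtain N z c M w d where F: "\<And>k. k \<notin> Fplus N \<Longrightarrow> z k = 0" "\<And>x. Re (F x) = c - 1 + trig_poly N z x"
    and G: "\<And>k. k \<notin> Fplus M \<Longrightarrow> w k = 0" "\<And>x. Re (G x) = d - 1 + trig_poly M w x"
    by blast
  let ?L = "max N M"
  have "trig_poly N z = trig_poly ?L z" "trig_poly M w = trig_poly ?L w"
    using trig_poly_pad[of N ?L z] trig_poly_pad[of M ?L w] F(1) G(1) by auto
  moreover have "trig_poly ?L (\<lambda>k. z k + w k) x = trig_poly ?L z x + trig_poly ?L w x - 1" for x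
    by (simp add: trig_poly_def distrib_right sum.distrib)
  ultimately show ?case
    using F G contra_subsetD[OF Fplus_mono[of N ?L, where 'a = 'n]] contra_subsetD[OF Fplus_mono[of M ?L, where 'a = 'n]]
    by (intro exI[of _ ?L] exI[of _ "\<lambda>k. z k + w k"] exI[of _ "c + d"]) auto
qed

lemma trig_poly_dense_continuous:
  fixes f :: "'n::{finite,linorder} torus \<Rightarrow> real"
  assumes "continuous_on UNIV f" "e > 0"
  obtains N z c where "\<And>k. k \<notin> Fplus N \<Longrightarrow> z k = 0" "\<And>x. \<bar>f x - (c - 1 + trig_poly N z x)\<bar> < e"
proof -
  define P where "P f \<longleftrightarrow> (\<exists>F. trig_span F \<and> (\<forall>x. f x = Re (F x)))" for f :: "'n torus \<Rightarrow> real"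
  have "\<exists>g. P g \<and> (\<forall>x\<in>UNIV. \<bar>f x - g x\<bar> < e)"
  proof (rule Stone_Weierstrass_HOL[where P = P])
    show "P (\<lambda>x. c)" for c
      unfolding P_def using trig_span_const[of "complex_of_real c"] by force
    show "continuous_on UNIV g" if "P g" for g
    proof -
      obtain F where F: "trig_span F" "g = (\<lambda>x. Re (F x))"
        using \<open>P g\<close> by (auto simp: P_def)
      then show ?thesis
        using continuous_on_trig_span[OF F(1)] by (auto intro!: continuous_intros)
    qed
    show "P (\<lambda>x. g x + h x)" if gh: "P g \<and> P h" for g h
    proof -
      obtain F G where "trig_span F" "\<forall>x. g x = Re (F x)" "trig_span G" "\<forall>x. h x = Re (G x)"
        using gh unfolding P_def by blast
      then show ?thesis
        unfolding P_def by (intro exI[of _ "\<lambda>x. F x + G x"]) (auto intro: trig_span.add)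
    qed
    show "P (\<lambda>x. g x * h x)" if gh: "P g \<and> P h" for g h
    proof -
      obtain F G where FG: "trig_span F" "\<forall>x. g x = Re (F x)" "trig_span G" "\<forall>x. h x = Re (G x)"
        using gh unfolding P_def by blast
      \<comment> \<open>Re F * Re G = Re (F * Re G), and Re G = (G + cnj G) / 2 is again in the
        span.\<close>
      have "trig_span (\<lambda>x. (1 / 2) * (F x * (G x + cnj (G x))))"
        using FG by (intro trig_span_mult trig_span.add trig_span_cnj trig_span_const)
      moreover have "\<forall>x. g x * h x = Re ((1 / 2) * (F x * (G x + cnj (G x))))"
        using FG by (simp add: complex_add_cnj)
      ultimately show ?thesis
        unfolding P_def by blast
    qed
    show "\<exists>g. P g \<and> g x \<noteq> g y" if xy: "x \<in> UNIV \<and> y \<in> UNIV \<and> x \<noteq> y" for x y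
    proof -
      obtain k where k: "echar k x \<noteq> echar k y"
        using echar_separates[of x y] xy by blast
      have "P (\<lambda>x. Re (c * echar k x))" for c
        unfolding P_def using trig_span.monom by blast
      from this[of 1] this[of "- \<i>"] have "P (\<lambda>x. Re (echar k x))" "P (\<lambda>x. Im (echar k x))"
        by simp_all
      then show ?thesis
        using k complex_eq_iff by blast
    qed
  qed (use assms compact_torus in auto)
  then obtain F where F: "trig_span F" "\<And>x. \<bar>f x - Re (F x)\<bar> < e"
    unfolding P_def by auto
  obtain N z c where "\<forall>k. k \<notin> Fplus N \<longrightarrow> z k = 0" "\<forall>x. Re (F x) = c - 1 + trig_poly N z x"
    using Re_trig_span[OF F(1)] by blast
  with F(2) show ?thesis
    using that[of N z c] by auto
qed

text \<open>Mixing \<open>h\<close> with the uniform density leaves room for the error of the polynomial approximation;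
  the mean is then corrected by a shift.\<close>

lemma torus_density_approx:
  fixes h :: "'n::{finite,linorder} torus \<Rightarrow> real"
  assumes h: "torus_density h" and e: "e > 0"
  obtains N z where "\<And>k. k \<notin> Fplus N \<Longrightarrow> z k = 0" "\<And>x. trig_poly N z x > 0"
    "\<And>x. \<bar>trig_poly N z x - h x\<bar> < e"
proof -
  note hD = torus_densityD[OF h]
  obtain B where B: "B > 0" "\<And>x. norm (h x) \<le> B"
    using bounded_continuous_torus[OF hD(1)] by blast
  define \<delta> where "\<delta> = min 1 (e / (2 * (1 + B)))"
  have "\<delta> * (1 + B) \<le> e / (2 * (1 + B)) * (1 + B)"
    using B(1) by (intro mult_right_mono) (auto simp: \<delta>_def)
  also have "\<dots> = e / 2"
    using B(1) by (simp add: divide_simps)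
  finally have \<delta>: "0 < \<delta>" "\<delta> \<le> 1" "\<delta> * (1 + B) \<le> e / 2"
    using B(1) e by (simp_all add: \<delta>_def)
  define h' where "h' x = (1 - \<delta>) * h x + \<delta>" for x
  \<comment> \<open>The polynomial will be within 2 * \<eta> \<le> \<delta> / 4 of
    \<open>h'\<close>, which is at least \<delta>; together with the mixing error
    \<open>e / 2\<close> the total stays below \<open>e\<close>.\<close>
  define \<eta> where "\<eta> = min \<delta> e / 8"
  have \<eta>: "\<eta> > 0" "8 * \<eta> \<le> \<delta>" "8 * \<eta> \<le> e"
    using \<delta> e by (auto simp: \<eta>_def)
  have ch': "continuous_on UNIV h'"
    unfolding h'_def by (intro continuous_intros hD)
  obtain N z c where z: "\<And>k. k \<notin> Fplus N \<Longrightarrow> z k = 0" and app: "\<And>x. \<bar>h' x - (c - 1 + trig_poly N z x)\<bar> < \<eta>"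
    using trig_poly_dense_continuous[OF ch' \<eta>(1)] by metis
  have "(\<integral>x. h' x \<partial>torus_lebesgue) = 1"
    unfolding h'_def using hD by (simp add: integrable_torus_lebesgue torus_lebesgue.prob_space[simplified])
  moreover have "(\<integral>x. c - 1 + trig_poly N z x \<partial>torus_lebesgue) = c"
    by (simp add: integrable_torus_lebesgue torus_lebesgue.prob_space[simplified] integral_trig_poly continuous_intros)
  moreover have "\<bar>(\<integral>x. h' x - (c - 1 + trig_poly N z x) \<partial>torus_lebesgue)\<bar> \<le> \<eta>"
  proof -
    have "(\<integral>x. \<bar>h' x - (c - 1 + trig_poly N z x)\<bar> \<partial>torus_lebesgue) \<le> (\<integral>x. \<eta> \<partial>(torus_lebesgue :: 'n torus measure))"
      by (intro Bochner_Integration.integral_mono integrable_torus_lebesgue continuous_intros ch' less_imp_le[OF app])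
    then show ?thesis
      by (intro order_trans[OF integral_abs_bound]) (simp add: torus_lebesgue.prob_space[simplified])
  qed
  ultimately have c: "\<bar>1 - c\<bar> \<le> \<eta>"
    by (simp add: integrable_torus_lebesgue ch' continuous_intros)
  have near: "\<bar>trig_poly N z x - h' x\<bar> < 2 * \<eta>" for x
    using app[of x] c by linarith
  have pos: "trig_poly N z x > 0" for x
  proof -
    have "h' x \<ge> \<delta>"
      using hD(2)[of x] \<delta> by (simp add: h'_def)
    then show ?thesis
      using near[of x] \<eta> by linarith
  qed
  have "\<bar>trig_poly N z x - h x\<bar> < e" for x
  proof -
    have "h' x - h x = \<delta> * (1 - h x)"
      by (simp add: h'_def algebra_simps)
    then have "\<bar>h' x - h x\<bar> = \<delta> * \<bar>1 - h x\<bar>"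
      using \<delta> by (simp add: abs_mult)
    also have "\<dots> \<le> \<delta> * (1 + B)"
      using B(2)[of x] \<delta> by (intro mult_left_mono) auto
    finally show ?thesis
      using near[of x] \<delta>(3) \<eta> e by linarith
  qed
  with z pos show ?thesis
    using that by blast
qed

text \<open>Where the weight lives, \<open>\<phi>\<close> is within \<open>r\<close> of its value at
  \<open>y\<close>. Applied to the given measure and to Lebesgue measure, this lets both be compared
  through point evaluations.\<close>

lemma localised_integral_lipschitz:
  fixes w \<phi> :: "'n::finite torus \<Rightarrow> real"
  assumes M: "finite_measure M" "sets M = sets borel" and \<phi>: "1-lipschitz_on UNIV \<phi>"
    and w: "continuous_on UNIV w" "\<And>x. 0 \<le> w x" "\<And>x. w x \<noteq> 0 \<Longrightarrow> dist y x \<le> r"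
  shows "\<bar>(\<integral>x. w x * \<phi> x \<partial>M) - \<phi> y * (\<integral>x. w x \<partial>M)\<bar> \<le> r * (\<integral>x. w x \<partial>M)"
proof -
  have c\<phi>: "continuous_on UNIV \<phi>"
    using \<phi> by (rule lipschitz_on_continuous_on)
  have [simp]: "integrable M f" if "continuous_on UNIV f" for f :: "'n torus \<Rightarrow> real"
    using integrable_continuous_torus[OF that M] .
  have bnd: "\<bar>w x * (\<phi> x - \<phi> y)\<bar> \<le> r * w x" for x
  proof (cases "w x = 0")
    case False
    then have "\<bar>\<phi> x - \<phi> y\<bar> \<le> r"
      using lipschitz_onD[OF \<phi>, of x y] w(3)[of x] by (simp add: dist_real_def dist_commute)
    then show ?thesis
      using w(2)[of x] by (simp add: abs_mult mult_left_mono mult.commute[of r])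
  qed simp
  have "(\<integral>x. w x * \<phi> x \<partial>M) - \<phi> y * (\<integral>x. w x \<partial>M) = (\<integral>x. w x * (\<phi> x - \<phi> y) \<partial>M)"
    using w(1) c\<phi> by (simp add: right_diff_distrib mult.commute[of _ "\<phi> y"] continuous_intros)
  also have "\<bar>\<dots>\<bar> \<le> (\<integral>x. \<bar>w x * (\<phi> x - \<phi> y)\<bar> \<partial>M)"
    by (rule integral_abs_bound)
  also have "\<dots> \<le> (\<integral>x. r * w x \<partial>M)"
    using bnd w(1) c\<phi> by (intro Bochner_Integration.integral_mono) (simp_all add: continuous_intros)
  finally show ?thesis
    by simp
qed

text \<open>Smear \<open>m\<close> out along a partition of unity subordinate to a finite cover by balls of radius \<open>r\<close>:
  this moves mass by at most \<open>2 r\<close>, and needs neither translations nor Fubini.\<close>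

lemma density_prob_dense:
  fixes m :: "'n::finite torus_prob"
  assumes "e > 0"
  obtains h where "torus_density h" "dist (density_prob h) m < e"
proof -
  define r where "r = e / 4"
  have r: "r > 0" using assms by (simp add: r_def)
  define M where "M = measure_of_torus_prob m"
  interpret M: prob_space M unfolding M_def by (rule prob_space_torus_prob)
  have M: "finite_measure M" "sets M = sets borel"
    by (auto simp: M_def M.finite_measure_axioms[unfolded M_def])
  have L: "finite_measure (torus_lebesgue :: 'n torus measure)" "sets (torus_lebesgue :: 'n torus measure) = sets borel"
    by (auto intro: torus_lebesgue.finite_measure_axioms)
  have int: "integrable M f" "integrable torus_lebesgue f" if "continuous_on UNIV f" for f :: "'n torus \<Rightarrow> real"
    using integrable_continuous_torus[OF that] M L by auto
  obtain Y where Y: "finite Y" "UNIV \<subseteq> (\<Union>y\<in>Y. ball (y :: 'n torus) r)"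
  proof (rule compactE_image[OF compact_torus, of UNIV "\<lambda>y. ball y r"])
    show "UNIV \<subseteq> (\<Union>y. ball (y :: 'n torus) r)"
      using r centre_in_ball by blast
  qed auto
  define \<psi> where "\<psi> y x = max 0 (r - dist y x)" for x y :: "'n torus"
  have c\<psi>: "continuous_on UNIV (\<psi> y)" for y
    unfolding \<psi>_def[abs_def] by (intro continuous_intros)
  have \<psi>0: "\<psi> y x \<ge> 0" for x y
    by (simp add: \<psi>_def)
  define s where "s x = (\<Sum>y\<in>Y. \<psi> y x)" for x
  have s: "s x > 0" for x
  proof -
    obtain y where "y \<in> Y" "dist y x < r"
      using Y(2) by fastforce
    then show ?thesis
      unfolding s_def using Y(1) by (intro sum_pos2[of _ y]) (auto simp: \<psi>_def)
  qed
  define p where "p y x = \<psi> y x / s x" for x y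
  have cp: "continuous_on UNIV (p y)" for y
    unfolding p_def[abs_def] s_def using s[unfolded s_def]
    by (intro continuous_intros c\<psi>) (auto simp: less_imp_neq[symmetric])
  have p0: "p y x \<ge> 0" for x y
    using \<psi>0[of y x] s[of x] by (simp add: p_def)
  have p1: "(\<Sum>y\<in>Y. p y x) = 1" for x
    using s[of x] by (simp add: p_def s_def flip: sum_divide_distrib)
  define a where "a y = (\<integral>x. \<psi> y x \<partial>torus_lebesgue)" for y
  have a: "a y > 0" for y
  proof -
    \<comment> \<open>On the ball of half the radius the bump is at least
      \<open>r / 2\<close>.\<close>
    have "0 < (r / 2) * measure torus_lebesgue (ball y (r / 2))"
      using emeasure_torus_lebesgue_open[of "ball y (r / 2)"] r
      by (simp add: torus_lebesgue.emeasure_eq_measure)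
    also have "\<dots> = (\<integral>x. (r / 2) * indicator (ball y (r / 2)) x \<partial>torus_lebesgue)"
      by simp
    also have "\<dots> \<le> a y"
      unfolding a_def using r
      by (intro Bochner_Integration.integral_mono int(2) c\<psi> integrable_mult_right integrable_real_indicator)
         (auto simp: \<psi>_def indicator_def torus_lebesgue.emeasure_eq_measure)
    finally show ?thesis .
  qed
  define c where "c y = (\<integral>x. p y x \<partial>M)" for y
  have c0: "c y \<ge> 0" for y
    unfolding c_def using p0 by simp
  have "(\<Sum>y\<in>Y. c y) = (\<integral>x. (\<Sum>y\<in>Y. p y x) \<partial>M)"
    unfolding c_def by (subst Bochner_Integration.integral_sum) (auto intro: int cp)
  then have c1: "(\<Sum>y\<in>Y. c y) = 1"
    by (simp add: p1 M.prob_space)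
  \<comment> \<open>The mass \<open>c y\<close> that \<open>m\<close> gives to the partition
    function at \<open>y\<close> is spread over the bump \<open>\<psi> y\<close>, normalised by its
    Lebesgue integral \<open>a y\<close>.\<close>
  define h where "h x = (\<Sum>y\<in>Y. c y / a y * \<psi> y x)" for x
  have ch: "continuous_on UNIV h"
    unfolding h_def[abs_def] by (intro continuous_intros c\<psi>)
  have h0: "h x \<ge> 0" for x
    unfolding h_def using c0 a \<psi>0 by (intro sum_nonneg mult_nonneg_nonneg divide_nonneg_pos) auto
  have an: "a y \<noteq> 0" for y
    using a[of y] by simp
  have "(\<integral>x. h x \<partial>torus_lebesgue) = (\<Sum>y\<in>Y. c y / a y * (\<integral>x. \<psi> y x \<partial>torus_lebesgue))"
    unfolding h_def by (subst Bochner_Integration.integral_sum) (auto intro!: int continuous_intros c\<psi> simp: an)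
  also have "\<dots> = (\<Sum>y\<in>Y. c y / a y * a y)"
    by (simp add: a_def)
  also have "\<dots> = 1"
    using c1 an by simp
  finally have h: "torus_density h"
    using ch h0 by (simp add: torus_density_def)
  \<comment> \<open>Both integrals of \<open>\<phi>\<close> are compared with the sum of
    \<open>c y * \<phi> y\<close>, each at cost \<open>r\<close>.\<close>
  have "dist (density_prob h) m \<le> 2 * r"
  proof (rule dist_torus_prob_le)
    fix \<phi> :: "'n torus \<Rightarrow> real" assume \<phi>: "1-lipschitz_on UNIV \<phi>"
    have c\<phi>: "continuous_on UNIV \<phi>"
      using \<phi> by (rule lipschitz_on_continuous_on)
    then have m\<phi>: "\<phi> \<in> borel_measurable borel"
      by (rule borel_measurable_continuous_onI)
    define A where "A y = (\<integral>x. \<psi> y x * \<phi> x \<partial>torus_lebesgue)" for y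
    define B where "B y = (\<integral>x. p y x * \<phi> x \<partial>M)" for y
    have Ay: "\<bar>c y / a y * A y - c y * \<phi> y\<bar> \<le> r * c y" for y
    proof -
      have "\<bar>A y - \<phi> y * a y\<bar> \<le> r * a y"
        unfolding A_def a_def
        by (rule localised_integral_lipschitz[OF L \<phi> c\<psi>]) (auto simp: \<psi>_def)
      then have "c y / a y * \<bar>A y - \<phi> y * a y\<bar> \<le> c y / a y * (r * a y)"
        using c0[of y] a[of y] by (intro mult_left_mono) auto
      moreover have "c y / a y * \<bar>A y - \<phi> y * a y\<bar> = \<bar>c y / a y * A y - c y * \<phi> y\<bar>"
      proof -
        have "c y / a y * \<bar>A y - \<phi> y * a y\<bar> = \<bar>c y / a y * (A y - \<phi> y * a y)\<bar>"
          using c0[of y] a[of y] by (simp add: abs_mult)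
        also have "c y / a y * (A y - \<phi> y * a y) = c y / a y * A y - c y * \<phi> y"
          using a[of y] by (simp add: field_simps)
        finally show ?thesis .
      qed
      ultimately show ?thesis
        using a[of y] by (simp add: mult.commute)
    qed
    have By: "\<bar>B y - c y * \<phi> y\<bar> \<le> r * c y" for y
      unfolding B_def c_def mult.commute[of _ "\<phi> y"]
      by (rule localised_integral_lipschitz[OF M \<phi> cp p0]) (auto simp: p_def \<psi>_def max_def split: if_splits)
    have "(\<integral>x. \<phi> x \<partial>measure_of_torus_prob (density_prob h)) = (\<integral>x. (\<Sum>y\<in>Y. c y / a y * (\<psi> y x * \<phi> x)) \<partial>torus_lebesgue)"
      by (simp add: integral_density_prob[OF h m\<phi>] h_def sum_distrib_right mult.assoc)
    also have "\<dots> = (\<Sum>y\<in>Y. c y / a y * A y)"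
      unfolding A_def by (subst Bochner_Integration.integral_sum) (auto intro!: int continuous_intros c\<psi> c\<phi> simp: an)
    finally have 1: "(\<integral>x. \<phi> x \<partial>measure_of_torus_prob (density_prob h)) = (\<Sum>y\<in>Y. c y / a y * A y)" .
    have "(\<integral>x. \<phi> x \<partial>M) = (\<integral>x. (\<Sum>y\<in>Y. p y x * \<phi> x) \<partial>M)"
      by (simp add: p1 flip: sum_distrib_right)
    also have "\<dots> = (\<Sum>y\<in>Y. B y)"
      unfolding B_def by (subst Bochner_Integration.integral_sum) (auto intro!: int continuous_intros cp c\<phi>)
    finally have "(\<integral>x. \<phi> x \<partial>measure_of_torus_prob (density_prob h)) - (\<integral>x. \<phi> x \<partial>M) =
        (\<Sum>y\<in>Y. (c y / a y * A y - c y * \<phi> y) - (B y - c y * \<phi> y))"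
      unfolding 1 by (simp add: sum_subtractf)
    also have "\<bar>\<dots>\<bar> \<le> (\<Sum>y\<in>Y. 2 * r * c y)"
    proof (rule order_trans[OF sum_abs sum_mono])
      fix y
      show "\<bar>(c y / a y * A y - c y * \<phi> y) - (B y - c y * \<phi> y)\<bar> \<le> 2 * r * c y"
        using Ay[of y] By[of y] by linarith
    qed
    also have "\<dots> = 2 * r"
      using c1 by (simp flip: sum_distrib_left)
    finally show "\<bar>(\<integral>x. \<phi> x \<partial>measure_of_torus_prob (density_prob h)) - (\<integral>x. \<phi> x \<partial>measure_of_torus_prob m)\<bar> \<le> 2 * r"
      by (simp add: M_def)
  qed
  also have "2 * r < e"
    using assms by (simp add: r_def)
  finally show ?thesis
    using h that by blast
qed

section \<open>Fourier series with summable weighted coefficients\<close>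

text \<open>The frequencies new at level \<open>Suc N\<close>. Grouping by shells turns sums over
  frequencies into series over the naturals whose partial sums match
  \<open>trig_poly\<close>.\<close>

definition shell :: "nat \<Rightarrow> 'n::{finite,linorder} frequency set" where
  "shell N = Fplus (Suc N) - Fplus N"

definition shell_sum :: "'n::{finite,linorder} coefficients \<Rightarrow> nat \<Rightarrow> real" where
  "shell_sum z N = (\<Sum>k\<in>shell N. int_vec_norm k * cmod (z k))"

text \<open>The weight |k| controls gradients, and since |k| \<ge> 1 the values as well. Continuity,
  differentiability and convergence of the series are all derived from this deterministic
  condition.\<close>

definition smooth_coeffs :: "'n::{finite,linorder} coefficients \<Rightarrow> bool" where
  "smooth_coeffs z \<longleftrightarrow> summable (shell_sum z)"

definition fourier_series :: "'n::{finite,linorder} coefficients \<Rightarrow> 'n torus \<Rightarrow> real" where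
  "fourier_series z x = lim (\<lambda>N. trig_poly N z x)"

text \<open>The sign condition in \<open>Fplus\<close> does not depend on the level, so
  \<open>k\<close> is missing from \<open>Fplus N\<close> by size alone: some coordinate is at least
  \<open>N\<close> in absolute value.\<close>

lemma int_vec_norm_shell:
  fixes k :: "'n::{finite,linorder} frequency"
  assumes "k \<in> shell N"
  shows "real N \<le> int_vec_norm k"
proof -
  have "k \<notin> F_set N"
    using assms by (auto simp: shell_def Fplus_def)
  then obtain i where i: "k $ i \<notin> {- int N + 1..int N - 1}"
    by (auto simp: F_set_def)
  then have "real N \<le> \<bar>real_of_int (k $ i)\<bar>"
    by auto
  also have "\<dots> \<le> int_vec_norm k"
    using component_le_norm_cart[of "kvec k" i] by (simp add: int_vec_norm_kvec kvec_def)
  finally show ?thesis .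
qed

lemma int_vec_norm_ge_1:
  fixes k :: "int ^ 'n::finite"
  assumes "k \<noteq> 0"
  shows "1 \<le> int_vec_norm k"
proof -
  obtain i where i: "k $ i \<noteq> 0"
    using assms by (auto simp: vec_eq_iff)
  then have "1 \<le> \<bar>real_of_int (k $ i)\<bar>"
    by simp
  also have "\<dots> \<le> int_vec_norm k"
    using component_le_norm_cart[of "kvec k" i] by (simp add: int_vec_norm_kvec kvec_def)
  finally show ?thesis .
qed

lemma shell_nonzero: "k \<in> shell N \<Longrightarrow> k \<noteq> 0"
  by (auto simp: shell_def dest: Fplus_nonzero)

lemma shell_sum_nonneg: "0 \<le> shell_sum z N"
  by (auto simp: shell_sum_def int_vec_norm_kvec intro!: sum_nonneg)

lemma Fplus_0 [simp]: "Fplus 0 = {}"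
  by (auto simp: Fplus_def F_set_def)

lemma trig_poly_0 [simp]: "trig_poly 0 z x = 1"
  by (simp add: trig_poly_def)

lemma abs_trig_poly_Suc_diff_le: "\<bar>trig_poly (Suc n) z x - trig_poly n z x\<bar> \<le> 2 * shell_sum z n"
proof -
  have "\<bar>trig_poly (Suc n) z x - trig_poly n z x\<bar> \<le> (\<Sum>k\<in>shell n. 2 * cmod (z k))"
    unfolding trig_poly_mono_diff[OF le_SucI[OF order_refl]] shell_def
    by (rule order_trans[OF sum_abs sum_mono]) (rule abs_trig_poly_summand_le)
  also have "\<dots> \<le> (\<Sum>k\<in>shell n. 2 * (int_vec_norm k * cmod (z k)))"
    using int_vec_norm_ge_1[OF shell_nonzero]
    by (intro sum_mono mult_left_mono) (auto simp: mult_le_cancel_right1)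
  finally show ?thesis
    by (simp add: shell_sum_def sum_distrib_left)
qed

context
  fixes z :: "'n::{finite,linorder} coefficients"
  assumes smooth: "smooth_coeffs z"
begin

lemma summable_shell_sum: "summable (shell_sum z)"
  using smooth by (simp add: smooth_coeffs_def)

lemma trig_poly_tendsto: "(\<lambda>N. trig_poly N z x) \<longlonglongrightarrow> fourier_series z x"
proof -
  have "summable (\<lambda>n. trig_poly (Suc n) z x - trig_poly n z x)"
    using abs_trig_poly_Suc_diff_le
    by (intro summable_comparison_test'[OF summable_mult[OF summable_shell_sum, of 2]]) simp
  then have "convergent (\<lambda>N. \<Sum>n<N. trig_poly (Suc n) z x - trig_poly n z x)"
    by (simp add: summable_iff_convergent)
  then have "convergent (\<lambda>N. trig_poly N z x - 1)"
    by (simp add: sum_lessThan_telescope[of "\<lambda>n. trig_poly n z x"])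
  then have "convergent (\<lambda>N. trig_poly N z x)"
    by (simp add: convergent_diff_const_right_iff)
  then show ?thesis
    by (simp add: fourier_series_def convergent_LIMSEQ_iff)
qed

text \<open>The bound is uniform in \<open>x\<close>. Continuity of the limit and convergence of
  minima, of integrals and in the Wasserstein distance all come from this tail.\<close>

lemma fourier_series_diff_le:
  "\<bar>fourier_series z x - trig_poly N z x\<bar> \<le> 2 * (\<Sum>n. shell_sum z (n + N))"
proof (rule LIMSEQ_le_const2[OF _ exI[of _ N]])
  show "(\<lambda>M. \<bar>trig_poly M z x - trig_poly N z x\<bar>) \<longlonglongrightarrow> \<bar>fourier_series z x - trig_poly N z x\<bar>"
    by (intro tendsto_intros trig_poly_tendsto)
  have sm: "summable (\<lambda>n. shell_sum z (n + N))"
    using summable_shell_sum by (simp add: summable_iff_shift)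
  show "\<forall>M\<ge>N. \<bar>trig_poly M z x - trig_poly N z x\<bar> \<le> 2 * (\<Sum>n. shell_sum z (n + N))"
  proof (intro allI impI)
    fix M assume MN: "M \<ge> N"
    have "trig_poly M z x - trig_poly N z x = (\<Sum>n<M - N. trig_poly (Suc n + N) z x - trig_poly (n + N) z x)"
      using MN sum_lessThan_telescope[of "\<lambda>n. trig_poly (n + N) z x" "M - N"] by simp
    also have "\<bar>\<dots>\<bar> \<le> (\<Sum>n<M - N. 2 * shell_sum z (n + N))"
      by (rule order_trans[OF sum_abs sum_mono]) (use abs_trig_poly_Suc_diff_le in simp)
    also have "\<dots> \<le> 2 * (\<Sum>n. shell_sum z (n + N))"
      using sum_le_suminf[OF sm] by (simp add: shell_sum_nonneg flip: sum_distrib_left)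
    finally show "\<bar>trig_poly M z x - trig_poly N z x\<bar> \<le> 2 * (\<Sum>n. shell_sum z (n + N))" .
  qed
qed

lemma shell_tail_tendsto_0: "(\<lambda>N. 2 * (\<Sum>n. shell_sum z (n + N))) \<longlonglongrightarrow> 0"
proof -
  have "(\<lambda>N. 2 * (suminf (shell_sum z) - (\<Sum>n<N. shell_sum z n))) \<longlonglongrightarrow> 2 * (suminf (shell_sum z) - suminf (shell_sum z))"
    by (intro tendsto_intros summable_LIMSEQ summable_shell_sum)
  then show ?thesis
    by (simp add: suminf_minus_initial_segment[OF summable_shell_sum])
qed

lemma continuous_on_fourier_series: "continuous_on UNIV (fourier_series z)"
proof (rule uniform_limit_theorem[where F = sequentially])
  show "uniform_limit UNIV (\<lambda>N. trig_poly N z) (fourier_series z) sequentially"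
    unfolding uniform_limit_iff
  proof safe
    fix e :: real assume "e > 0"
    from order_tendstoD(2)[OF shell_tail_tendsto_0 this]
    show "\<forall>\<^sub>F n in sequentially. \<forall>x\<in>UNIV. dist (trig_poly n z x) (fourier_series z x) < e"
    proof eventually_elim
      case (elim n)
      then show ?case
        using fourier_series_diff_le[of _ n] by (auto simp: dist_real_def abs_minus_commute intro: le_less_trans)
    qed
  qed
qed (auto intro!: always_eventually continuous_intros)

lemma INF_trig_poly_tendsto: "(\<lambda>N. INF x. trig_poly N z x) \<longlonglongrightarrow> (INF x. fourier_series z x)"
proof (rule LIM_zero_cancel, rule Lim_null_comparison[OF always_eventually[OF allI] shell_tail_tendsto_0])
  fix N
  have "\<bar>(INF x. trig_poly N z x) - (INF x. fourier_series z x)\<bar> \<le> 2 * (\<Sum>n. shell_sum z (n + N))"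
    using fourier_series_diff_le[of _ N]
    by (intro INF_torus_diff_le continuous_intros continuous_on_fourier_series) (simp add: abs_minus_commute)
  then show "norm ((INF x. trig_poly N z x) - (INF x. fourier_series z x)) \<le> 2 * (\<Sum>n. shell_sum z (n + N))"
    by simp
qed

lemma integral_fourier_series_tendsto:
  fixes e :: "'n torus \<Rightarrow> complex"
  assumes e: "continuous_on UNIV e" "\<And>x. cmod (e x) \<le> 1"
  shows "(\<lambda>N. \<integral>x. e x * complex_of_real (trig_poly N z x) \<partial>torus_lebesgue) \<longlonglongrightarrow>
     (\<integral>x. e x * complex_of_real (fourier_series z x) \<partial>torus_lebesgue)"
proof (rule LIM_zero_cancel, rule Lim_null_comparison[OF always_eventually[OF allI] shell_tail_tendsto_0])
  fix N
  let ?d = "2 * (\<Sum>n. shell_sum z (n + N))"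
  have "(\<integral>x. e x * complex_of_real (trig_poly N z x) \<partial>torus_lebesgue) -
      (\<integral>x. e x * complex_of_real (fourier_series z x) \<partial>torus_lebesgue) =
     (\<integral>x. e x * complex_of_real (trig_poly N z x) - e x * complex_of_real (fourier_series z x) \<partial>torus_lebesgue)"
    by (subst Bochner_Integration.integral_diff)
       (auto intro!: integrable_torus_lebesgue continuous_intros e continuous_on_fourier_series)
  also have "cmod \<dots> \<le> (\<integral>x. cmod (e x * complex_of_real (trig_poly N z x) - e x * complex_of_real (fourier_series z x)) \<partial>torus_lebesgue)"
    by (rule integral_norm_bound)
  also have "\<dots> \<le> (\<integral>x. ?d \<partial>(torus_lebesgue :: 'n torus measure))"
  proof (intro Bochner_Integration.integral_mono integrable_torus_lebesgue continuous_intros e continuous_on_fourier_series)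
    fix x
    have "cmod (e x * complex_of_real (trig_poly N z x) - e x * complex_of_real (fourier_series z x)) =
       cmod (e x) * \<bar>fourier_series z x - trig_poly N z x\<bar>"
      by (simp only: norm_mult norm_of_real abs_minus_commute flip: right_diff_distrib of_real_diff)
    also have "\<dots> \<le> 1 * ?d"
      by (intro mult_mono e fourier_series_diff_le) auto
    finally show "cmod (e x * complex_of_real (trig_poly N z x) - e x * complex_of_real (fourier_series z x)) \<le> ?d"
      by simp
  qed
  also have "\<dots> = ?d"
    by (simp add: torus_lebesgue.prob_space[simplified])
  finally show "norm ((\<integral>x. e x * complex_of_real (trig_poly N z x) \<partial>torus_lebesgue) -
      (\<integral>x. e x * complex_of_real (fourier_series z x) \<partial>torus_lebesgue)) \<le> ?d"
    by simp
qed

lemma torus_density_fourier_series: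
  assumes "\<And>x. 0 < fourier_series z x"
  shows "torus_density (fourier_series z)"
proof -
  have "(\<lambda>N. complex_of_real (\<integral>x. trig_poly N z x \<partial>torus_lebesgue)) \<longlonglongrightarrow>
     complex_of_real (\<integral>x. fourier_series z x \<partial>torus_lebesgue)"
    using integral_fourier_series_tendsto[of "\<lambda>_. 1"] by simp
  then have "complex_of_real (\<integral>x. fourier_series z x \<partial>torus_lebesgue) = 1"
    by (simp add: integral_trig_poly LIMSEQ_const_iff)
  then show ?thesis
    using assms by (simp add: torus_density_def continuous_on_fourier_series less_imp_le)
qed

lemma fourier_fourier_series:
  assumes "k \<in> Fplus N"
  shows "(\<integral>x. echar k x * complex_of_real (fourier_series z x) \<partial>torus_lebesgue) = z k"
proof (rule LIMSEQ_unique[OF integral_fourier_series_tendsto tendsto_eventually])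
  show "\<forall>\<^sub>F M in sequentially. (\<integral>x. echar k x * complex_of_real (trig_poly M z x) \<partial>torus_lebesgue) = z k"
    using eventually_ge_at_top[of N]
    by eventually_elim (use assms Fplus_mono in \<open>blast intro: fourier_trig_poly\<close>)
qed (simp_all add: continuous_on_echar)

lemma pi2_fourier_series:
  assumes "\<And>x. 0 < fourier_series z x"
  shows "pi2 N (density_prob (fourier_series z)) = restrict z (Fplus N)"
  unfolding pi2_def fourier_density_prob[OF torus_density_fourier_series[OF assms]]
  by (auto simp: fourier_fourier_series)

lemma eventually_trig_poly_pos:
  assumes "\<And>x. 0 < fourier_series z x"
  shows "\<forall>\<^sub>F N in sequentially. \<forall>x. 0 < trig_poly N z x"
proof -
  have "0 < (INF x. fourier_series z x)"
    using assms by (simp add: INF_torus_pos_iff continuous_on_fourier_series)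
  from order_tendstoD(1)[OF INF_trig_poly_tendsto this] show ?thesis
    by eventually_elim (simp add: INF_torus_pos_iff continuous_intros)
qed

lemma I_map_tendsto:
  assumes "\<And>x. 0 < fourier_series z x"
  shows "(\<lambda>N. I_map N z) \<longlonglongrightarrow> density_prob (fourier_series z)"
proof (rule tendsto_dist_iff[THEN iffD2], rule Lim_null_comparison)
  show "(\<lambda>N. real CARD('n) * (2 * (\<Sum>n. shell_sum z (n + N)))) \<longlonglongrightarrow> 0"
    by (rule tendsto_mult_right_zero) (rule shell_tail_tendsto_0)
  show "\<forall>\<^sub>F N in sequentially. norm (dist (I_map N z) (density_prob (fourier_series z))) \<le>
     real CARD('n) * (2 * (\<Sum>n. shell_sum z (n + N)))"
    using eventually_trig_poly_pos[OF assms]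
  proof eventually_elim
    case (elim N)
    then have "dist (I_map N z) (density_prob (fourier_series z)) \<le> real CARD('n) * (2 * (\<Sum>n. shell_sum z (n + N)))"
      unfolding I_map_eq using fourier_series_diff_le[of _ N]
      by (intro dist_density_prob_le torus_density_trig_poly torus_density_fourier_series assms)
         (auto simp: abs_minus_commute)
    then show ?case
      by simp
  qed
qed

text \<open>Termwise differentiation: the gradient of a summand is at most 4 * pi * |k| * |z k|, so
  the gradients of the partial sums converge uniformly by the Weierstrass test.\<close>

lemma C1_fourier_series: "C1_torus (fourier_series z)"
proof -
  \<comment> \<open>Gradient of \<open>2 * Re (z k * echar (- k) x)\<close> in the lifted variable:
    differentiating the exponential gives the factor -2 * pi * i and the direction
    \<open>kvec k\<close>.\<close>
  define q where "q k a = (2 * Re (z k * (- \<i> * of_real (2 * pi)) * echar (- k) (abs_torus a))) *\<^sub>R kvec k"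
    for k :: "'n::{finite,linorder} frequency" and a
  define G where "G N a = (\<Sum>k\<in>Fplus N. q k a)" for N a
  have cG: "continuous_on UNIV (G N)" for N
    unfolding G_def[abs_def] q_def
    by (intro continuous_intros continuous_on_compose2[OF continuous_on_echar[of UNIV]]) auto
  have q: "norm (q k a) \<le> 4 * pi * (int_vec_norm k * cmod (z k))" for k a
  proof -
    have "norm (q k a) \<le> 2 * cmod (z k * (- \<i> * of_real (2 * pi))) * norm (kvec k)"
      unfolding q_def norm_scaleR
      by (intro mult_right_mono abs_trig_poly_summand_le) auto
    then show ?thesis
      by (simp add: norm_mult int_vec_norm_kvec mult_ac)
  qed
  have dG: "norm (G (Suc n) a - G n a) \<le> 4 * pi * shell_sum z n" for n a
  proof -
    have "G (Suc n) a - G n a = (\<Sum>k\<in>shell n. q k a)"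
      unfolding G_def shell_def by (rule sum_diff[symmetric]) (simp_all add: Fplus_mono)
    also have "norm \<dots> \<le> (\<Sum>k\<in>shell n. 4 * pi * (int_vec_norm k * cmod (z k)))"
      by (rule order_trans[OF norm_sum sum_mono]) (rule q)
    finally show ?thesis
      by (simp add: shell_sum_def sum_distrib_left)
  qed
  have "uniform_limit UNIV (\<lambda>n a. \<Sum>i<n. G (Suc i) a - G i a) (\<lambda>a. \<Sum>i. G (Suc i) a - G i a) sequentially"
    by (rule Weierstrass_m_test[OF dG]) (intro summable_mult summable_shell_sum)
  moreover define g where "g = (\<lambda>a. \<Sum>i. G (Suc i) a - G i a)"
  moreover have G_0: "G 0 a = 0" for a
    by (simp add: G_def)
  ultimately have ug: "uniform_limit UNIV G g sequentially"
    by (simp add: sum_lessThan_telescope[of "\<lambda>n. G n _"] G_0)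
  then have cg: "continuous_on UNIV g"
    by (rule uniform_limit_theorem[rotated]) (auto intro!: always_eventually cG)
  have der: "((\<lambda>b. trig_poly N z (abs_torus b)) has_derivative (\<lambda>v. G N a \<bullet> v)) (at a within UNIV)" for N a
  proof -
    have "((\<lambda>b. 2 * Re (z k * echar (- k) (abs_torus b))) has_derivative (\<lambda>v. q k a \<bullet> v)) (at a)" for k
    proof -
      let ?E = "\<lambda>b. \<i> * complex_of_real (2 * pi * (kvec (- k) \<bullet> b))"
      have "(?E has_derivative ?E) (at a)"
        by (intro derivative_intros has_derivative_of_real)
      from has_derivative_compose[OF this DERIV_exp[THEN has_field_derivative_imp_has_derivative]]
      have "((\<lambda>b. 2 * Re (z k * exp (?E b))) has_derivative (\<lambda>v. 2 * Re (z k * (exp (?E a) * ?E v)))) (at a)"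
        by (intro has_derivative_mult_right has_derivative_Re)
      moreover have "2 * Re (z k * (exp (?E a) * ?E v)) = q k a \<bullet> v" for v
        by (simp add: q_def echar_abs_torus cis_conv_exp algebra_simps)
      ultimately show ?thesis
        by (simp add: echar_abs_torus cis_conv_exp)
    qed
    then have "((\<lambda>b. \<Sum>k\<in>Fplus N. 2 * Re (z k * echar (- k) (abs_torus b))) has_derivative
        (\<lambda>v. \<Sum>k\<in>Fplus N. q k a \<bullet> v)) (at a)"
      by (rule has_derivative_sum)
    from has_derivative_add[OF has_derivative_const[of 1] this] show ?thesis
      unfolding trig_poly_eq_sum G_def inner_sum_left by (simp only: add_0)
  qed
  have "\<exists>h. \<forall>a\<in>UNIV. (\<lambda>n. trig_poly n z (abs_torus a)) \<longlonglongrightarrow> h a \<and>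
      (h has_derivative (\<lambda>v. g a \<bullet> v)) (at a within UNIV)"
  proof (rule has_derivative_sequence[OF convex_UNIV der _ UNIV_I trig_poly_tendsto])
    fix e :: real assume "e > 0"
    from uniform_limitD[OF ug this]
    show "\<forall>\<^sub>F n in sequentially. \<forall>a\<in>UNIV. \<forall>v. norm (G n a \<bullet> v - g a \<bullet> v) \<le> e * norm v"
    proof eventually_elim
      case (elim n)
      show ?case
      proof (intro ballI allI)
        fix a v
        have "norm (G n a \<bullet> v - g a \<bullet> v) \<le> norm (G n a - g a) * norm v"
          using Cauchy_Schwarz_ineq2[of "G n a - g a" v] by (simp add: inner_diff_left)
        also have "\<dots> \<le> e * norm v"
          using elim by (intro mult_right_mono) (auto simp: dist_norm less_imp_le)
        finally show "norm (G n a \<bullet> v - g a \<bullet> v) \<le> e * norm v" .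
      qed
    qed
  qed
  then obtain h where h: "\<And>a. (\<lambda>n. trig_poly n z (abs_torus a)) \<longlonglongrightarrow> h a" "\<And>a. (h has_derivative (\<lambda>v. g a \<bullet> v)) (at a)"
    by auto
  have "h = (\<lambda>a. fourier_series z (abs_torus a))"
    using LIMSEQ_unique[OF h(1) trig_poly_tendsto] by auto
  with h(2) cg show ?thesis
    unfolding C1_torus_def by blast
qed

end

section \<open>Gaussian coefficients\<close>

text \<open>A function that is Lipschitz in finitely many coordinates is continuous for the product
  topology. This is how Borel measurability on the space of all coefficient families is
  obtained.\<close>

lemma continuous_on_finitely_many_coords:
  fixes F :: "('a \<Rightarrow> complex) \<Rightarrow> 'b::metric_space"
  assumes "\<And>z w. z \<in> S \<Longrightarrow> w \<in> S \<Longrightarrow> dist (F z) (F w) \<le> C * (\<Sum>k\<in>K. cmod (z k - w k))"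
  shows "continuous_on S F"
  unfolding continuous_on_def
proof (intro ballI)
  fix w assume w: "w \<in> S"
  have "continuous_on S (\<lambda>z. C * (\<Sum>k\<in>K. cmod (z k - w k)))"
    by (intro continuous_intros continuous_on_subset[OF continuous_on_product_coordinates]) auto
  then have lim: "((\<lambda>z. C * (\<Sum>k\<in>K. cmod (z k - w k))) \<longlongrightarrow> 0) (at w within S)"
    using w unfolding continuous_on_def by fastforce
  show "(F \<longlongrightarrow> F w) (at w within S)"
  proof (rule tendsto_dist_iff[THEN iffD2], rule Lim_null_comparison[OF _ lim])
    show "\<forall>\<^sub>F z in at w within S. norm (dist (F z) (F w)) \<le> C * (\<Sum>k\<in>K. cmod (z k - w k))"
      unfolding eventually_at_filter using assms w by (intro always_eventually) simp
  qed
qed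

lemma measurable_coord [measurable]:
  "(\<lambda>z. z k) \<in> borel_measurable (borel :: ('a \<Rightarrow> complex) measure)"
  by (intro borel_measurable_continuous_onI continuous_on_product_coordinates)

definition min_trig :: "nat \<Rightarrow> 'n::{finite,linorder} coefficients \<Rightarrow> real" where
  "min_trig N z = (INF x. trig_poly N z x)"

lemma min_trig_pos_iff: "0 < min_trig N z \<longleftrightarrow> (\<forall>x. 0 < trig_poly N z x)"
  unfolding min_trig_def by (intro INF_torus_pos_iff continuous_intros)

lemma measurable_min_trig [measurable]: "min_trig N \<in> borel_measurable borel"
proof (intro borel_measurable_continuous_onI continuous_on_finitely_many_coords)
  fix z w
  show "dist (min_trig N z) (min_trig N w) \<le> 2 * (\<Sum>k\<in>Fplus N. cmod (z k - w k))"
    unfolding dist_real_def min_trig_def using trig_poly_diff_le[of N z _ w]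
    by (intro INF_torus_diff_le continuous_intros) (simp add: sum_distrib_left)
qed

lemma dist_I_map_le:
  fixes z w :: "'n::{finite,linorder} coefficients"
  assumes "0 < min_trig N z" "0 < min_trig N w"
  shows "dist (I_map N z) (I_map N w) \<le> (real CARD('n) * 2) * (\<Sum>k\<in>Fplus N. cmod (z k - w k))"
proof -
  have "dist (I_map N z) (I_map N w) \<le> real CARD('n) * (2 * (\<Sum>k\<in>Fplus N. cmod (z k - w k)))"
    unfolding I_map_eq using assms trig_poly_diff_le[of N z _ w]
    by (intro dist_density_prob_le torus_density_trig_poly) (simp_all add: min_trig_pos_iff sum_distrib_left)
  then show ?thesis
    by (simp only: mult.assoc)
qed

lemma measurable_I_map_restrict: "I_map N \<in> restrict_space borel {z. 0 < min_trig N z} \<rightarrow>\<^sub>M borel"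
  by (intro borel_measurable_continuous_on_restrict continuous_on_finitely_many_coords[OF dist_I_map_le]) auto

definition uniform_prob :: "'n::finite torus_prob" where
  "uniform_prob = density_prob (\<lambda>_. 1)"

text \<open>Borel on the whole coefficient space. The default value is an arbitrary point: the laws
  below are conditioned on the first branch.\<close>

definition I_total :: "nat \<Rightarrow> 'n::{finite,linorder} coefficients \<Rightarrow> 'n torus_prob" where
  "I_total N z = (if 0 < min_trig N z then I_map N z else uniform_prob)"

lemma measurable_I_total [measurable]: "I_total N \<in> borel_measurable borel"
  unfolding I_total_def[abs_def]
  by (subst measurable_If_restrict_space_iff) (auto simp: measurable_I_map_restrict)

text \<open>Functions on \<^term>\<open>Fplus N\<close> are extended by \<open>0\<close> because the topology, and hence continuity in the
  coefficients, is only available on the full function space.\<close>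

definition embed_coeffs :: "nat \<Rightarrow> 'n::{finite,linorder} coefficients \<Rightarrow> 'n coefficients" where
  "embed_coeffs N z = (\<lambda>k. if k \<in> Fplus N then z k else 0)"

lemma trig_poly_embed [simp]: "trig_poly N (embed_coeffs N z) = trig_poly N z"
  by (auto simp: embed_coeffs_def intro!: trig_poly_cong)

lemma measurable_embed_coeffs [measurable]:
  "embed_coeffs N \<in> coeff_lebesgue N \<rightarrow>\<^sub>M (borel :: 'n::{finite,linorder} coefficients measure)"
proof -
  have "embed_coeffs N \<in> Pi\<^sub>M (Fplus N) (\<lambda>_. borel) \<rightarrow>\<^sub>M (Pi\<^sub>M UNIV (\<lambda>_ :: 'n frequency. borel :: complex measure))"
  proof (rule measurable_PiM_single')
    fix k :: "'n frequency"
    show "(\<lambda>z. embed_coeffs N z k) \<in> borel_measurable (Pi\<^sub>M (Fplus N) (\<lambda>_. borel))"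
      unfolding embed_coeffs_def by (cases "k \<in> Fplus N") simp_all
  qed (auto simp: space_PiM)
  then show ?thesis
    by (simp cong: measurable_cong_sets add: sets_coeff_lebesgue sets_PiM_equal_borel)
qed

lemma O_set_eq: "O_set N = {z \<in> space (coeff_lebesgue N). 0 < min_trig N (embed_coeffs N z)}"
  by (auto simp: O_set_iff min_trig_pos_iff)

lemma sets_O_set [measurable]: "O_set N \<in> sets (coeff_lebesgue N)"
  unfolding O_set_eq by measurable

lemma measurable_I_map [measurable]: "I_map N \<in> O_lebesgue N \<rightarrow>\<^sub>M borel"
proof -
  have "(\<lambda>z. I_total N (embed_coeffs N z)) \<in> O_lebesgue N \<rightarrow>\<^sub>M borel"
    unfolding O_lebesgue_def by (rule measurable_restrict_space1) measurable
  then show ?thesis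
  proof (rule measurable_cong[THEN iffD1, rotated])
    fix z :: "int ^ 'a::{finite,linorder} \<Rightarrow> complex" assume "z \<in> space (O_lebesgue N)"
    then have "0 < min_trig N (embed_coeffs N z)"
      by (auto simp: O_lebesgue_def space_restrict_space O_set_eq)
    then show "I_total N (embed_coeffs N z) = I_map N z"
      by (simp add: I_total_def I_map_eq)
  qed
qed

section \<open>The centred Gaussian law on the complex plane\<close>

definition cgauss_Z :: "real \<Rightarrow> real" where
  "cgauss_Z a = (\<integral>z. exp (- (a * (cmod z)\<^sup>2)) \<partial>lborel)"

definition cgauss :: "real \<Rightarrow> complex measure" where
  "cgauss a = density lborel (\<lambda>z. ennreal (exp (- (a * (cmod z)\<^sup>2)) / cgauss_Z a))"

lemma sets_cgauss [simp, measurable_cong]: "sets (cgauss a) = sets borel"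
  and space_cgauss [simp]: "space (cgauss a) = UNIV"
  by (simp_all add: cgauss_def)

lemma nn_integral_complex_scale:
  fixes f :: "complex \<Rightarrow> ennreal"
  assumes [measurable]: "f \<in> borel_measurable borel" and c: "c > 0"
  shows "(\<integral>\<^sup>+z. f z \<partial>lborel) = ennreal (c\<^sup>2) * (\<integral>\<^sup>+z. f (c *\<^sub>R z) \<partial>lborel)"
proof -
  have "(\<integral>\<^sup>+z. f z \<partial>lborel) = (\<integral>\<^sup>+z. f z \<partial>density (distr lborel borel (\<lambda>z::complex. 0 + c *\<^sub>R z)) (\<lambda>_. \<bar>c\<bar> ^ DIM(complex)))"
    using lborel_affine[of c "0::complex"] c by simp
  also have "\<dots> = (\<integral>\<^sup>+z. ennreal (c\<^sup>2) * f (c *\<^sub>R z) \<partial>lborel)"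
    using c by (subst nn_integral_density) (simp_all add: nn_integral_distr)
  finally show ?thesis
    by (simp add: nn_integral_cmult)
qed

text \<open>The inequality 1 + |z| \<le> (1 + |Re z|) * (1 + |Im z|) bounds the integrand by a
  product of one-dimensional functions with finite Gaussian moments. The factor 1 + |z| covers the
  moments of order 0 and 1 at once.\<close>

lemma gauss_weight_finite:
  "(\<integral>\<^sup>+z. ennreal ((1 + cmod z) * exp (- ((cmod z)\<^sup>2 / 2))) \<partial>lborel) < \<infinity>"
proof -
  define h where "h t = (1 + \<bar>t\<bar>) * exp (- (t\<^sup>2 / 2))" for t :: real
  have h_eq: "h t = sqrt (2 * pi) * (std_normal_density t * \<bar>t\<bar> ^ 0 + std_normal_density t * \<bar>t\<bar> ^ 1)" for t
    by (simp add: h_def std_normal_density_def field_simps)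
  have [measurable]: "h \<in> borel_measurable borel"
    unfolding h_def by measurable
  have "integrable lborel h"
    unfolding h_eq[abs_def]
    by (intro integrable_mult_right Bochner_Integration.integrable_add integrable_std_normal_moment_abs)
  then have fin: "(\<integral>\<^sup>+t. ennreal (h t) \<partial>lborel) < \<infinity>"
    by (subst nn_integral_eq_integral) (auto simp: h_def)
  have "(1 + cmod z) * exp (- ((cmod z)\<^sup>2 / 2)) \<le> h (Re z) * h (Im z)" for z
  proof -
    have "1 + cmod z \<le> (1 + \<bar>Re z\<bar>) * (1 + \<bar>Im z\<bar>)"
    proof -
      have "0 \<le> \<bar>Re z\<bar> * \<bar>Im z\<bar>"
        by simp
      then show ?thesis
        using cmod_le[of z] unfolding distrib_left distrib_right by linarith
    qed
    then have "(1 + cmod z) * exp (- ((cmod z)\<^sup>2 / 2)) \<le> (1 + \<bar>Re z\<bar>) * (1 + \<bar>Im z\<bar>) * exp (- ((cmod z)\<^sup>2 / 2))"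
      by (rule mult_right_mono) simp
    moreover have "exp (- ((cmod z)\<^sup>2 / 2)) = exp (- ((Re z)\<^sup>2 / 2)) * exp (- ((Im z)\<^sup>2 / 2))"
      by (simp add: cmod_power2 add_divide_distrib flip: exp_add)
    ultimately show ?thesis
      by (simp add: h_def mult_ac)
  qed
  then have "(\<integral>\<^sup>+z. ennreal ((1 + cmod z) * exp (- ((cmod z)\<^sup>2 / 2))) \<partial>lborel)
      \<le> (\<integral>\<^sup>+z. ennreal (h (Re z)) * ennreal (h (Im z)) \<partial>lborel)"
    by (intro nn_integral_mono) (simp add: h_def flip: ennreal_mult)
  also have "\<dots> = (\<integral>\<^sup>+z. (\<Prod>b\<in>Basis. ennreal (h (z \<bullet> b))) \<partial>(lborel :: complex measure))"
    by (simp add: Basis_complex_def)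
  also have "\<dots> = (\<Prod>b\<in>(Basis :: complex set). \<integral>\<^sup>+t. ennreal (h t) \<partial>lborel)"
    by (rule nn_integral_lborel_prod) auto
  also have "\<dots> < \<infinity>"
    using fin by (simp add: power_less_top_ennreal)
  finally show ?thesis .
qed

lemma cgauss_scaling:
  assumes a: "a > 0"
  shows "(\<integral>\<^sup>+z. ennreal (cmod z ^ j * exp (- (a * (cmod z)\<^sup>2))) \<partial>lborel) =
    ennreal ((1 / sqrt (2 * a)) ^ (j + 2)) * (\<integral>\<^sup>+z. ennreal (cmod z ^ j * exp (- ((cmod z)\<^sup>2 / 2))) \<partial>lborel)"
proof -
  \<comment> \<open>This dilation turns the weight \<open>a\<close> into 1/2; the modulus
    contributes \<open>c ^ j\<close> and the planar area element \<open>c\<^sup>2\<close>.\<close>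
  define c where "c = 1 / sqrt (2 * a)"
  have c: "c > 0" "a * c\<^sup>2 = 1 / 2"
    using a by (simp_all add: c_def power_divide)
  have exp: "a * (cmod (c *\<^sub>R z))\<^sup>2 = (cmod z)\<^sup>2 / 2" for z
  proof -
    have "a * (cmod (c *\<^sub>R z))\<^sup>2 = a * c\<^sup>2 * (cmod z)\<^sup>2"
      using c(1) by (simp add: power_mult_distrib)
    then show ?thesis
      by (simp add: c(2))
  qed
  have "(\<integral>\<^sup>+z. ennreal (cmod z ^ j * exp (- (a * (cmod z)\<^sup>2))) \<partial>lborel) =
     ennreal (c\<^sup>2) * (\<integral>\<^sup>+z. ennreal (cmod (c *\<^sub>R z) ^ j * exp (- (a * (cmod (c *\<^sub>R z))\<^sup>2))) \<partial>lborel)"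
    by (rule nn_integral_complex_scale) (use c in auto)
  also have "\<dots> = ennreal (c\<^sup>2) * (\<integral>\<^sup>+z. ennreal (c ^ j) * ennreal (cmod z ^ j * exp (- ((cmod z)\<^sup>2 / 2))) \<partial>lborel)"
    unfolding exp using c(1) by (simp add: power_mult_distrib mult.assoc flip: ennreal_mult)
  also have "\<dots> = ennreal (c\<^sup>2) * ennreal (c ^ j) * (\<integral>\<^sup>+z. ennreal (cmod z ^ j * exp (- ((cmod z)\<^sup>2 / 2))) \<partial>lborel)"
    by (subst nn_integral_cmult) (simp_all add: mult.assoc)
  also have "ennreal (c\<^sup>2) * ennreal (c ^ j) = ennreal (c ^ (j + 2))"
    using c(1) by (simp add: power_add power2_eq_square mult_ac flip: ennreal_mult)
  finally show ?thesis
    by (simp add: c_def)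
qed

text \<open>Absolute moments of the unnormalised Gaussian of weight 1/2. The one of order 0 equals 2
  * pi, so that \<open>cgauss_Z a\<close> is pi / a.\<close>

definition cgauss_moment :: "nat \<Rightarrow> real" where
  "cgauss_moment j = enn2real (\<integral>\<^sup>+z. ennreal (cmod z ^ j * exp (- ((cmod z)\<^sup>2 / 2))) \<partial>lborel)"

lemma ennreal_cgauss_moment:
  assumes "j \<le> 1"
  shows "(\<integral>\<^sup>+z. ennreal (cmod z ^ j * exp (- ((cmod z)\<^sup>2 / 2))) \<partial>lborel) = ennreal (cgauss_moment j)"
proof -
  have "j = 0 \<or> j = 1"
    using assms by auto
  then have "(\<integral>\<^sup>+z. ennreal (cmod z ^ j * exp (- ((cmod z)\<^sup>2 / 2))) \<partial>lborel) \<le>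
     (\<integral>\<^sup>+z. ennreal ((1 + cmod z) * exp (- ((cmod z)\<^sup>2 / 2))) \<partial>lborel)"
    by (intro nn_integral_mono ennreal_leI mult_right_mono) auto
  also note gauss_weight_finite
  finally show ?thesis
    unfolding cgauss_moment_def by simp
qed

lemma cgauss_moment_0_pos: "cgauss_moment 0 > 0"
proof -
  have "(\<integral>\<^sup>+z. ennreal (exp (- ((cmod z)\<^sup>2 / 2))) \<partial>lborel) \<noteq> 0"
    by (subst nn_integral_0_iff_AE) (auto simp: AE_iff_null null_sets_def)
  then show ?thesis
    using ennreal_cgauss_moment[of 0] by (auto simp: ennreal_eq_0_iff not_le)
qed

lemma cgauss_Z:
  assumes "a > 0"
  shows "(\<integral>\<^sup>+z. ennreal (exp (- (a * (cmod z)\<^sup>2))) \<partial>lborel) = ennreal (cgauss_Z a)"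
    and "cgauss_Z a = (1 / sqrt (2 * a))\<^sup>2 * cgauss_moment 0" and "cgauss_Z a > 0"
proof -
  have *: "(\<integral>\<^sup>+z. ennreal (exp (- (a * (cmod z)\<^sup>2))) \<partial>lborel) = ennreal ((1 / sqrt (2 * a))\<^sup>2 * cgauss_moment 0)"
    using cgauss_scaling[OF assms, of 0] ennreal_cgauss_moment[of 0] cgauss_moment_0_pos assms
    by (subst ennreal_mult) (simp_all add: numeral_2_eq_2)
  show eq: "cgauss_Z a = (1 / sqrt (2 * a))\<^sup>2 * cgauss_moment 0"
    unfolding cgauss_Z_def using cgauss_moment_0_pos assms
    by (subst integral_eq_nn_integral) (simp_all add: *)
  show "(\<integral>\<^sup>+z. ennreal (exp (- (a * (cmod z)\<^sup>2))) \<partial>lborel) = ennreal (cgauss_Z a)"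
    unfolding eq * ..
  show "cgauss_Z a > 0"
    unfolding eq using cgauss_moment_0_pos assms by simp
qed

lemma prob_space_cgauss:
  assumes "a > 0"
  shows "prob_space (cgauss a)"
proof (rule prob_spaceI)
  have "emeasure (cgauss a) UNIV = (\<integral>\<^sup>+z. ennreal (1 / cgauss_Z a) * ennreal (exp (- (a * (cmod z)\<^sup>2))) \<partial>lborel)"
    unfolding cgauss_def using cgauss_Z(3)[OF assms]
    by (simp add: emeasure_density mult.commute flip: ennreal_mult)
  also have "\<dots> = ennreal (1 / cgauss_Z a) * ennreal (cgauss_Z a)"
    by (subst nn_integral_cmult) (simp_all add: cgauss_Z[OF assms])
  also have "\<dots> = 1"
    using cgauss_Z(3)[OF assms] by (simp flip: ennreal_mult)
  finally show "emeasure (cgauss a) (space (cgauss a)) = 1"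
    by simp
qed

text \<open>By scaling, the mean modulus is a constant times 1 / sqrt a. This decay in the weight is
  what makes the weighted coefficients summable.\<close>

lemma cgauss_mean:
  assumes "a > 0"
  shows "(\<integral>\<^sup>+z. ennreal (cmod z) \<partial>cgauss a) = ennreal (cgauss_moment 1 / cgauss_moment 0 / sqrt (2 * a))"
proof -
  let ?c = "1 / sqrt (2 * a)"
  have m1: "cgauss_moment 1 \<ge> 0"
    by (simp add: cgauss_moment_def)
  have "(\<integral>\<^sup>+z. ennreal (cmod z) \<partial>cgauss a) =
      (\<integral>\<^sup>+z. ennreal (1 / cgauss_Z a) * ennreal (cmod z ^ 1 * exp (- (a * (cmod z)\<^sup>2))) \<partial>lborel)"
    unfolding cgauss_def using cgauss_Z(3)[OF assms]
    by (subst nn_integral_density) (simp_all add: mult_ac flip: ennreal_mult)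
  also have "\<dots> = ennreal (1 / cgauss_Z a) * (\<integral>\<^sup>+z. ennreal (cmod z ^ 1 * exp (- (a * (cmod z)\<^sup>2))) \<partial>lborel)"
    by (subst nn_integral_cmult) simp_all
  also have "(\<integral>\<^sup>+z. ennreal (cmod z ^ 1 * exp (- (a * (cmod z)\<^sup>2))) \<partial>lborel) = ennreal (?c ^ 3 * cgauss_moment 1)"
    unfolding cgauss_scaling[OF assms] using assms m1 ennreal_cgauss_moment[of 1]
    by (subst ennreal_mult) (simp_all add: numeral_3_eq_3)
  also have "ennreal (1 / cgauss_Z a) * ennreal (?c ^ 3 * cgauss_moment 1) = ennreal (1 / cgauss_Z a * (?c ^ 3 * cgauss_moment 1))"
    using cgauss_Z(3)[OF assms] m1 assms by (simp flip: ennreal_mult)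
  also have "1 / cgauss_Z a * (?c ^ 3 * cgauss_moment 1) = cgauss_moment 1 / cgauss_moment 0 / sqrt (2 * a)"
    unfolding cgauss_Z(2)[OF assms] using assms cgauss_moment_0_pos
    by (simp add: field_simps power2_eq_square power3_eq_cube)
  finally show ?thesis .
qed

lemma null_sets_cgauss: "A \<in> null_sets lborel \<Longrightarrow> A \<in> null_sets (cgauss a)"
  using absolutely_continuousI_density[of "\<lambda>z. ennreal (exp (- (a * (cmod z)\<^sup>2)) / cgauss_Z a)" lborel]
  by (auto simp: absolutely_continuous_def cgauss_def)

text \<open>The density is strictly positive, so an open set that is null for the Gaussian would be
  Lebesgue null, hence empty.\<close>

lemma emeasure_cgauss_open:
  assumes "a > 0" "open U" "U \<noteq> {}"
  shows "emeasure (cgauss a) U > 0"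
proof -
  have "U \<notin> null_sets (cgauss a)"
  proof
    assume "U \<in> null_sets (cgauss a)"
    then have "AE z in lborel. z \<in> U \<longrightarrow> ennreal (exp (- (a * (cmod z)\<^sup>2)) / cgauss_Z a) = 0"
      unfolding cgauss_def by (subst (asm) null_sets_density_iff) auto
    then have "AE z in lborel. z \<notin> U"
      by eventually_elim (use cgauss_Z(3)[OF assms(1)] in \<open>auto simp: ennreal_eq_0_iff divide_le_0_iff\<close>)
    then have "U \<in> null_sets lborel"
      using assms(2) by (simp add: AE_iff_null_sets)
    then have "negligible U"
      by (simp add: negligible_iff_null_sets null_sets_completionI)
    with assms show False
      using open_not_negligible by blast
  qed
  then show ?thesis
    using assms(2) by (auto simp: null_sets_def zero_less_iff_neq_zero)
qed

text \<open>All integer frequencies carry a Gaussian, which makes the index set a type; only those in some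
  \<^term>\<open>Fplus N\<close> matter. The weight at \<open>0\<close> is arbitrary but must be positive.\<close>

definition coeff_weight :: "real \<Rightarrow> int ^ 'n::finite \<Rightarrow> real" where
  "coeff_weight p k = (if k = 0 then 1 else int_vec_norm k powr (2 * p * real CARD('n)))"

definition coeff_law :: "real \<Rightarrow> (int ^ 'n::finite \<Rightarrow> complex) measure" where
  "coeff_law p = Pi\<^sub>M UNIV (\<lambda>k. cgauss (coeff_weight p k))"

lemma coeff_weight_pos: "coeff_weight p k > 0"
  using int_vec_norm_ge_1[of k] by (auto simp: coeff_weight_def)

lemma sets_coeff_law [simp, measurable_cong]: "sets (coeff_law p) = sets borel"
proof -
  have "sets (coeff_law p) = sets (Pi\<^sub>M UNIV (\<lambda>_ :: int ^ 'a. borel :: complex measure))"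
    unfolding coeff_law_def by (intro sets_PiM_cong) auto
  then show ?thesis
    by (simp add: sets_PiM_equal_borel)
qed

lemma space_coeff_law [simp]: "space (coeff_law p) = UNIV"
  by (simp add: coeff_law_def space_PiM)

lemma product_prob_space_cgauss: "product_prob_space (\<lambda>k. cgauss (coeff_weight p k))"
  by (intro product_prob_spaceI prob_space_cgauss coeff_weight_pos)

lemma prob_space_coeff_law: "prob_space (coeff_law p)"
  unfolding coeff_law_def by (intro prob_space_PiM prob_space_cgauss coeff_weight_pos)

section \<open>Finite-dimensional marginals and conditioning on positivity\<close>

lemma measurable_cgauss_density:
  "(\<lambda>z. \<Prod>k\<in>K. ennreal (exp (- (a k * (cmod (z k))\<^sup>2)) / cgauss_Z (a k))) \<in> borel_measurable (Pi\<^sub>M K (\<lambda>_. lborel))"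
proof (rule borel_measurable_prod_ennreal)
  fix k assume "k \<in> K"
  then have "(\<lambda>z. z k) \<in> borel_measurable (Pi\<^sub>M K (\<lambda>_. lborel :: complex measure))"
    using measurable_component_singleton[of k K "\<lambda>_. lborel :: complex measure"] by simp
  moreover have "(\<lambda>x. ennreal (exp (- (a k * (cmod x)\<^sup>2)) / cgauss_Z (a k))) \<in> borel_measurable borel"
    by measurable
  ultimately show "(\<lambda>z. ennreal (exp (- (a k * (cmod (z k))\<^sup>2)) / cgauss_Z (a k))) \<in> borel_measurable (Pi\<^sub>M K (\<lambda>_. lborel))"
    by (rule measurable_compose)
qed

text \<open>The product measure is determined by its values on boxes, and there the integral of a
  product of one-variable functions factorises.\<close>

lemma PiM_cgauss:
  assumes "finite K" "\<And>k. a k > 0"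
  shows "Pi\<^sub>M K (\<lambda>k. cgauss (a k)) =
    density (Pi\<^sub>M K (\<lambda>_. lborel)) (\<lambda>z. \<Prod>k\<in>K. ennreal (exp (- (a k * (cmod (z k))\<^sup>2)) / cgauss_Z (a k)))"
    (is "_ = density ?L ?f")
proof -
  interpret G: product_prob_space "\<lambda>k. cgauss (a k)"
    by (intro product_prob_spaceI prob_space_cgauss assms)
  have "density ?L ?f = Pi\<^sub>M K (\<lambda>k. cgauss (a k))"
  proof (rule G.PiM_eqI)
    show "sets (density ?L ?f) = sets (Pi\<^sub>M K (\<lambda>k. cgauss (a k)))"
      by (simp cong: sets_PiM_cong)
    fix A assume A: "\<And>k. k \<in> K \<Longrightarrow> A k \<in> sets (cgauss (a k))"
    have "Pi\<^sub>E K A \<in> sets ?L"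
      using A by (intro sets_PiM_I_finite assms) auto
    then have "emeasure (density ?L ?f) (Pi\<^sub>E K A) = (\<integral>\<^sup>+z. ?f z * indicator (Pi\<^sub>E K A) z \<partial>?L)"
      by (intro emeasure_density measurable_cgauss_density)
    also have "\<dots> = (\<integral>\<^sup>+z. (\<Prod>k\<in>K. ennreal (exp (- (a k * (cmod (z k))\<^sup>2)) / cgauss_Z (a k)) * indicator (A k) (z k)) \<partial>?L)"
    proof (rule nn_integral_cong)
      fix z assume z: "z \<in> space ?L"
      have "indicator (Pi\<^sub>E K A) z = (\<Prod>k\<in>K. indicator (A k) (z k) :: ennreal)"
      proof (cases "z \<in> Pi\<^sub>E K A")
        case True
        then show ?thesis by (auto simp: PiE_iff intro!: prod.neutral[symmetric])
      next
        case False
        then obtain k where "k \<in> K" "z k \<notin> A k"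
          using z by (auto simp: PiE_iff space_PiM)
        then have "(\<Prod>k\<in>K. indicator (A k) (z k) :: ennreal) = 0"
          using assms(1) by (intro prod_zero bexI[of _ k]) auto
        then show ?thesis
          using False by simp
      qed
      then show "?f z * indicator (Pi\<^sub>E K A) z =
          (\<Prod>k\<in>K. ennreal (exp (- (a k * (cmod (z k))\<^sup>2)) / cgauss_Z (a k)) * indicator (A k) (z k))"
        by (simp add: prod.distrib)
    qed
    also have "\<dots> = (\<Prod>k\<in>K. \<integral>\<^sup>+x. ennreal (exp (- (a k * (cmod x)\<^sup>2)) / cgauss_Z (a k)) * indicator (A k) x \<partial>lborel)"
      using A by (intro lborel_product.product_nn_integral_prod assms) auto
    also have "\<dots> = (\<Prod>k\<in>K. emeasure (cgauss (a k)) (A k))"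
      using A by (intro prod.cong refl) (auto simp: cgauss_def emeasure_density)
    finally show "emeasure (density ?L ?f) (Pi\<^sub>E K A) = (\<Prod>k\<in>K. emeasure (cgauss (a k)) (A k))" .
  qed (fact assms)
  then show ?thesis ..
qed

text \<open>Normalisation of the weight over all coefficients, before conditioning;
  \<open>Gauss_Z\<close> integrates over \<open>O_set N\<close> only.\<close>

definition norm_const :: "real \<Rightarrow> nat \<Rightarrow> 'n::{finite,linorder} itself \<Rightarrow> real" where
  "norm_const p N _ = (\<Prod>k\<in>(Fplus N :: 'n::{finite,linorder} frequency set). cgauss_Z (coeff_weight p k))"

lemma norm_const_pos: "norm_const p N TYPE('n::{finite,linorder}) > 0"
  unfolding norm_const_def by (intro prod_pos cgauss_Z coeff_weight_pos)

lemma measurable_restrict_coeffs [measurable]: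
  "(\<lambda>z :: 'n::{finite,linorder} coefficients. restrict z (Fplus N)) \<in> borel \<rightarrow>\<^sub>M coeff_lebesgue N"
  unfolding measurable_cong_sets[OF refl sets_coeff_lebesgue] by measurable

lemma measurable_Gauss_weight [measurable]: "Gauss_weight p N \<in> borel_measurable (coeff_lebesgue N)"
  unfolding measurable_cong_sets[OF sets_coeff_lebesgue refl] Gauss_weight_def[abs_def] by measurable

text \<open>Marginals of a product are products, and the Gaussian factors multiply to
  \<open>Gauss_weight\<close>. As 0 is not in \<open>Fplus N\<close>, all weights involved have
  their power form.\<close>

lemma distr_restrict_coeff_law:
  "distr (coeff_law p) (coeff_lebesgue N) (\<lambda>z. restrict z (Fplus N)) =
   density (coeff_lebesgue N :: 'n::{finite,linorder} coefficients measure)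
     (\<lambda>z. ennreal (Gauss_weight p N z / norm_const p N TYPE('n)))"
proof -
  interpret G: product_prob_space "\<lambda>k :: 'n frequency. cgauss (coeff_weight p k)" UNIV
    by (rule product_prob_space_cgauss)
  have "distr (coeff_law p) (coeff_lebesgue N) (\<lambda>z. restrict z (Fplus N)) =
    distr (coeff_law p) (Pi\<^sub>M (Fplus N) (\<lambda>k. cgauss (coeff_weight p k))) (\<lambda>z. restrict z (Fplus N :: 'n frequency set))"
    by (rule distr_cong) (simp_all add: sets_coeff_lebesgue cong: sets_PiM_cong)
  also have "\<dots> = Pi\<^sub>M (Fplus N :: 'n frequency set) (\<lambda>k. cgauss (coeff_weight p k))"
    unfolding coeff_law_def by (rule G.distr_PiM_restrict_finite) auto
  also have "\<dots> = density (coeff_lebesgue N) (\<lambda>z. \<Prod>k\<in>Fplus N. ennreal (exp (- (coeff_weight p k * (cmod (z k))\<^sup>2)) / cgauss_Z (coeff_weight p k)))"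
    unfolding coeff_lebesgue_def by (rule PiM_cgauss) (auto simp: coeff_weight_pos)
  also have "(\<lambda>z. \<Prod>k\<in>Fplus N. ennreal (exp (- (coeff_weight p k * (cmod (z k))\<^sup>2)) / cgauss_Z (coeff_weight p k))) =
     (\<lambda>z :: 'n coefficients. ennreal (Gauss_weight p N z / norm_const p N TYPE('n)))"
  proof
    fix z :: "'n coefficients"
    have "Gauss_weight p N z = (\<Prod>k\<in>Fplus N. exp (- (coeff_weight p k * (cmod (z k))\<^sup>2)))"
      unfolding Gauss_weight_def
      by (auto simp: exp_sum coeff_weight_def dest: Fplus_nonzero simp flip: sum_negf intro!: prod.cong)
    then show "(\<Prod>k\<in>Fplus N. ennreal (exp (- (coeff_weight p k * (cmod (z k))\<^sup>2)) / cgauss_Z (coeff_weight p k))) =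
        ennreal (Gauss_weight p N z / norm_const p N TYPE('n))"
      by (subst prod_ennreal) (simp_all add: norm_const_def prod_dividef cgauss_Z(3)[OF coeff_weight_pos, THEN less_imp_le])
  qed
  finally show ?thesis .
qed

lemma nn_integral_Gauss_weight:
  fixes E :: "'n::{finite,linorder} coefficients set"
  assumes [measurable]: "E \<in> sets (coeff_lebesgue N)"
  shows "(\<integral>\<^sup>+z. ennreal (Gauss_weight p N z) * indicator E z \<partial>coeff_lebesgue N) =
    ennreal (norm_const p N TYPE('n)) * emeasure (coeff_law p) {z. restrict z (Fplus N) \<in> E}"
proof -
  let ?C = "norm_const p N TYPE('n)"
  have C: "?C > 0"
    by (rule norm_const_pos)
  have "emeasure (coeff_law p) {z. restrict z (Fplus N) \<in> E} =
      emeasure (distr (coeff_law p) (coeff_lebesgue N) (\<lambda>z. restrict z (Fplus N))) E"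
    by (subst emeasure_distr) (auto simp: vimage_def)
  also have "\<dots> = (\<integral>\<^sup>+z. ennreal (Gauss_weight p N z / ?C) * indicator E z \<partial>coeff_lebesgue N)"
    unfolding distr_restrict_coeff_law by (rule emeasure_density) measurable
  finally have "ennreal ?C * emeasure (coeff_law p) {z. restrict z (Fplus N) \<in> E} =
      (\<integral>\<^sup>+z. ennreal ?C * (ennreal (Gauss_weight p N z / ?C) * indicator E z) \<partial>coeff_lebesgue N)"
    by (simp add: nn_integral_cmult)
  also have "\<dots> = (\<integral>\<^sup>+z. ennreal (Gauss_weight p N z) * indicator E z \<partial>coeff_lebesgue N)"
    using C by (simp add: Gauss_weight_def flip: mult.assoc ennreal_mult)
  finally show ?thesis ..
qed

lemma restrict_in_O_set: "restrict z (Fplus N) \<in> O_set N \<longleftrightarrow> 0 < min_trig N z"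
  by (auto simp: O_set_iff min_trig_pos_iff coeff_lebesgue_def space_PiM)

lemma emeasure_coeff_law_cube_pos:
  assumes "finite K" "\<eta> > 0"
  shows "emeasure (coeff_law p) {z. \<forall>k\<in>K. cmod (z k - w k) < \<eta>} > 0"
proof -
  interpret G: product_prob_space "\<lambda>k :: int ^ 'a. cgauss (coeff_weight p k)" UNIV
    by (rule product_prob_space_cgauss)
  have "emeasure (coeff_law p) {z \<in> space (coeff_law p). \<forall>k\<in>K. z k \<in> ball (w k) \<eta>} =
     (\<Prod>k\<in>K. emeasure (cgauss (coeff_weight p k)) (ball (w k) \<eta>))"
    unfolding coeff_law_def by (rule G.emeasure_PiM_Collect) (use assms in auto)
  moreover have "\<dots> > 0"
    using emeasure_cgauss_open[OF coeff_weight_pos open_ball, of _ \<eta>] assms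
    by (auto simp: zero_less_iff_neq_zero)
  ultimately show ?thesis
    by (simp add: dist_norm norm_minus_commute)
qed

lemma emeasure_min_trig_pos: "emeasure (coeff_law p) {z :: 'n::{finite,linorder} coefficients. 0 < min_trig N z} > 0"
proof -
  define c where "c = real (card (Fplus N :: 'n frequency set))"
  \<comment> \<open>Coefficients below this bound move the constant polynomial 1 by less than 1.
    Using \<open>c + 1\<close> avoids division by 0 when \<open>Fplus N\<close> is empty.\<close>
  define \<eta> where "\<eta> = 1 / (2 * (c + 1))"
  have \<eta>: "\<eta> > 0" "2 * c * \<eta> < 1"
    by (auto simp: \<eta>_def c_def field_simps)
  have "{z. \<forall>k\<in>Fplus N. cmod (z k - 0) < \<eta>} \<subseteq> {z :: 'n coefficients. 0 < min_trig N z}"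
  proof safe
    fix z :: "'n coefficients"
    assume z: "\<forall>k\<in>Fplus N. cmod (z k - 0) < \<eta>"
    have "(\<Sum>k\<in>Fplus N. 2 * cmod (z k - 0)) \<le> (\<Sum>k\<in>(Fplus N :: 'n frequency set). 2 * \<eta>)"
      using z by (intro sum_mono mult_left_mono) (auto intro: less_imp_le)
    then have le: "(\<Sum>k\<in>Fplus N. 2 * cmod (z k - 0)) < 1"
      using \<eta> by (simp add: c_def mult_ac)
    have "0 < trig_poly N z x" for x
      using trig_poly_diff_le[of N z x "\<lambda>_. 0"] le by (simp add: trig_poly_def[of N "\<lambda>_. 0"])
    then show "0 < min_trig N z"
      by (simp add: min_trig_pos_iff)
  qed
  then have "emeasure (coeff_law p) {z :: 'n coefficients. \<forall>k\<in>Fplus N. cmod (z k - 0) < \<eta>} \<le>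
    emeasure (coeff_law p) {z :: 'n coefficients. 0 < min_trig N z}"
    by (rule emeasure_mono) measurable
  with emeasure_coeff_law_cube_pos[OF finite_Fplus \<eta>(1), of p N "\<lambda>_ :: 'n frequency. 0"] show ?thesis
    by (rule less_le_trans)
qed

text \<open>\<open>Gauss_Z\<close> is \<open>norm_const\<close> times the probability of
  \<open>0 < min_trig N z\<close>, so \<open>norm_const\<close> cancels and the renormalised
  restriction to \<open>O_set N\<close> becomes conditioning. From here on all these laws are images
  of one Gaussian law.\<close>

lemma P_N_eq:
  "P_N p N = distr (uniform_measure (coeff_law p) {z. 0 < min_trig N z}) borel
     (I_total N :: 'n::{finite,linorder} coefficients \<Rightarrow> 'n torus_prob)"
proof (rule measure_eqI)
  interpret prob_space "coeff_law p :: 'n coefficients measure"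
    by (rule prob_space_coeff_law)
  let ?C = "norm_const p N TYPE('n)" and ?\<Omega> = "coeff_law p :: 'n coefficients measure"
  let ?A = "{z :: 'n coefficients. 0 < min_trig N z}"
  have C: "?C > 0"
    by (rule norm_const_pos)
  have "(\<integral>\<^sup>+z. ennreal (Gauss_weight p N z) \<partial>(O_lebesgue N :: 'n coefficients measure)) = ennreal (?C * prob ?A)"
    unfolding O_lebesgue_def using C
    by (simp add: nn_integral_restrict_space nn_integral_Gauss_weight restrict_in_O_set ennreal_mult emeasure_eq_measure)
  moreover have "Gauss_weight p N \<in> borel_measurable (O_lebesgue N)"
    unfolding O_lebesgue_def by (rule measurable_restrict_space1) measurable
  ultimately have Z: "Gauss_Z TYPE('n) p N = ?C * prob ?A"
    unfolding Gauss_Z_def using C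
    by (subst integral_eq_nn_integral) (auto simp: Gauss_weight_def)
  have A: "prob ?A > 0"
    using emeasure_min_trig_pos[where 'n = 'n and p = p and N = N] by (simp add: emeasure_eq_measure)
  fix B :: "'n::{finite,linorder} torus_prob set" assume "B \<in> sets (P_N p N)"
  then have [measurable]: "B \<in> sets borel"
    by (simp add: P_N_def)
  define E where "E = I_map N -` B \<inter> (O_set N :: 'n coefficients set)"
  have sO: "space (O_lebesgue N) = (O_set N :: 'n coefficients set)"
    by (auto simp: O_lebesgue_def space_restrict_space O_set_def)
  have EO: "E \<in> sets (O_lebesgue N)"
    unfolding E_def sO[symmetric] by (rule measurable_sets[OF measurable_I_map]) simp
  then have E [measurable]: "E \<in> sets (coeff_lebesgue N)"
    unfolding O_lebesgue_def by (subst (asm) sets_restrict_space_iff) auto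
  have wO: "(\<lambda>z. ennreal (Gauss_weight p N z / Gauss_Z TYPE('n) p N)) \<in> borel_measurable (O_lebesgue N)"
    unfolding O_lebesgue_def by (rule measurable_restrict_space1) measurable
  have "emeasure (P_N p N) B = emeasure (Gamma_N p N) E"
    unfolding P_N_def E_def by (subst emeasure_distr) (auto simp: Gamma_N_def sO)
  also have "\<dots> = (\<integral>\<^sup>+z. ennreal (Gauss_weight p N z / Gauss_Z TYPE('n) p N) * indicator E z \<partial>O_lebesgue N)"
    unfolding Gamma_N_def by (rule emeasure_density[OF wO EO])
  also have "\<dots> = (\<integral>\<^sup>+z. ennreal (1 / Gauss_Z TYPE('n) p N) * (ennreal (Gauss_weight p N z) * indicator E z) \<partial>coeff_lebesgue N)"
    unfolding O_lebesgue_def using A C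
    by (subst nn_integral_restrict_space) (auto simp: Z E_def Gauss_weight_def mult_ac simp flip: ennreal_mult intro!: nn_integral_cong split: split_indicator)
  also have "\<dots> = ennreal (1 / Gauss_Z TYPE('n) p N) * (ennreal ?C * emeasure ?\<Omega> {z. restrict z (Fplus N) \<in> E})"
    by (subst nn_integral_cmult) (simp_all add: nn_integral_Gauss_weight)
  also have "{z. restrict z (Fplus N) \<in> E} = ?A \<inter> I_total N -` B"
    by (auto simp: E_def restrict_in_O_set I_total_def I_map_eq)
  also have "ennreal (1 / Gauss_Z TYPE('n) p N) * (ennreal ?C * emeasure ?\<Omega> (?A \<inter> I_total N -` B)) =
      emeasure ?\<Omega> (?A \<inter> I_total N -` B) / emeasure ?\<Omega> ?A"
    using A C by (simp add: Z emeasure_eq_measure divide_ennreal flip: ennreal_mult)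
  also have "\<dots> = emeasure (distr (uniform_measure ?\<Omega> ?A) borel (I_total N)) B"
  proof -
    have "I_total N -` B \<in> sets borel"
      using measurable_sets[OF measurable_I_total \<open>B \<in> sets borel\<close>] by simp
    then show ?thesis
      by (subst emeasure_distr) (auto simp: space_uniform_measure)
  qed
  finally show "emeasure (P_N p N) B = emeasure (distr (uniform_measure ?\<Omega> ?A) borel (I_total N)) B" .
qed (simp add: P_N_def)

section \<open>Almost sure summability of the weighted coefficients\<close>

lemma measurable_shell_sum [measurable]: "(\<lambda>z. shell_sum z n) \<in> borel_measurable borel"
  unfolding shell_sum_def by measurable

lemma measurable_smooth_coeffs [measurable]: "Measurable.pred borel smooth_coeffs"
proof -
  have "smooth_coeffs z \<longleftrightarrow> Cauchy (\<lambda>n. \<Sum>i<n. shell_sum z i)" for z :: "int ^ 'a::{finite,linorder} \<Rightarrow> complex"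
    by (simp add: smooth_coeffs_def summable_iff_convergent Cauchy_convergent_iff)
  moreover have "{z \<in> space borel. Cauchy (\<lambda>n. \<Sum>i<n. shell_sum z i)} \<in> sets borel"
    by measurable
  ultimately show ?thesis
    by (simp add: pred_def)
qed

lemma card_shell_le: "card (shell n :: 'n::{finite,linorder} frequency set) \<le> (2 * n + 1) ^ CARD('n)"
proof -
  let ?S = "UNIV \<rightarrow>\<^sub>E {- int n..int n} :: ('n \<Rightarrow> int) set"
  have "(shell n :: 'n frequency set) \<subseteq> vec_lambda ` ?S"
  proof
    fix k :: "'n frequency" assume "k \<in> shell n"
    then show "k \<in> vec_lambda ` ?S"
      by (intro image_eqI[of _ _ "vec_nth k"]) (auto simp: shell_def Fplus_def F_set_def)
  qed
  then have "card (shell n :: 'n frequency set) \<le> card (vec_lambda ` ?S :: 'n frequency set)"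
    by (intro card_mono finite_imageI finite_PiE) auto
  also have "\<dots> \<le> card ?S"
    by (intro card_image_le finite_PiE) auto
  also have "\<dots> = (2 * n + 1) ^ CARD('n)"
    by (simp add: card_PiE nat_add_distrib nat_mult_distrib)
  finally show ?thesis .
qed

text \<open>Each frequency of shell \<open>n\<close> has norm at least \<open>n\<close> and
  contributes a constant times |k|^(1 - p d), a decreasing power of |k|; for n \<ge> 1 there are at
  most (3 n)^d such frequencies.\<close>

lemma expected_shell_sum:
  fixes p :: real
  assumes p: "p \<ge> 5"
  obtains b where "summable b" "\<And>n. 0 \<le> b n"
    "\<And>n. (\<integral>\<^sup>+z. ennreal (shell_sum z n) \<partial>(coeff_law p :: 'n::{finite,linorder} coefficients measure)) \<le> ennreal (b n)"
proof -
  interpret G: product_prob_space "\<lambda>k :: 'n frequency. cgauss (coeff_weight p k)" UNIV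
    by (rule product_prob_space_cgauss)
  define d where "d = CARD('n)"
  have d: "d \<ge> 1"
    by (simp add: d_def Suc_leI)
  define \<kappa> where "\<kappa> = cgauss_moment 1 / cgauss_moment 0 / sqrt 2"
  have \<kappa>: "\<kappa> \<ge> 0"
    using cgauss_moment_0_pos by (simp add: \<kappa>_def cgauss_moment_def)
  \<comment> \<open>The factor \<open>3 ^ d\<close> comes from 2 n + 1 \<le> 3 n for n \<ge> 1; for
    n = 0 the shell is empty and \<open>powr\<close> gives 0.\<close>
  define b where "b n = 3 ^ d * \<kappa> * real n powr (- 2)" for n
  have mean: "(\<integral>\<^sup>+z. ennreal (cmod (z k)) \<partial>(coeff_law p :: 'n coefficients measure)) =
      ennreal (\<kappa> * int_vec_norm k powr (- (p * real d)))" if "k \<noteq> 0" for k :: "'n frequency"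
  proof -
    have pos: "int_vec_norm k > 0"
      using int_vec_norm_ge_1[OF that] by simp
    have "(\<integral>\<^sup>+z. ennreal (cmod (z k)) \<partial>coeff_law p) = (\<integral>\<^sup>+x. ennreal (cmod x) \<partial>distr (coeff_law p) (cgauss (coeff_weight p k)) (\<lambda>z. z k))"
    proof (rule nn_integral_distr[symmetric])
      show "(\<lambda>z. z k) \<in> coeff_law p \<rightarrow>\<^sub>M cgauss (coeff_weight p k)"
        by (simp cong: measurable_cong_sets add: measurable_coord)
    qed (simp cong: measurable_cong_sets)
    also have "\<dots> = (\<integral>\<^sup>+x. ennreal (cmod x) \<partial>cgauss (coeff_weight p k))"
      unfolding coeff_law_def by (subst G.PiM_component) auto
    also have "\<dots> = ennreal (cgauss_moment 1 / cgauss_moment 0 / sqrt (2 * coeff_weight p k))"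
      by (rule cgauss_mean[OF coeff_weight_pos])
    also have "sqrt (coeff_weight p k) = int_vec_norm k powr (p * real d)"
      using that pos by (simp add: coeff_weight_def d_def powr_half_sqrt[symmetric] powr_powr)
    then have "cgauss_moment 1 / cgauss_moment 0 / sqrt (2 * coeff_weight p k) = \<kappa> * int_vec_norm k powr (- (p * real d))"
      by (simp add: \<kappa>_def real_sqrt_mult powr_minus field_simps)
    finally show ?thesis .
  qed
  have "(\<integral>\<^sup>+z. ennreal (shell_sum z n) \<partial>(coeff_law p :: 'n coefficients measure)) \<le> ennreal (b n)" for n
  proof (cases "n = 0")
    case True
    have "shell 0 = ({} :: 'n frequency set)"
      by (auto simp: shell_def Fplus_def F_set_def vec_eq_iff)
    then show ?thesis
      using True by (simp add: shell_sum_def)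
  next
    case False
    have term_le: "int_vec_norm k * (\<kappa> * int_vec_norm k powr (- (p * real d))) \<le> \<kappa> * real n powr (1 - p * real d)"
      if "k \<in> shell n" for k :: "'n frequency"
    proof -
      have k: "int_vec_norm k \<ge> 1" "int_vec_norm k \<ge> real n"
        using int_vec_norm_ge_1[OF shell_nonzero[OF that]] int_vec_norm_shell[OF that] by auto
      have "p * real d \<ge> 5 * 1"
        using p d by (intro mult_mono) auto
      then have "int_vec_norm k powr (1 - p * real d) \<le> real n powr (1 - p * real d)"
        using k False by (intro powr_mono2') auto
      moreover have "int_vec_norm k * int_vec_norm k powr (- (p * real d)) = int_vec_norm k powr (1 - p * real d)"
        using k(1) powr_add[of "int_vec_norm k" 1 "- (p * real d)"] by simp
      ultimately show ?thesis
        using \<kappa> by (simp add: mult.left_commute mult_left_mono)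
    qed
    have "(\<integral>\<^sup>+z. ennreal (shell_sum z n) \<partial>(coeff_law p :: 'n coefficients measure)) =
       (\<integral>\<^sup>+z. (\<Sum>k\<in>(shell n :: 'n frequency set). ennreal (int_vec_norm k) * ennreal (cmod (z k))) \<partial>coeff_law p)"
      by (simp add: shell_sum_def int_vec_norm_kvec sum_nonneg flip: ennreal_mult)
    also have "\<dots> = (\<Sum>k\<in>(shell n :: 'n frequency set). ennreal (int_vec_norm k) * (\<integral>\<^sup>+z. ennreal (cmod (z k)) \<partial>coeff_law p))"
      by (subst nn_integral_sum) (auto simp: nn_integral_cmult)
    also have "\<dots> = (\<Sum>k\<in>(shell n :: 'n frequency set). ennreal (int_vec_norm k * (\<kappa> * int_vec_norm k powr (- (p * real d)))))"
      using \<kappa> by (intro sum.cong refl) (simp add: mean shell_nonzero ennreal_mult int_vec_norm_kvec)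
    also have "\<dots> \<le> (\<Sum>k\<in>(shell n :: 'n frequency set). ennreal (\<kappa> * real n powr (1 - p * real d)))"
      by (intro sum_mono ennreal_leI term_le)
    also have "\<dots> = ennreal (real (card (shell n :: 'n frequency set)) * (\<kappa> * real n powr (1 - p * real d)))"
      using \<kappa> by (simp add: ennreal_mult ennreal_of_nat_eq_real_of_nat)
    also have "\<dots> \<le> ennreal (b n)"
    proof (rule ennreal_leI)
      have "real (card (shell n :: 'n frequency set)) \<le> (3 * real n) ^ d"
      proof -
        have "real (card (shell n :: 'n frequency set)) \<le> real ((2 * n + 1) ^ d)"
          unfolding d_def using card_shell_le[where 'n = 'n, of n] of_nat_le_iff by blast
        also have "\<dots> \<le> (3 * real n) ^ d"
          unfolding of_nat_power using False by (intro power_mono) auto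
        finally show ?thesis .
      qed
      also have "(3 * real n) ^ d = 3 ^ d * real n powr real d"
        using False by (simp add: power_mult_distrib powr_realpow)
      finally have "real (card (shell n :: 'n frequency set)) * (\<kappa> * real n powr (1 - p * real d)) \<le>
        3 ^ d * real n powr real d * (\<kappa> * real n powr (1 - p * real d))"
        using \<kappa> by (intro mult_right_mono) auto
      also have "\<dots> = 3 ^ d * \<kappa> * real n powr (real d + (1 - p * real d))"
        by (simp add: powr_add)
      also have "\<dots> \<le> b n"
      proof -
        \<comment> \<open>With p \<ge> 5 and d \<ge> 1 the exponent is at most 1 - 4 d \<le>
          -3.\<close>
        have "5 * real d \<le> p * real d"
          using p by (intro mult_right_mono) auto
        then have "real d + (1 - p * real d) \<le> - 2"
          using d by linarith
        then show ?thesis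
          unfolding b_def using \<kappa> False by (intro mult_left_mono powr_mono) auto
      qed
      finally show "real (card (shell n :: 'n frequency set)) * (\<kappa> * real n powr (1 - p * real d)) \<le> b n" .
    qed
    finally show ?thesis .
  qed
  moreover have "summable b"
    unfolding b_def by (intro summable_mult) (simp add: summable_real_powr_iff)
  moreover have "b n \<ge> 0" for n
    using \<kappa> by (simp add: b_def)
  ultimately show ?thesis
    using that by blast
qed

text \<open>First moment: if the tail were almost surely at least \<eta>, so would be its
  expectation, which is at most the tail of a convergent series. In \<open>ennreal\<close> the tail
  makes sense before summability is known.\<close>

lemma shell_tail_small_prob:
  fixes p :: real
  assumes p: "p \<ge> 5" and \<eta>: "\<eta> > 0"
  obtains M where "\<And>N. N \<ge> M \<Longrightarrow>
    emeasure (coeff_law p) {z :: 'n::{finite,linorder} coefficients. (\<Sum>n. ennreal (shell_sum z (n + N))) < ennreal \<eta>} > 0"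
proof -
  let ?\<Omega> = "coeff_law p :: 'n coefficients measure"
  interpret prob_space ?\<Omega> by (rule prob_space_coeff_law)
  obtain b where b: "summable b" "\<And>n. 0 \<le> b n" "\<And>n. (\<integral>\<^sup>+z. ennreal (shell_sum z n) \<partial>?\<Omega>) \<le> ennreal (b n)"
    using expected_shell_sum[OF p, where 'n = 'n] by metis
  have "(\<lambda>N. \<Sum>n. b (n + N)) \<longlonglongrightarrow> 0"
  proof -
    have "(\<lambda>N. suminf b - (\<Sum>n<N. b n)) \<longlonglongrightarrow> suminf b - suminf b"
      by (intro tendsto_intros summable_LIMSEQ b)
    then show ?thesis
      by (simp add: suminf_minus_initial_segment[OF b(1)])
  qed
  from order_tendstoD(2)[OF this \<eta>] obtain M where M: "\<And>N. N \<ge> M \<Longrightarrow> (\<Sum>n. b (n + N)) < \<eta>"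
    by (auto simp: eventually_sequentially)
  have "emeasure ?\<Omega> {z. (\<Sum>n. ennreal (shell_sum z (n + N))) < ennreal \<eta>} > 0" if "N \<ge> M" for N
  proof (rule ccontr)
    let ?T = "\<lambda>z. (\<Sum>n. ennreal (shell_sum z (n + N)))"
    assume "\<not> ?thesis"
    then have "emeasure ?\<Omega> {z \<in> space ?\<Omega>. \<not> \<not> ?T z < ennreal \<eta>} = 0"
      by (simp add: zero_less_iff_neq_zero)
    moreover have "{z \<in> space ?\<Omega>. \<not> \<not> ?T z < ennreal \<eta>} \<in> sets ?\<Omega>"
      by measurable
    ultimately have "AE z in ?\<Omega>. \<not> ?T z < ennreal \<eta>"
      by (subst AE_iff_measurable) auto
    then have "(\<integral>\<^sup>+z. ennreal \<eta> \<partial>?\<Omega>) \<le> (\<integral>\<^sup>+z. ?T z \<partial>?\<Omega>)"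
      by (intro nn_integral_mono_AE) (auto simp: not_less)
    also have "\<dots> = (\<Sum>n. \<integral>\<^sup>+z. ennreal (shell_sum z (n + N)) \<partial>?\<Omega>)"
      by (rule nn_integral_suminf) measurable
    also have "\<dots> \<le> (\<Sum>n. ennreal (b (n + N)))"
      by (intro suminf_le b) auto
    also have "\<dots> = ennreal (\<Sum>n. b (n + N))"
      using b by (intro suminf_ennreal2) (simp_all add: summable_iff_shift)
    also have "\<dots> < ennreal \<eta>"
      using M[OF that] \<eta> by (simp add: ennreal_less_iff suminf_nonneg b summable_iff_shift)
    finally show False
      by (simp add: emeasure_space_1[simplified])
  qed
  then show ?thesis
    using that by blast
qed

lemma AE_smooth_coeffs:
  fixes p :: real
  assumes p: "p \<ge> 5"
  shows "AE z in (coeff_law p :: 'n::{finite,linorder} coefficients measure). smooth_coeffs z"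
proof -
  let ?\<Omega> = "coeff_law p :: 'n coefficients measure"
  obtain b where b: "summable b" "\<And>n. 0 \<le> b n" "\<And>n. (\<integral>\<^sup>+z. ennreal (shell_sum z n) \<partial>?\<Omega>) \<le> ennreal (b n)"
    using expected_shell_sum[OF p, where 'n = 'n] by metis
  have "(\<integral>\<^sup>+z. (\<Sum>n. ennreal (shell_sum z n)) \<partial>?\<Omega>) = (\<Sum>n. \<integral>\<^sup>+z. ennreal (shell_sum z n) \<partial>?\<Omega>)"
    by (rule nn_integral_suminf) measurable
  also have "\<dots> \<le> (\<Sum>n. ennreal (b n))"
    by (intro suminf_le b) auto
  also have "\<dots> = ennreal (\<Sum>n. b n)"
    using b by (intro suminf_ennreal2) simp_all
  also have "\<dots> < \<infinity>"
    by simp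
  finally have "AE z in ?\<Omega>. (\<Sum>n. ennreal (shell_sum z n)) \<noteq> \<infinity>"
    by (intro nn_integral_noteq_infinite) auto
  then show ?thesis
    by eventually_elim (auto simp: smooth_coeffs_def shell_sum_nonneg intro: summable_suminf_not_top)
qed

section \<open>Resampling one coordinate\<close>

lemma distr_coeff_law_resample:
  "distr (cgauss (coeff_weight p k) \<Otimes>\<^sub>M coeff_law p) (coeff_law p) (\<lambda>(x, z). z(k := x)) = coeff_law p"
  using distr_pair_PiM_eq_PiM[of UNIV "\<lambda>k. cgauss (coeff_weight p k)" k]
  by (simp add: coeff_law_def prob_space_cgauss coeff_weight_pos)

lemma measurable_resample [measurable]:
  fixes k :: "int ^ 'a::finite"
  shows "(\<lambda>(x, z). z(k := x)) \<in> cgauss a \<Otimes>\<^sub>M coeff_law p \<rightarrow>\<^sub>M coeff_law p"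
  unfolding coeff_law_def
proof (rule measurable_PiM_single')
  fix j :: "int ^ 'a::finite"
  have *: "(\<lambda>xz. snd xz j) \<in> cgauss a \<Otimes>\<^sub>M Pi\<^sub>M UNIV (\<lambda>k. cgauss (coeff_weight p k)) \<rightarrow>\<^sub>M cgauss (coeff_weight p j)"
    by measurable
  have "fst \<in> cgauss a \<Otimes>\<^sub>M Pi\<^sub>M UNIV (\<lambda>k. cgauss (coeff_weight p k)) \<rightarrow>\<^sub>M cgauss (coeff_weight p j)"
    using measurable_fst[of "cgauss a" "Pi\<^sub>M UNIV (\<lambda>k. cgauss (coeff_weight p k))"]
    by (simp cong: measurable_cong_sets)
  with * show "(\<lambda>xz. (case xz of (x, z) \<Rightarrow> z(k := x)) j) \<in>
      cgauss a \<Otimes>\<^sub>M Pi\<^sub>M UNIV (\<lambda>k. cgauss (coeff_weight p k)) \<rightarrow>\<^sub>M cgauss (coeff_weight p j)"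
    by (cases "j = k") (simp_all add: case_prod_beta)
qed (auto simp: space_PiM)

text \<open>Rewrites a probability under the infinite product as one on a product of two factors,
  where Fubini and the formula for rectangles apply.\<close>

lemma emeasure_coeff_law_resample:
  assumes "B \<in> sets borel"
  shows "emeasure (coeff_law p) B =
    emeasure (cgauss (coeff_weight p k) \<Otimes>\<^sub>M coeff_law p) {(x, z). z(k := x) \<in> B}"
proof -
  have "emeasure (coeff_law p) B =
      emeasure (distr (cgauss (coeff_weight p k) \<Otimes>\<^sub>M coeff_law p) (coeff_law p) (\<lambda>(x, z). z(k := x))) B"
    unfolding distr_coeff_law_resample ..
  also have "\<dots> = emeasure (cgauss (coeff_weight p k) \<Otimes>\<^sub>M coeff_law p)
      ((\<lambda>(x, z). z(k := x)) -` B \<inter> space (cgauss (coeff_weight p k) \<Otimes>\<^sub>M coeff_law p))"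
    using assms by (intro emeasure_distr) auto
  also have "(\<lambda>(x, z). z(k := x)) -` B \<inter> space (cgauss (coeff_weight p k) \<Otimes>\<^sub>M coeff_law p) = {(x, z). z(k := x) \<in> B}"
    by (auto simp: space_pair_measure)
  finally show ?thesis .
qed

text \<open>The coordinates in \<open>K\<close> are resampled one at a time, which replaces independence of the
  coordinates in \<open>K\<close> from the others.\<close>

lemma emeasure_coeff_law_insensitive_pos:
  fixes K :: "(int ^ 'a::finite) set"
  assumes K: "finite K" and \<eta>: "\<eta> > 0" and T: "T \<in> sets borel" "emeasure (coeff_law p) T > 0"
    "\<And>z w. (\<And>k. k \<notin> K \<Longrightarrow> z k = w k) \<Longrightarrow> z \<in> T \<longleftrightarrow> w \<in> T"
  shows "emeasure (coeff_law p) (T \<inter> {z. \<forall>k\<in>K. cmod (z k - w k) < \<eta>}) > 0"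
  using K T(3)
proof (induction K)
  case empty
  show ?case
    using T(2) by simp
next
  case (insert k K)
  interpret C: prob_space "coeff_law p :: (int ^ 'a::finite \<Rightarrow> complex) measure" by (rule prob_space_coeff_law)
  interpret G: prob_space "cgauss (coeff_weight p k)"
    by (intro prob_space_cgauss coeff_weight_pos)
  define B where "B K = {z :: int ^ 'a::finite \<Rightarrow> complex. \<forall>k\<in>K. cmod (z k - w k) < \<eta>}" for K
  have B [measurable]: "B J \<in> sets borel" if "finite J" for J
  proof -
    have "{z \<in> space borel. \<forall>k\<in>J. cmod (z k - w k) < \<eta>} \<in> sets (borel :: (int ^ 'a::finite \<Rightarrow> complex) measure)"
      using that by (intro sets.sets_Collect_finite_All) measurable
    then show ?thesis
      by (simp add: B_def)
  qed
  have T' [measurable]: "T \<inter> B K \<in> sets borel"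
    using T(1) B[OF insert.hyps(1)] by blast
  have ins: "z \<in> T \<longleftrightarrow> z' \<in> T" if "\<And>j. j \<notin> K \<Longrightarrow> z j = z' j" for z z'
    by (rule insert.prems) (use that in simp)
  have IH: "emeasure (coeff_law p) (T \<inter> B K) > 0"
    unfolding B_def by (rule insert.IH) (rule ins)
  \<comment> \<open>As \<open>k\<close> is not in \<open>K\<close>, resampling it affects neither
    \<open>T\<close> nor the constraints on \<open>K\<close>, so the event becomes a
    rectangle.\<close>
  have upd: "z(k := x) \<in> T \<inter> B (insert k K) \<longleftrightarrow> x \<in> ball (w k) \<eta> \<and> z \<in> T \<inter> B K" for x z
  proof -
    have "z(k := x) \<in> T \<longleftrightarrow> z \<in> T"
      by (rule insert.prems) simp
    moreover have "z(k := x) \<in> B (insert k K) \<longleftrightarrow> x \<in> ball (w k) \<eta> \<and> z \<in> B K"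
    proof -
      have "(\<forall>j\<in>K. cmod ((z(k := x)) j - w j) < \<eta>) \<longleftrightarrow> (\<forall>j\<in>K. cmod (z j - w j) < \<eta>)"
        using insert.hyps(2) by (intro ball_cong) auto
      then show ?thesis
        by (simp add: B_def dist_norm norm_minus_commute)
    qed
    ultimately show ?thesis
      by blast
  qed
  have "T \<inter> B (insert k K) \<in> sets borel"
    using T(1) B[of "insert k K"] insert.hyps(1) by blast
  then have "emeasure (coeff_law p) (T \<inter> B (insert k K)) =
     emeasure (cgauss (coeff_weight p k) \<Otimes>\<^sub>M coeff_law p) {(x, z). z(k := x) \<in> T \<inter> B (insert k K)}"
    by (rule emeasure_coeff_law_resample)
  also have "{(x, z). z(k := x) \<in> T \<inter> B (insert k K)} = ball (w k) \<eta> \<times> (T \<inter> B K)"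
    unfolding upd by blast
  also have "emeasure (cgauss (coeff_weight p k) \<Otimes>\<^sub>M coeff_law p) (ball (w k) \<eta> \<times> (T \<inter> B K)) =
      emeasure (cgauss (coeff_weight p k)) (ball (w k) \<eta>) * emeasure (coeff_law p) (T \<inter> B K)"
    by (rule C.emeasure_pair_measure_Times) (use T' in simp_all)
  also have "\<dots> > 0"
    using IH emeasure_cgauss_open[OF coeff_weight_pos open_ball, of "w k" \<eta>] \<eta>
    by (auto simp: zero_less_iff_neq_zero)
  finally show ?case
    by (simp only: B_def)
qed

section \<open>The minimum of the limit is almost surely non-zero\<close>

lemma frontier_positivity:
  fixes T :: "'n::finite torus \<Rightarrow> real"
  assumes T: "continuous_on UNIV T"
  shows "{w. (INF x. T x + 2 * Re (w * echar k x)) = 0} \<subseteq> frontier {w. \<forall>x. 0 \<le> T x + 2 * Re (w * echar k x)}"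
proof
  define C where "C = {w. \<forall>x. 0 \<le> T x + 2 * Re (w * echar k x)}"
  fix w assume w: "w \<in> {w. (INF x. T x + 2 * Re (w * echar k x)) = 0}"
  have cont: "continuous_on UNIV (\<lambda>x. T x + 2 * Re (w * echar k x))"
    by (intro continuous_intros T)
  obtain x0 where x0: "(INF x. T x + 2 * Re (w * echar k x)) = T x0 + 2 * Re (w * echar k x0)"
    "\<And>x. T x0 + 2 * Re (w * echar k x0) \<le> T x + 2 * Re (w * echar k x)"
    using INF_torus_attained[OF cont] by blast
  have zero: "T x0 + 2 * Re (w * echar k x0) = 0"
    using w x0(1) by simp
  have "0 \<le> T x + 2 * Re (w * echar k x)" for x
    using x0(2)[of x] unfolding zero .
  then have "w \<in> C"
    by (simp only: C_def mem_Collect_eq) blast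
  then have "w \<in> closure C"
    using closure_subset by blast
  moreover have "w \<notin> interior C"
  proof
    assume "w \<in> interior C"
    then obtain e where e: "e > 0" "ball w e \<subseteq> C"
      unfolding mem_interior by blast
    \<comment> \<open>Moving \<open>w\<close> against the phase of the character at the minimiser
      \<open>x0\<close> lowers the value there from 0 to \<open>- e\<close>, while \<open>w'\<close>
      stays within distance \<open>e\<close> of \<open>w\<close>.\<close>
    define w' where "w' = w - complex_of_real (e / 2) * cnj (echar k x0)"
    have "cmod (w - w') < e"
      using e(1) by (simp add: w'_def norm_mult)
    then have "w' \<in> ball w e"
      by (simp add: dist_norm)
    then have "w' \<in> C"
      using e(2) by blast
    moreover have "w' * echar k x0 = w * echar k x0 - complex_of_real (e / 2)"
    proof -
      have "cnj (echar k x0) * echar k x0 = 1"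
        using complex_norm_square[of "echar k x0"] by (simp add: mult.commute)
      then show ?thesis
        unfolding w'_def left_diff_distrib mult.assoc by (simp only: mult_1_right)
    qed
    ultimately have "0 \<le> T x0 + 2 * Re (w * echar k x0 - complex_of_real (e / 2))"
      unfolding C_def mem_Collect_eq by metis
    with zero e(1) show False
      by simp
  qed
  ultimately show "w \<in> frontier {w. \<forall>x. 0 \<le> T x + 2 * Re (w * echar k x)}"
    unfolding C_def[symmetric] frontier_def by blast
qed

text \<open>For each \<open>x\<close> the condition is affine in \<open>w\<close>; the set is an
  intersection of half-planes.\<close>

lemma convex_positivity: "convex {w. \<forall>x. 0 \<le> T x + 2 * Re (w * echar k x)}"
  unfolding convex_def
proof (intro ballI allI impI)
  fix w w' and u v :: real
  assume w: "w \<in> {w. \<forall>x. 0 \<le> T x + 2 * Re (w * echar k x)}" "w' \<in> {w. \<forall>x. 0 \<le> T x + 2 * Re (w * echar k x)}"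
    and uv: "0 \<le> u" "0 \<le> v" "u + v = 1"
  have "0 \<le> T x + 2 * Re ((u *\<^sub>R w + v *\<^sub>R w') * echar k x)" for x
  proof -
    have "T x + 2 * Re ((u *\<^sub>R w + v *\<^sub>R w') * echar k x) =
        (u + v) * T x + (u * (2 * Re (w * echar k x)) + v * (2 * Re (w' * echar k x)))"
      using uv(3) by (simp add: algebra_simps)
    also have "\<dots> = u * (T x + 2 * Re (w * echar k x)) + v * (T x + 2 * Re (w' * echar k x))"
      by (simp only: distrib_left distrib_right add_ac)
    also have "\<dots> \<ge> 0"
      using w uv by (intro add_nonneg_nonneg[OF mult_nonneg_nonneg mult_nonneg_nonneg]) blast+
    finally show ?thesis .
  qed
  then show "u *\<^sub>R w + v *\<^sub>R w' \<in> {w. \<forall>x. 0 \<le> T x + 2 * Re (w * echar k x)}"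
    by simp
qed

text \<open>The coordinate that is resampled. With all entries positive it is in the half-system for
  every dimension and every order of the coordinates; level 2 is the first non-empty one.\<close>

definition all_ones :: "int ^ 'n::finite" where
  "all_ones = (\<chi> i. 1)"

lemma all_ones_Fplus: "all_ones \<in> (Fplus 2 :: 'n::{finite,linorder} frequency set)"
proof -
  have "\<not> i < Min (UNIV :: 'n set)" for i :: 'n
    by (rule leD) (rule Min_le; simp)
  then have "\<exists>j :: 'n. \<forall>i. \<not> i < j"
    by blast
  then show ?thesis
    by (auto simp: Fplus_def F_set_def all_ones_def vec_eq_iff)
qed

text \<open>\<open>k\<close> lies in no shell of index at least \<open>M\<close>, so only finitely
  many shell sums change.\<close>

lemma smooth_coeffs_upd:
  assumes "k \<in> Fplus M"
  shows "smooth_coeffs (z(k := x)) \<longleftrightarrow> smooth_coeffs z"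
  unfolding smooth_coeffs_def
proof (rule summable_cong)
  show "\<forall>\<^sub>F n in sequentially. shell_sum (z(k := x)) n = shell_sum z n"
    using eventually_ge_at_top[of M]
  proof eventually_elim
    case (elim n)
    then have "k \<notin> shell n"
      using assms Fplus_mono[OF elim, where 'a = 'a] by (auto simp: shell_def)
    then show ?case
      unfolding shell_sum_def by (intro sum.cong) auto
  qed
qed

lemma trig_poly_upd:
  assumes "k \<in> Fplus N"
  shows "trig_poly N (z(k := x)) y = trig_poly N (z(k := 0)) y + 2 * Re (x * echar (- k) y)"
proof -
  have "(\<Sum>j\<in>Fplus N - {k}. 2 * Re ((z(k := x)) j * echar (- j) y)) =
      (\<Sum>j\<in>Fplus N - {k}. 2 * Re ((z(k := 0)) j * echar (- j) y))"
    by (intro sum.cong) auto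
  then show ?thesis
    unfolding trig_poly_eq_sum sum.remove[OF finite_Fplus assms] by simp
qed

text \<open>The series is affine in a single coefficient; with the others frozen, positivity is thus
  a convex condition in the plane.\<close>

lemma fourier_series_upd:
  assumes "k \<in> Fplus M" "smooth_coeffs z"
  shows "fourier_series (z(k := x)) y = fourier_series (z(k := 0)) y + 2 * Re (x * echar (- k) y)"
proof (rule LIMSEQ_unique)
  show "(\<lambda>N. trig_poly N (z(k := x)) y) \<longlonglongrightarrow> fourier_series (z(k := x)) y"
    by (intro trig_poly_tendsto) (simp add: smooth_coeffs_upd[OF assms(1)] assms(2))
  have "(\<lambda>N. trig_poly N (z(k := 0)) y + 2 * Re (x * echar (- k) y)) \<longlonglongrightarrow>
      fourier_series (z(k := 0)) y + 2 * Re (x * echar (- k) y)"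
    by (intro tendsto_add tendsto_const trig_poly_tendsto) (simp add: smooth_coeffs_upd[OF assms(1)] assms(2))
  moreover have "\<forall>\<^sub>F N in sequentially. trig_poly N (z(k := 0)) y + 2 * Re (x * echar (- k) y) = trig_poly N (z(k := x)) y"
    using eventually_ge_at_top[of M]
  proof eventually_elim
    case (elim N)
    then have "k \<in> Fplus N"
      using assms Fplus_mono[OF elim, where 'a = 'a] by auto
    then show ?case
      using trig_poly_upd[of k N z x y] by simp
  qed
  ultimately show "(\<lambda>N. trig_poly N (z(k := x)) y) \<longlonglongrightarrow> fourier_series (z(k := 0)) y + 2 * Re (x * echar (- k) y)"
    by (rule Lim_transform_eventually)
qed

text \<open>Writes the minimum of the limit as a limit of Borel functions of the coefficients, which
  makes the events below Borel.\<close>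

lemma lim_min_trig:
  assumes "smooth_coeffs z"
  shows "(\<lambda>N. min_trig N z) \<longlonglongrightarrow> (INF x. fourier_series z x)" "lim (\<lambda>N. min_trig N z) = (INF x. fourier_series z x)"
proof -
  show *: "(\<lambda>N. min_trig N z) \<longlonglongrightarrow> (INF x. fourier_series z x)"
    using INF_trig_poly_tendsto[OF assms] unfolding min_trig_def .
  show "lim (\<lambda>N. min_trig N z) = (INF x. fourier_series z x)"
    using * by (rule limI)
qed

lemma AE_fourier_series_min_nonzero:
  "AE z in (coeff_law p :: 'n::{finite,linorder} coefficients measure).
     smooth_coeffs z \<longrightarrow> (INF x. fourier_series z x) \<noteq> 0"
proof -
  let ?k = "all_ones :: 'n frequency"
  let ?\<Omega> = "coeff_law p :: 'n coefficients measure"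
  let ?G = "cgauss (coeff_weight p ?k)"
  interpret C: prob_space ?\<Omega> by (rule prob_space_coeff_law)
  interpret G: prob_space ?G by (intro prob_space_cgauss coeff_weight_pos)
  interpret CG: pair_sigma_finite ?G ?\<Omega> ..
  define Bad where "Bad = {z :: 'n coefficients. smooth_coeffs z \<and> lim (\<lambda>N. min_trig N z) = 0}"
  have Bad: "Bad \<in> sets borel"
  proof -
    have "{z \<in> space borel. smooth_coeffs z \<and> lim (\<lambda>N. min_trig N z) = 0} \<in> sets (borel :: 'n coefficients measure)"
      by measurable
    then show ?thesis
      by (simp add: Bad_def)
  qed
  define D where "D = {(x, z). z(?k := x) \<in> Bad}"
  have D: "D \<in> sets (?G \<Otimes>\<^sub>M ?\<Omega>)"
  proof -
    have "(\<lambda>(x, z). z(?k := x)) -` Bad \<inter> space (?G \<Otimes>\<^sub>M ?\<Omega>) \<in> sets (?G \<Otimes>\<^sub>M ?\<Omega>)"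
      using Bad by (intro measurable_sets[OF measurable_resample]) simp
    also have "(\<lambda>(x, z). z(?k := x)) -` Bad \<inter> space (?G \<Otimes>\<^sub>M ?\<Omega>) = D"
      by (auto simp: D_def space_pair_measure)
    finally show ?thesis .
  qed
  have "emeasure ?G ((\<lambda>x. (x, z)) -` D) = 0" for z
  proof (cases "smooth_coeffs z")
    case True
    define T where "T = fourier_series (z(?k := 0))"
    have T: "continuous_on UNIV T"
      unfolding T_def by (intro continuous_on_fourier_series) (simp add: smooth_coeffs_upd[OF all_ones_Fplus] True)
    let ?S = "(\<lambda>x. (x, z)) -` D"
    have "?S \<subseteq> {w. (INF y. T y + 2 * Re (w * echar (- ?k) y)) = 0}"
    proof
      fix w assume "w \<in> ?S"
      then have "smooth_coeffs (z(?k := w))" "lim (\<lambda>N. min_trig N (z(?k := w))) = 0"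
        by (auto simp: D_def Bad_def)
      then have "(INF y. fourier_series (z(?k := w)) y) = 0"
        by (simp add: lim_min_trig)
      moreover have "fourier_series (z(?k := w)) = (\<lambda>y. T y + 2 * Re (w * echar (- ?k) y))"
        unfolding T_def by (rule ext) (rule fourier_series_upd[OF all_ones_Fplus True])
      ultimately show "w \<in> {w. (INF y. T y + 2 * Re (w * echar (- ?k) y)) = 0}"
        by (simp only: mem_Collect_eq)
    qed
    also note frontier_positivity[OF T, of "- ?k"]
    finally have "negligible ?S"
      by (rule negligible_subset[OF negligible_convex_frontier[OF convex_positivity]])
    moreover have "?S \<in> sets lborel"
      using sets_Pair2[OF D, of z] by simp
    ultimately have "?S \<in> null_sets lborel"
      by (simp add: negligible_iff_null_sets null_sets_completion_iff)
    then have "?S \<in> null_sets ?G"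
      by (rule null_sets_cgauss)
    then show ?thesis
      by (simp add: null_sets_def)
  next
    case False
    then have "(\<lambda>x. (x, z)) -` D = {}"
      by (auto simp: D_def Bad_def smooth_coeffs_upd[OF all_ones_Fplus])
    then show ?thesis
      by simp
  qed
  then have "emeasure (?G \<Otimes>\<^sub>M ?\<Omega>) D = 0"
    by (simp add: CG.emeasure_pair_measure_alt2[OF D])
  then have "emeasure ?\<Omega> Bad = 0"
    using emeasure_coeff_law_resample[OF Bad, of p ?k] by (simp add: D_def)
  then have "AE z in ?\<Omega>. z \<notin> Bad"
    using Bad by (intro AE_not_in) (auto simp: null_sets_def)
  then show ?thesis
    by eventually_elim (auto simp: Bad_def lim_min_trig)
qed

section \<open>The limit law\<close>

text \<open>Smoothness belongs to the event because \<open>fourier_series\<close> is a bare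
  \<open>lim\<close>, meaningful only where the partial sums converge.\<close>

definition limit_event :: "'n::{finite,linorder} coefficients set" where
  "limit_event = {z. smooth_coeffs z \<and> (\<forall>x. 0 < fourier_series z x)}"

definition limit_map :: "'n::{finite,linorder} coefficients \<Rightarrow> 'n torus_prob" where
  "limit_map z = (if z \<in> limit_event then density_prob (fourier_series z) else uniform_prob)"

definition limit_law :: "real \<Rightarrow> 'n::{finite,linorder} torus_prob measure" where
  "limit_law p = distr (uniform_measure (coeff_law p) limit_event) borel limit_map"

lemma limit_event_eq: "limit_event = {z. smooth_coeffs z \<and> 0 < lim (\<lambda>N. min_trig N z)}"
  by (auto simp: limit_event_def lim_min_trig INF_torus_pos_iff continuous_on_fourier_series)

lemma sets_limit_event [measurable]: "limit_event \<in> sets borel"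
proof -
  have "{z \<in> space borel. smooth_coeffs z \<and> 0 < lim (\<lambda>N. min_trig N z)} \<in> sets (borel :: (int ^ 'a::{finite,linorder} \<Rightarrow> complex) measure)"
    by measurable
  then show ?thesis
    by (simp add: limit_event_eq)
qed

lemma eventually_min_trig_pos:
  assumes "z \<in> limit_event"
  shows "\<forall>\<^sub>F N in sequentially. 0 < min_trig N z"
  using eventually_trig_poly_pos[of z] assms by (simp add: limit_event_def min_trig_pos_iff)

lemma I_total_tendsto:
  assumes "z \<in> limit_event"
  shows "(\<lambda>N. I_total N z) \<longlonglongrightarrow> limit_map z"
proof -
  have "(\<lambda>N. I_map N z) \<longlonglongrightarrow> limit_map z"
    using I_map_tendsto[of z] assms by (simp add: limit_event_def limit_map_def)
  moreover have "\<forall>\<^sub>F N in sequentially. I_map N z = I_total N z"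
    using eventually_min_trig_pos[OF assms] by eventually_elim (simp add: I_total_def)
  ultimately show ?thesis
    by (rule Lim_transform_eventually)
qed

text \<open>A pointwise limit of Borel maps into a metric space. Off \<open>limit_event\<close>,
  where \<open>I_total N z\<close> need not converge, the sequence is frozen at the default.\<close>

lemma measurable_limit_map [measurable]: "limit_map \<in> borel_measurable borel"
proof (rule borel_measurable_LIMSEQ_metric)
  show "(\<lambda>z. if z \<in> limit_event then I_total N z else uniform_prob) \<in> borel_measurable borel" for N
    by measurable
  show "(\<lambda>N. if z \<in> limit_event then I_total N z else uniform_prob) \<longlonglongrightarrow> limit_map z" for z
    by (cases "z \<in> limit_event") (simp_all add: I_total_tendsto, simp add: limit_map_def)
qed

text \<open>Together with \<open>pi2_I_total\<close>: on their respective events, limit and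
  approximation have the same first coefficients, those of \<open>z\<close>.\<close>

lemma pi2_limit_map: "z \<in> limit_event \<Longrightarrow> pi2 N (limit_map z) = restrict z (Fplus N)"
  by (simp add: limit_map_def limit_event_def pi2_fourier_series)

lemma pi2_I_total: "0 < min_trig N z \<Longrightarrow> pi2 N (I_total N z) = restrict z (Fplus N)"
  by (simp add: I_total_def min_trig_pos_iff pi2_I_map)

section \<open>Approximating a given measure with positive probability\<close>

lemma shell_sum_insensitive:
  fixes z w :: "'n::{finite,linorder} coefficients"
  assumes "\<And>k. k \<notin> Fplus N \<Longrightarrow> z k = w k"
  shows "shell_sum z (n + N) = shell_sum w (n + N)"
  unfolding shell_sum_def
proof (rule sum.cong[OF refl])
  fix k :: "'n frequency" assume "k \<in> shell (n + N)"
  then have "k \<notin> Fplus N"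
    using Fplus_mono[of N "n + N", where 'a = 'n] by (auto simp: shell_def)
  then show "int_vec_norm k * cmod (z k) = int_vec_norm k * cmod (w k)"
    using assms by simp
qed

lemma fourier_series_near_trig_poly:
  fixes z0 :: "'n::{finite,linorder} coefficients"
  assumes p: "p \<ge> 5" and e: "e > 0" and z0: "\<forall>k. k \<notin> Fplus N0 \<longrightarrow> z0 k = 0"
  obtains E where "E \<in> sets borel" "emeasure (coeff_law p) E > 0"
    "\<And>z. z \<in> E \<Longrightarrow> smooth_coeffs z"
    "\<And>z x. z \<in> E \<Longrightarrow> \<bar>fourier_series z x - trig_poly N0 z0 x\<bar> < e"
proof -
  \<comment> \<open>Error budget: \<open>2 * \<eta> = e / 4\<close> for the tail and
    \<open>2 * (c * \<eta>') \<le> e / 4\<close> for the head.\<close>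
  define \<eta> where "\<eta> = e / 8"
  have \<eta>: "\<eta> > 0"
    using e by (simp add: \<eta>_def)
  obtain M where M: "\<And>N. N \<ge> M \<Longrightarrow>
    emeasure (coeff_law p) {z :: 'n coefficients. (\<Sum>n. ennreal (shell_sum z (n + N))) < ennreal \<eta>} > 0"
    using shell_tail_small_prob[OF p \<eta>, where 'n = 'n] by blast
  \<comment> \<open>Large enough for the tail estimate and for all frequencies of \<open>z0\<close>
    to belong to the head.\<close>
  define N where "N = max M N0"
  define c where "c = real (card (Fplus N :: 'n frequency set))"
  define \<eta>' where "\<eta>' = e / (8 * (c + 1))"
  have c: "c \<ge> 0"
    by (simp add: c_def)
  then have \<eta>': "\<eta>' > 0" "c * \<eta>' \<le> e / 8"
    using e by (auto simp: \<eta>'_def field_simps)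
  define T where "T = {z :: 'n coefficients. (\<Sum>n. ennreal (shell_sum z (n + N))) < ennreal \<eta>}"
  define B where "B = {z. \<forall>k\<in>Fplus N. cmod (z k - z0 k) < \<eta>'}"
  have T: "T \<in> sets borel"
  proof -
    have "{z \<in> space borel. (\<Sum>n. ennreal (shell_sum z (n + N))) < ennreal \<eta>} \<in> sets (borel :: 'n coefficients measure)"
      by measurable
    then show ?thesis
      by (simp add: T_def)
  qed
  have B: "B \<in> sets borel"
  proof -
    have "{z \<in> space borel. \<forall>k\<in>Fplus N. cmod (z k - z0 k) < \<eta>'} \<in> sets borel"
      by (intro sets.sets_Collect_finite_All finite_Fplus) measurable
    then show ?thesis
      by (simp add: B_def)
  qed
  have "emeasure (coeff_law p) (T \<inter> B) > 0"
    unfolding B_def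
  proof (rule emeasure_coeff_law_insensitive_pos[OF finite_Fplus \<eta>'(1) T])
    show "emeasure (coeff_law p) T > 0"
      unfolding T_def by (rule M) (simp add: N_def)
    show "z \<in> T \<longleftrightarrow> w \<in> T" if "\<And>k. k \<notin> Fplus N \<Longrightarrow> z k = w k" for z w
      using shell_sum_insensitive[of N z w, OF that] by (simp add: T_def)
  qed
  moreover have smooth: "smooth_coeffs z" and tail: "(\<Sum>n. shell_sum z (n + N)) < \<eta>" if "z \<in> T" for z
  proof -
    have lt: "(\<Sum>n. ennreal (shell_sum z (n + N))) < ennreal \<eta>"
      using that by (simp add: T_def)
    then have sm: "summable (\<lambda>n. shell_sum z (n + N))"
      by (intro summable_suminf_not_top shell_sum_nonneg) auto
    then show "smooth_coeffs z"
      by (simp add: smooth_coeffs_def summable_iff_shift)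
    have "(\<Sum>n. ennreal (shell_sum z (n + N))) = ennreal (\<Sum>n. shell_sum z (n + N))"
      by (intro suminf_ennreal2 sm shell_sum_nonneg)
    with lt show "(\<Sum>n. shell_sum z (n + N)) < \<eta>"
      by (simp add: ennreal_less_iff suminf_nonneg[OF sm] shell_sum_nonneg)
  qed
  have "\<bar>fourier_series z x - trig_poly N0 z0 x\<bar> < e" if z: "z \<in> T \<inter> B" for z x
  proof -
    have "\<bar>fourier_series z x - trig_poly N z x\<bar> \<le> 2 * (\<Sum>n. shell_sum z (n + N))"
      using fourier_series_diff_le[OF smooth] z by blast
    moreover have "(\<Sum>n. shell_sum z (n + N)) < \<eta>"
      using tail z by blast
    moreover have "\<bar>trig_poly N z x - trig_poly N z0 x\<bar> \<le> 2 * (c * \<eta>')"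
    proof -
      have "(\<Sum>k\<in>Fplus N. 2 * cmod (z k - z0 k)) \<le> (\<Sum>k\<in>(Fplus N :: 'n frequency set). 2 * \<eta>')"
        using z by (intro sum_mono mult_left_mono) (auto simp: B_def intro: less_imp_le)
      then show ?thesis
        using trig_poly_diff_le[of N z x z0] by (simp add: c_def mult_ac)
    qed
    moreover have "trig_poly N z0 = trig_poly N0 z0"
      using z0 by (intro trig_poly_pad) (auto simp: N_def)
    ultimately show ?thesis
      using \<eta>'(2) e unfolding \<eta>_def by simp
  qed
  moreover have "T \<inter> B \<in> sets borel"
    using T B by blast
  ultimately show ?thesis
    using that[of "T \<inter> B"] smooth by blast
qed

lemma limit_map_near:
  fixes m :: "'n::{finite,linorder} torus_prob"
  assumes p: "p \<ge> 5" and e: "e > 0"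
  obtains E where "E \<in> sets borel" "emeasure (coeff_law p) E > 0" "E \<subseteq> limit_event"
    "\<And>z. z \<in> E \<Longrightarrow> dist (limit_map z) m < e"
proof -
  define d where "d = real CARD('n)"
  have d: "d > 0"
    by (simp add: d_def)
  \<comment> \<open>Uniform distance \<open>e1\<close> between densities costs at most
    \<open>d * e1 = e / 3\<close>. There are two such comparisons, series to polynomial and
    polynomial to \<open>h\<close>; the third \<open>e / 3\<close> leads from \<open>h\<close> to
    \<open>m\<close>.\<close>
  define e1 where "e1 = e / (3 * d)"
  have e1: "e1 > 0" "d * e1 = e / 3"
    using e d by (simp_all add: e1_def)
  obtain h where h: "torus_density h" "dist (density_prob h) m < e / 3"
    using density_prob_dense[of "e / 3" m] e by auto
  obtain N z0 where z0: "\<And>k. k \<notin> Fplus N \<Longrightarrow> z0 k = 0" "\<And>x. trig_poly N z0 x > 0"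
    "\<And>x. \<bar>trig_poly N z0 x - h x\<bar> < e1"
    by (rule torus_density_approx[OF h(1) e1(1)]) (rule that)
  have c: "0 < min_trig N z0"
    using z0(2) by (simp add: min_trig_pos_iff)
  have c': "min_trig N z0 \<le> trig_poly N z0 x" for x
  proof -
    obtain x0 where "min_trig N z0 = trig_poly N z0 x0" "\<And>x. trig_poly N z0 x0 \<le> trig_poly N z0 x"
      unfolding min_trig_def using INF_torus_attained[OF continuous_on_trig_poly] by blast
    then show ?thesis
      by simp
  qed
  \<comment> \<open>Staying within the minimum of the polynomial keeps the series positive, which
    puts \<open>E\<close> inside \<open>limit_event\<close>.\<close>
  define e2 where "e2 = min e1 (min_trig N z0)"
  have e2: "e2 > 0" "e2 \<le> e1" "e2 \<le> min_trig N z0"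
    using e1 c by (auto simp: e2_def)
  obtain E where E: "E \<in> sets borel" "emeasure (coeff_law p) E > 0" "\<And>z. z \<in> E \<Longrightarrow> smooth_coeffs z"
    "\<And>z x. z \<in> E \<Longrightarrow> \<bar>fourier_series z x - trig_poly N z0 x\<bar> < e2"
    by (rule fourier_series_near_trig_poly[OF p e2(1), of N z0]) (use z0(1) in blast, rule that)
  have pos: "0 < fourier_series z x" if "z \<in> E" for z x
    using E(4)[OF that, of x] e2(3) c'[of x] by linarith
  then have sub: "E \<subseteq> limit_event"
    using E(3) by (auto simp: limit_event_def)
  have "dist (limit_map z) m < e" if z: "z \<in> E" for z
  proof -
    have eq: "limit_map z = density_prob (fourier_series z)"
      using sub z by (auto simp: limit_map_def)
    have td: "torus_density (fourier_series z)" "torus_density (trig_poly N z0)"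
      using E(3)[OF z] pos[OF z] z0(2) by (auto intro: torus_density_fourier_series torus_density_trig_poly)
    have "dist (density_prob (fourier_series z)) (density_prob (trig_poly N z0)) \<le> d * e1"
      unfolding d_def using E(4)[OF z] e2(2) by (intro dist_density_prob_le td) (meson less_le_trans less_imp_le)
    moreover have "dist (density_prob (trig_poly N z0)) (density_prob h) \<le> d * e1"
      unfolding d_def using z0(3) by (intro dist_density_prob_le td h less_imp_le)
    ultimately show ?thesis
      unfolding eq e1(2) using h(2)
        dist_triangle[of "density_prob (fourier_series z)" m "density_prob (trig_poly N z0)"]
        dist_triangle[of "density_prob (trig_poly N z0)" m "density_prob h"] by linarith
  qed
  with E(1,2) sub show ?thesis
    using that by blast
qed

lemma emeasure_limit_event_pos:
  assumes "p \<ge> 5"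
  shows "emeasure (coeff_law p) (limit_event :: 'n::{finite,linorder} coefficients set) > 0"
proof -
  obtain E :: "'n coefficients set" where "E \<in> sets borel" "emeasure (coeff_law p) E > 0" "E \<subseteq> limit_event"
    by (rule limit_map_near[OF assms zero_less_one, of "uniform_prob :: 'n torus_prob"]) (rule that)
  then show ?thesis
    using emeasure_mono[of E limit_event "coeff_law p"] by (auto intro: less_le_trans)
qed

section \<open>The limit law: full support and regular densities\<close>

lemma prob_space_limit_law:
  assumes "p \<ge> 5"
  shows "prob_space (limit_law p :: 'n::{finite,linorder} torus_prob measure)"
proof -
  interpret C: prob_space "coeff_law p :: 'n::{finite,linorder} coefficients measure"
    by (rule prob_space_coeff_law)
  have "prob_space (uniform_measure (coeff_law p) (limit_event :: 'n coefficients set))"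
    using emeasure_limit_event_pos[OF assms, where 'n = 'n] by (intro prob_space_uniform_measure) auto
  then show ?thesis
    unfolding limit_law_def by (rule prob_space.prob_space_distr) simp
qed

lemma emeasure_limit_law:
  fixes B :: "'n::{finite,linorder} torus_prob set"
  assumes "B \<in> sets borel"
  shows "emeasure (limit_law p) B =
    emeasure (coeff_law p) (limit_event \<inter> limit_map -` B) /
      emeasure (coeff_law p) (limit_event :: 'n::{finite,linorder} coefficients set)"
proof -
  have "limit_map -` B \<in> sets borel"
    using measurable_sets[OF measurable_limit_map assms] by simp
  then show ?thesis
    unfolding limit_law_def using assms by (simp add: emeasure_distr)
qed

lemma measure_support_limit_law:
  assumes p: "p \<ge> 5"
  shows "measure_support (limit_law p :: 'n::{finite,linorder} torus_prob measure) = UNIV"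
proof -
  interpret C: prob_space "coeff_law p :: 'n::{finite,linorder} coefficients measure"
    by (rule prob_space_coeff_law)
  have "emeasure (limit_law p) U > 0" if U: "open U" "m \<in> U" for m :: "'n torus_prob" and U
  proof -
    obtain e where e: "e > 0" "ball m e \<subseteq> U"
      using U by (meson openE)
    obtain E where E: "E \<in> sets borel" "emeasure (coeff_law p) E > 0" "E \<subseteq> limit_event"
      "\<And>z. z \<in> E \<Longrightarrow> dist (limit_map z) m < e"
      using limit_map_near[OF p e(1), of m] by blast
    have "limit_map -` U \<in> sets borel"
      using measurable_sets[OF measurable_limit_map, of U] U by simp
    moreover have "limit_map z \<in> U" if "z \<in> E" for z
      using E(4)[OF that] e(2) by (auto simp: subset_iff dist_commute)
    then have "E \<subseteq> limit_event \<inter> limit_map -` U"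
      using E(3) by blast
    ultimately have "emeasure (coeff_law p) E \<le> emeasure (coeff_law p) (limit_event \<inter> limit_map -` U)"
      by (intro emeasure_mono) auto
    with E(2) have "emeasure (coeff_law p) (limit_event \<inter> limit_map -` U) > 0"
      by (rule less_le_trans)
    then show ?thesis
      using U emeasure_limit_event_pos[OF p, where 'n = 'n]
      by (simp add: emeasure_limit_law ennreal_zero_less_divide C.emeasure_eq_measure)
  qed
  then show ?thesis
    by (auto simp: measure_support_def)
qed

text \<open>Trigonometric polynomials are uniformly dense in the continuous functions; for real ones
  the half-system suffices, as opposite coefficients are conjugate.\<close>

lemma torus_prob_eqI_fourier:
  fixes m m' :: "'n::{finite,linorder} torus_prob"
  assumes eq: "\<And>k N. k \<in> Fplus N \<Longrightarrow> fourier_measure (measure_of_torus_prob m) k = fourier_measure (measure_of_torus_prob m') k"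
  shows "m = m'"
proof (rule measure_eq_if_lipschitz_integrals_eq)
  fix \<phi> :: "'n torus \<Rightarrow> real" assume "1-lipschitz_on UNIV \<phi>"
  then have c\<phi>: "continuous_on UNIV \<phi>"
    by (rule lipschitz_on_continuous_on)
  have trig: "(\<integral>x. c - 1 + trig_poly N z x \<partial>measure_of_torus_prob m) = (\<integral>x. c - 1 + trig_poly N z x \<partial>measure_of_torus_prob m')" for c N z
  proof -
    have *: "(\<integral>x. c - 1 + trig_poly N z x \<partial>measure_of_torus_prob m) =
        c + 2 * Re (\<Sum>k\<in>Fplus N. z k * cnj (fourier_measure (measure_of_torus_prob m) k))" for m :: "'n torus_prob"
    proof -
      interpret prob_space "measure_of_torus_prob m" by (rule prob_space_torus_prob)
      have int: "integrable (measure_of_torus_prob m) f" if "continuous_on UNIV f" for f :: "'n torus \<Rightarrow> complex"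
        using that by (rule integrable_torus_prob_continuous)
      have F: "integrable (measure_of_torus_prob m) (\<lambda>x. \<Sum>k\<in>Fplus N. z k * echar (- k) x)"
        by (intro int continuous_intros)
      have "(\<integral>x. c - 1 + trig_poly N z x \<partial>measure_of_torus_prob m) =
          (\<integral>x. c + 2 * Re (\<Sum>k\<in>Fplus N. z k * echar (- k) x) \<partial>measure_of_torus_prob m)"
        by (simp add: trig_poly_def del: Re_sum)
      also have "\<dots> = c + 2 * Re (\<integral>x. (\<Sum>k\<in>Fplus N. z k * echar (- k) x) \<partial>measure_of_torus_prob m)"
        using F integrable_Re[OF F] integral_Re[OF F] by (simp add: prob_space[simplified] del: Re_sum integral_Re)
      also have "(\<integral>x. (\<Sum>k\<in>Fplus N. z k * echar (- k) x) \<partial>measure_of_torus_prob m) =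
          (\<Sum>k\<in>Fplus N. z k * cnj (fourier_measure (measure_of_torus_prob m) k))"
        unfolding fourier_measure_uminus[symmetric] unfolding fourier_measure_def
        by (subst Bochner_Integration.integral_sum) (auto intro!: int continuous_intros)
      finally show ?thesis .
    qed
    show ?thesis
      unfolding * using eq by (auto intro!: sum.cong)
  qed
  have small: "\<bar>(\<integral>x. \<phi> x \<partial>measure_of_torus_prob m) - (\<integral>x. \<phi> x \<partial>measure_of_torus_prob m')\<bar> \<le> e" if e: "e > 0" for e
  proof -
    obtain N z c where near: "\<And>x. \<bar>\<phi> x - (c - 1 + trig_poly N z x)\<bar> < e / 2"
      by (rule trig_poly_dense_continuous[OF c\<phi>, of "e / 2"]) (use e in simp, rule that)
    have "\<bar>(\<integral>x. \<phi> x \<partial>measure_of_torus_prob m) - (\<integral>x. c - 1 + trig_poly N z x \<partial>measure_of_torus_prob m)\<bar> \<le> e / 2" for m :: "'n torus_prob"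
    proof -
      interpret prob_space "measure_of_torus_prob m" by (rule prob_space_torus_prob)
      have "(\<integral>x. \<bar>\<phi> x - (c - 1 + trig_poly N z x)\<bar> \<partial>measure_of_torus_prob m) \<le> (\<integral>x. e / 2 \<partial>measure_of_torus_prob m)"
        by (intro Bochner_Integration.integral_mono integrable_torus_prob_continuous continuous_intros c\<phi> less_imp_le[OF near])
      also have "\<dots> = e / 2"
        by (simp add: prob_space[simplified])
      finally have "\<bar>\<integral>x. \<phi> x - (c - 1 + trig_poly N z x) \<partial>measure_of_torus_prob m\<bar> \<le> e / 2"
        by (rule order_trans[OF integral_abs_bound])
      moreover have "(\<integral>x. \<phi> x - (c - 1 + trig_poly N z x) \<partial>measure_of_torus_prob m) =
          (\<integral>x. \<phi> x \<partial>measure_of_torus_prob m) - (\<integral>x. c - 1 + trig_poly N z x \<partial>measure_of_torus_prob m)"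
        by (intro Bochner_Integration.integral_diff integrable_torus_prob_continuous continuous_intros c\<phi>)
      ultimately show ?thesis
        by (simp only:)
    qed
    from this[of m] this[of m'] show ?thesis
      using trig[of c N z] by linarith
  qed
  have "\<bar>(\<integral>x. \<phi> x \<partial>measure_of_torus_prob m) - (\<integral>x. \<phi> x \<partial>measure_of_torus_prob m')\<bar> \<le> 0"
    by (rule field_le_epsilon) (unfold add_0, rule small)
  then show "(\<integral>x. \<phi> x \<partial>measure_of_torus_prob m) = (\<integral>x. \<phi> x \<partial>measure_of_torus_prob m')"
    by simp
qed

definition coeffs :: "'n::{finite,linorder} torus_prob \<Rightarrow> 'n::{finite,linorder} coefficients" where
  "coeffs m = (\<lambda>k. fourier_measure (measure_of_torus_prob m) k)"

lemma measurable_coeffs [measurable]: "coeffs \<in> borel_measurable borel"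
proof -
  have "coeffs \<in> borel \<rightarrow>\<^sub>M (Pi\<^sub>M UNIV (\<lambda>_ :: 'n::{finite,linorder} frequency. borel :: complex measure))"
    unfolding coeffs_def[abs_def] by (rule measurable_PiM_single') (auto simp: space_PiM)
  then show ?thesis
    by (simp cong: measurable_cong_sets add: sets_PiM_equal_borel)
qed

text \<open>Outside the half-system the coefficients of \<open>limit_map z\<close> are forced by
  those inside, whereas the coordinates of \<open>z\<close> there are independent. The two families
  can be expected to agree on the half-system only.\<close>

lemma limit_event_cong:
  assumes "\<And>k N. k \<in> Fplus N \<Longrightarrow> z k = w k"
  shows "z \<in> limit_event \<longleftrightarrow> w \<in> limit_event"
proof -
  have "trig_poly N z = trig_poly N w" for N
    by (rule ext, rule trig_poly_cong) (rule assms)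
  then have "min_trig N z = min_trig N w" for N
    by (simp add: min_trig_def)
  moreover have "shell_sum z = shell_sum w"
    unfolding shell_sum_def using assms by (intro ext sum.cong refl) (auto simp: shell_def)
  ultimately show ?thesis
    by (simp add: limit_event_eq smooth_coeffs_def)
qed

lemma coeffs_limit_map: "z \<in> limit_event \<Longrightarrow> k \<in> Fplus N \<Longrightarrow> coeffs (limit_map z) k = z k"
  using pi2_limit_map[of z N] by (simp add: pi2_def coeffs_def fun_eq_iff restrict_def) metis

text \<open>A measure is determined by its Fourier coefficients; so the measures with a density given by a
  smooth positive Fourier series form a Borel set, namely the preimage of \<^term>\<open>limit_event\<close> under
  \<^term>\<open>coeffs\<close>. The almost sure statement about
  \<open>u\<close> can thus be transferred to the image measure.\<close>

lemma density_of_coeffs_in_limit_event: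
  fixes m :: "'n::{finite,linorder} torus_prob"
  assumes "coeffs m \<in> limit_event"
  shows "m = density_prob (fourier_series (coeffs m))"
proof (rule torus_prob_eqI_fourier)
  fix k :: "'n::{finite,linorder} frequency" and N assume "k \<in> Fplus N"
  then show "fourier_measure (measure_of_torus_prob m) k =
      fourier_measure (measure_of_torus_prob (density_prob (fourier_series (coeffs m)))) k"
    using coeffs_limit_map[OF assms, of k N] assms by (simp add: coeffs_def limit_map_def)
qed

lemma AE_limit_law_C1:
  "AE m in (limit_law p :: 'n::{finite,linorder} torus_prob measure). \<exists>h. C1_torus h \<and> (\<forall>x. h x > 0) \<and>
     measure_of_torus_prob m = density torus_lebesgue (\<lambda>x. ennreal (h x))"
proof -
  have "AE m in (limit_law p :: 'n torus_prob measure). coeffs m \<in> limit_event"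
    unfolding limit_law_def
  proof (subst AE_distr_iff)
    show "{m \<in> space borel. coeffs m \<in> limit_event} \<in> sets (borel :: 'n torus_prob measure)"
      by measurable
    have "coeffs (limit_map z) \<in> limit_event" if "z \<in> limit_event" for z :: "'n::{finite,linorder} coefficients"
      using limit_event_cong[of "coeffs (limit_map z)" z] coeffs_limit_map[OF that] that by blast
    then show "AE z in uniform_measure (coeff_law p) limit_event. coeffs (limit_map z) \<in> (limit_event :: 'n coefficients set)"
      by (intro AE_uniform_measureI) auto
  qed simp
  then show ?thesis
  proof eventually_elim
    case (elim m)
    let ?h = "fourier_series (coeffs m)"
    have h: "smooth_coeffs (coeffs m)" "\<And>x. 0 < ?h x"
      using elim by (auto simp: limit_event_def)
    then have "measure_of_torus_prob m = density torus_lebesgue (\<lambda>x. ennreal (?h x))"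
      using density_of_coeffs_in_limit_event[OF elim] measure_of_density_prob[OF torus_density_fourier_series[OF h]]
      by simp
    then show ?case
      using C1_fourier_series[OF h(1)] h(2) by blast
  qed
qed

section \<open>Convergence\<close>

lemma uniform_measure_eq_density:
  assumes "prob_space M" "A \<in> sets M" "emeasure M A > 0"
  shows "uniform_measure M A = density M (\<lambda>x. ennreal (indicator A x / measure M A))"
proof -
  interpret prob_space M by fact
  have "measure M A > 0"
    using assms(3) by (simp add: emeasure_eq_measure)
  then have "indicator A x / emeasure M A = ennreal (indicator A x / measure M A)" for x
    by (simp add: emeasure_eq_measure divide_ennreal ennreal_indicator[symmetric] split: split_indicator)
  then show ?thesis
    unfolding uniform_measure_def by simp
qed

lemma integral_uniform_measure:
  fixes f :: "'a \<Rightarrow> real"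
  assumes "prob_space M" "A \<in> sets M" "emeasure M A > 0" "f \<in> borel_measurable M"
  shows "(\<integral>x. f x \<partial>uniform_measure M A) = (\<integral>x. indicator A x * f x \<partial>M) / measure M A"
proof -
  have "(\<integral>x. f x \<partial>uniform_measure M A) = (\<integral>x. indicator A x / measure M A * f x \<partial>M)"
    unfolding uniform_measure_eq_density[OF assms(1-3)] using assms(2,4)
    by (subst integral_real_density) auto
  then show ?thesis
    by simp
qed

text \<open>A non-zero limit of \<open>min_trig N z\<close> fixes its sign eventually; at 0 the
  indicators could oscillate.\<close>

lemma indicator_min_trig_tendsto:
  assumes "smooth_coeffs z" "(INF x. fourier_series z x) \<noteq> 0"
  shows "(\<lambda>N. indicator {z. 0 < min_trig N z} z :: real) \<longlonglongrightarrow> indicator limit_event z"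
proof (cases "0 < (INF x. fourier_series z x)")
  case True
  then have "z \<in> limit_event"
    using assms(1) by (simp add: limit_event_def INF_torus_pos_iff continuous_on_fourier_series)
  moreover have "\<forall>\<^sub>F N in sequentially. indicator {z. 0 < min_trig N z} z = (1 :: real)"
    using order_tendstoD(1)[OF lim_min_trig(1)[OF assms(1)] True] by eventually_elim simp
  ultimately show ?thesis
    by (simp add: tendsto_eventually)
next
  case False
  then have neg: "(INF x. fourier_series z x) < 0"
    using assms(2) by simp
  have "z \<notin> limit_event"
    using False assms(1) by (simp add: limit_event_def INF_torus_pos_iff continuous_on_fourier_series)
  moreover have "\<forall>\<^sub>F N in sequentially. indicator {z. 0 < min_trig N z} z = (0 :: real)"
    using order_tendstoD(2)[OF lim_min_trig(1)[OF assms(1)] neg] by eventually_elim simp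
  ultimately show ?thesis
    by (simp add: tendsto_eventually)
qed

lemma AE_indicator_min_trig_tendsto:
  fixes p :: real
  assumes p: "p \<ge> 5"
  shows "AE z in (coeff_law p :: 'n::{finite,linorder} coefficients measure).
    (\<lambda>N. indicator {z. 0 < min_trig N z} z :: real) \<longlonglongrightarrow> indicator limit_event z"
  using AE_smooth_coeffs[OF p, where 'n = 'n] AE_fourier_series_min_nonzero[of p, where 'n = 'n]
  by eventually_elim (blast intro: indicator_min_trig_tendsto)

lemma sets_min_trig_pos: "{z. 0 < min_trig N z} \<in> sets borel"
proof -
  have "{z \<in> space borel. 0 < min_trig N z} \<in> sets (borel :: (int ^ 'a::{finite,linorder} \<Rightarrow> complex) measure)"
    by measurable
  then show ?thesis
    by simp
qed

lemma integral_P_N: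
  fixes f :: "'n::{finite,linorder} torus_prob \<Rightarrow> real"
  assumes [measurable]: "f \<in> borel_measurable borel"
  shows "(\<integral>m. f m \<partial>P_N p N) = (\<integral>z. indicator {z. 0 < min_trig N z} z * f (I_total N z) \<partial>coeff_law p) /
    measure (coeff_law p) {z :: 'n::{finite,linorder} coefficients. 0 < min_trig N z}"
proof -
  have "(\<integral>m. f m \<partial>P_N p N) = (\<integral>z. f (I_total N z) \<partial>uniform_measure (coeff_law p) {z. 0 < min_trig N z})"
    unfolding P_N_eq by (rule integral_distr) auto
  also have "\<dots> = (\<integral>z. indicator {z. 0 < min_trig N z} z * f (I_total N z) \<partial>coeff_law p) /
    measure (coeff_law p) {z :: 'n coefficients. 0 < min_trig N z}"
    by (rule integral_uniform_measure[OF prob_space_coeff_law _ emeasure_min_trig_pos])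
       (auto simp: sets_min_trig_pos)
  finally show ?thesis .
qed

lemma integral_limit_law:
  fixes f :: "'n::{finite,linorder} torus_prob \<Rightarrow> real"
  assumes p: "p \<ge> 5" and [measurable]: "f \<in> borel_measurable borel"
  shows "(\<integral>m. f m \<partial>limit_law p) = (\<integral>z. indicator limit_event z * f (limit_map z) \<partial>coeff_law p) /
    measure (coeff_law p) (limit_event :: 'n::{finite,linorder} coefficients set)"
proof -
  have "(\<integral>m. f m \<partial>limit_law p) = (\<integral>z. f (limit_map z) \<partial>uniform_measure (coeff_law p) limit_event)"
    unfolding limit_law_def by (rule integral_distr) auto
  also have "\<dots> = (\<integral>z. indicator limit_event z * f (limit_map z) \<partial>coeff_law p) /
    measure (coeff_law p) (limit_event :: 'n coefficients set)"
    by (rule integral_uniform_measure[OF prob_space_coeff_law _ emeasure_limit_event_pos[OF p]]) auto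
  finally show ?thesis .
qed

lemma measure_min_trig_tendsto:
  fixes p :: real
  assumes p: "p \<ge> 5"
  shows "(\<lambda>N. measure (coeff_law p) {z :: 'n::{finite,linorder} coefficients. 0 < min_trig N z}) \<longlonglongrightarrow>
    measure (coeff_law p) (limit_event :: 'n coefficients set)"
proof -
  interpret C: prob_space "coeff_law p :: 'n coefficients measure"
    by (rule prob_space_coeff_law)
  have "(\<lambda>N. \<integral>z. indicator {z :: 'n coefficients. 0 < min_trig N z} z \<partial>coeff_law p) \<longlonglongrightarrow>
    (\<integral>z. indicator (limit_event :: 'n coefficients set) z \<partial>coeff_law p :: real)"
    by (rule integral_dominated_convergence[where w = "\<lambda>_. 1"])
       (use AE_indicator_min_trig_tendsto[OF p, where 'n = 'n] in \<open>auto split: split_indicator\<close>)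
  then show ?thesis
    by (simp add: sets_min_trig_pos)
qed

lemma P_N_weakly_converges:
  fixes p :: real
  assumes p: "p \<ge> 5"
  shows "weakly_converges (P_N p) (limit_law p :: 'n::{finite,linorder} torus_prob measure)"
  unfolding weakly_converges_def
proof (intro allI impI)
  fix f :: "'n torus_prob \<Rightarrow> real"
  assume f: "continuous_on UNIV f \<and> bounded (range f)"
  interpret C: prob_space "coeff_law p :: 'n::{finite,linorder} coefficients measure"
    by (rule prob_space_coeff_law)
  have [measurable]: "f \<in> borel_measurable borel"
    using f by (auto intro: borel_measurable_continuous_onI)
  obtain B where B: "\<And>m. \<bar>f m\<bar> \<le> B"
    using f by (auto simp: bounded_iff)
  have B0: "B \<ge> 0"
    using order_trans[OF abs_ge_zero B] .
  have "(\<lambda>N. \<integral>z. indicator {z. 0 < min_trig N z} z * f (I_total N z) \<partial>coeff_law p) \<longlonglongrightarrow>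
    (\<integral>z. indicator limit_event z * f (limit_map z) \<partial>coeff_law p)"
  proof (rule integral_dominated_convergence[where w = "\<lambda>_. B"])
    show "AE z in coeff_law p. (\<lambda>N. indicator {z. 0 < min_trig N z} z * f (I_total N z)) \<longlonglongrightarrow>
        indicator limit_event z * f (limit_map z)"
      using AE_indicator_min_trig_tendsto[OF p, where 'n = 'n]
    proof eventually_elim
      case (elim z)
      show ?case
      proof (cases "z \<in> limit_event")
        case True
        have "isCont f (limit_map z)"
          using f by (simp add: continuous_on_eq_continuous_at)
        then have "(\<lambda>N. f (I_total N z)) \<longlonglongrightarrow> f (limit_map z)"
          using I_total_tendsto[OF True] by (rule isCont_tendsto_compose)
        with elim show ?thesis
          by (rule tendsto_mult)
      next
        \<comment> \<open>Here \<open>I_total N z\<close> need not converge, but the indicators tend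
          to 0 and \<open>f\<close> is bounded.\<close>
        case False
        show ?thesis
        proof (rule Lim_null_comparison[where g = "\<lambda>N. B * indicator {z. 0 < min_trig N z} z", THEN tendsto_eq_rhs])
          show "\<forall>\<^sub>F N in sequentially. norm (indicator {z. 0 < min_trig N z} z * f (I_total N z)) \<le> B * indicator {z. 0 < min_trig N z} z"
            using B by (intro always_eventually) (auto split: split_indicator)
          show "(\<lambda>N. B * indicator {z. 0 < min_trig N z} z) \<longlonglongrightarrow> 0"
            using tendsto_mult_left[OF elim, of B] False by simp
          show "0 = indicator limit_event z * f (limit_map z)"
            using False by simp
        qed
      qed
    qed
    show "AE z in coeff_law p. norm (indicator {z. 0 < min_trig N z} z * f (I_total N z)) \<le> B" for N
      using B B0 by (intro always_eventually) (auto split: split_indicator)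
  qed auto
  then have "(\<lambda>N. (\<integral>z. indicator {z. 0 < min_trig N z} z * f (I_total N z) \<partial>coeff_law p) /
      measure (coeff_law p) {z :: 'n coefficients. 0 < min_trig N z}) \<longlonglongrightarrow>
    (\<integral>z. indicator limit_event z * f (limit_map z) \<partial>coeff_law p) /
      measure (coeff_law p) (limit_event :: 'n coefficients set)"
    using emeasure_limit_event_pos[OF p, where 'n = 'n]
    by (intro tendsto_divide measure_min_trig_tendsto[OF p]) (auto simp: C.emeasure_eq_measure)
  then show "(\<lambda>N. integral\<^sup>L (P_N p N) f) \<longlonglongrightarrow> integral\<^sup>L (limit_law p) f"
    by (simp add: integral_P_N integral_limit_law[OF p])
qed

text \<open>Both expectations average the same function \<open>\<psi>\<close> of the Gaussian
  coefficients over two events. The mean symmetric difference \<open>\<delta> N\<close> of the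
  events bounds the gap for every test function.\<close>

lemma total_variation_P_N:
  fixes p :: real
  assumes p: "p \<ge> 5"
  shows "(\<lambda>N. SUP \<phi>\<in>{\<phi> \<in> borel_measurable (coeff_lebesgue N :: 'n::{finite,linorder} coefficients measure).
                  \<forall>z\<in>space (coeff_lebesgue N). \<phi> z \<in> {-1..1 :: real}}.
        \<bar>(\<integral>m. \<phi> (pi2 N m) \<partial>limit_law p) - (\<integral>m. \<phi> (pi2 N m) \<partial>(P_N p N))\<bar>) \<longlonglongrightarrow> 0"
proof -
  let ?\<Omega> = "coeff_law p :: 'n coefficients measure"
  interpret C: prob_space ?\<Omega>
    by (rule prob_space_coeff_law)
  let ?A = "limit_event :: 'n coefficients set"
  let ?B = "\<lambda>N. {z :: 'n coefficients. 0 < min_trig N z}"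
  have a: "C.prob ?A > 0" and b: "C.prob (?B N) > 0" for N
    using emeasure_limit_event_pos[OF p, where 'n = 'n] emeasure_min_trig_pos[of p N, where 'n = 'n]
    by (simp_all add: C.emeasure_eq_measure)
  define \<delta> where "\<delta> N = (\<integral>z. \<bar>indicator ?A z - indicator (?B N) z\<bar> \<partial>?\<Omega> :: real)" for N
  have "\<delta> \<longlonglongrightarrow> (\<integral>z. 0 \<partial>?\<Omega>)"
    unfolding \<delta>_def
  proof (rule integral_dominated_convergence[where w = "\<lambda>_. 1"])
    show "AE z in ?\<Omega>. (\<lambda>N. \<bar>indicator ?A z - indicator (?B N) z :: real\<bar>) \<longlonglongrightarrow> 0"
      using AE_indicator_min_trig_tendsto[OF p, where 'n = 'n]
    proof eventually_elim
      case (elim z)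
      have "(\<lambda>N. \<bar>indicator ?A z - indicator (?B N) z :: real\<bar>) \<longlonglongrightarrow> \<bar>indicator ?A z - indicator ?A z\<bar>"
        by (intro tendsto_intros elim)
      then show ?case
        by simp
    qed
  qed (auto split: split_indicator)
  then have lim: "(\<lambda>N. 2 / C.prob ?A * \<delta> N) \<longlonglongrightarrow> 0"
    using tendsto_mult_left[of \<delta> 0 sequentially "2 / C.prob ?A"] by simp
  have bound: "\<bar>(\<integral>m. \<phi> (pi2 N m) \<partial>limit_law p) - (\<integral>m. \<phi> (pi2 N m) \<partial>(P_N p N))\<bar> \<le> 2 / C.prob ?A * \<delta> N"
    if \<phi>: "\<phi> \<in> borel_measurable (coeff_lebesgue N :: 'n coefficients measure)"
      "\<forall>z\<in>space (coeff_lebesgue N). \<phi> z \<in> {-1..1 :: real}" for N \<phi>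
  proof -
    note [measurable] = \<phi>(1)
    define \<psi> where "\<psi> z = \<phi> (restrict z (Fplus N))" for z :: "'n coefficients"
    have [measurable]: "\<psi> \<in> borel_measurable borel"
      unfolding \<psi>_def by measurable
    have \<psi>: "\<bar>\<psi> z\<bar> \<le> 1" for z
      using \<phi>(2) by (auto simp: \<psi>_def coeff_lebesgue_def space_PiM abs_le_iff)
    have intA: "integrable ?\<Omega> (\<lambda>z. indicator ?A z * \<psi> z)" and intB: "integrable ?\<Omega> (\<lambda>z. indicator (?B N) z * \<psi> z)"
      using \<psi> by (auto intro!: C.integrable_const_bound[where B = 1] split: split_indicator)
    have int\<delta>: "integrable ?\<Omega> (\<lambda>z. \<bar>indicator ?A z - indicator (?B N) z\<bar> :: real)"
      by (auto intro!: C.integrable_const_bound[where B = 1] split: split_indicator)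
    define X where "X = (\<integral>z. indicator ?A z * \<psi> z \<partial>?\<Omega>)"
    define Y where "Y = (\<integral>z. indicator (?B N) z * \<psi> z \<partial>?\<Omega>)"
    have "(\<integral>m. \<phi> (pi2 N m) \<partial>limit_law p) = X / C.prob ?A"
      unfolding X_def by (subst integral_limit_law[OF p])
        (auto intro!: arg_cong2[where f = "(/)"] Bochner_Integration.integral_cong simp: \<psi>_def pi2_limit_map split: split_indicator)
    moreover have "(\<integral>m. \<phi> (pi2 N m) \<partial>P_N p N) = Y / C.prob (?B N)"
      unfolding Y_def by (subst integral_P_N)
        (auto intro!: arg_cong2[where f = "(/)"] Bochner_Integration.integral_cong simp: \<psi>_def pi2_I_total split: split_indicator)
    moreover have XY: "\<bar>X - Y\<bar> \<le> \<delta> N"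
    proof -
      have "X - Y = (\<integral>z. indicator ?A z * \<psi> z - indicator (?B N) z * \<psi> z \<partial>?\<Omega>)"
        unfolding X_def Y_def using intA intB by simp
      also have "\<bar>\<dots>\<bar> \<le> (\<integral>z. \<bar>indicator ?A z * \<psi> z - indicator (?B N) z * \<psi> z\<bar> \<partial>?\<Omega>)"
        by (rule integral_abs_bound)
      also have "\<dots> \<le> \<delta> N"
        unfolding \<delta>_def using \<psi>
        by (intro Bochner_Integration.integral_mono integrable_abs Bochner_Integration.integrable_diff intA intB int\<delta>)
           (auto split: split_indicator)
      finally show ?thesis .
    qed
    moreover have Y: "\<bar>Y\<bar> \<le> C.prob (?B N)"
    proof -
      have "\<bar>Y\<bar> \<le> (\<integral>z. \<bar>indicator (?B N) z * \<psi> z\<bar> \<partial>?\<Omega>)"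
        unfolding Y_def by (rule integral_abs_bound)
      also have "\<dots> \<le> (\<integral>z. indicator (?B N) z \<partial>?\<Omega>)"
        using \<psi> by (intro Bochner_Integration.integral_mono integrable_abs intB integrable_real_indicator)
          (auto split: split_indicator simp: C.emeasure_eq_measure sets_min_trig_pos)
      finally show ?thesis
        by (simp add: sets_min_trig_pos)
    qed
    moreover have "\<bar>C.prob ?A - C.prob (?B N)\<bar> \<le> \<delta> N"
    proof -
      have "C.prob ?A - C.prob (?B N) = (\<integral>z. indicator ?A z - indicator (?B N) z \<partial>?\<Omega>)"
        by (subst Bochner_Integration.integral_diff) (auto simp: sets_min_trig_pos C.emeasure_eq_measure)
      then show ?thesis
        unfolding \<delta>_def using integral_abs_bound[of ?\<Omega> "\<lambda>z. indicator ?A z - indicator (?B N) z"] by simp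
    qed
    \<comment> \<open>One \<open>d\<close> pays for the numerators and one for the normalising
      probabilities, the latter through |Y| \<le> t.\<close>
    moreover have "\<bar>X / s - Y / t\<bar> \<le> 2 / s * d" if "s > 0" "t > 0" "\<bar>X - Y\<bar> \<le> d" "\<bar>Y\<bar> \<le> t" "\<bar>s - t\<bar> \<le> d" for s t d :: real
    proof -
      have "X / s - Y / t = (X - Y) / s + (Y / t) * ((t - s) / s)"
        using that(1,2) by (simp add: field_simps)
      also have "\<bar>\<dots>\<bar> \<le> \<bar>X - Y\<bar> / s + \<bar>Y / t\<bar> * (\<bar>t - s\<bar> / s)"
        using that(1) by (intro order_trans[OF abs_triangle_ineq]) (simp add: abs_mult)
      also have "\<dots> \<le> d / s + 1 * (d / s)"
        using that by (intro add_mono mult_mono divide_right_mono) (auto simp: abs_minus_commute)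
      finally show ?thesis
        by simp
    qed
    ultimately show ?thesis
      using a b[of N] by simp
  qed
  show ?thesis
  proof (rule tendsto_sandwich[OF _ _ tendsto_const lim])
    let ?\<Phi> = "\<lambda>N. {\<phi> \<in> borel_measurable (coeff_lebesgue N :: 'n coefficients measure).
                  \<forall>z\<in>space (coeff_lebesgue N). \<phi> z \<in> {-1..1 :: real}}"
    have z: "(\<lambda>_. 0) \<in> ?\<Phi> N" for N
      by simp
    show "\<forall>\<^sub>F N in sequentially. 0 \<le> (SUP \<phi>\<in>?\<Phi> N. \<bar>(\<integral>m. \<phi> (pi2 N m) \<partial>limit_law p) - (\<integral>m. \<phi> (pi2 N m) \<partial>(P_N p N))\<bar>)"
    proof (intro always_eventually allI)
      fix N
      show "0 \<le> (SUP \<phi>\<in>?\<Phi> N. \<bar>(\<integral>m. \<phi> (pi2 N m) \<partial>limit_law p) - (\<integral>m. \<phi> (pi2 N m) \<partial>(P_N p N))\<bar>)"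
        using bound by (intro cSUP_upper2[OF _ z[of N]] bdd_aboveI2[where M = "2 / C.prob ?A * \<delta> N"]) auto
    qed
    show "\<forall>\<^sub>F N in sequentially. (SUP \<phi>\<in>?\<Phi> N. \<bar>(\<integral>m. \<phi> (pi2 N m) \<partial>limit_law p) - (\<integral>m. \<phi> (pi2 N m) \<partial>(P_N p N))\<bar>)
        \<le> 2 / C.prob ?A * \<delta> N"
    proof (intro always_eventually allI)
      fix N
      show "(SUP \<phi>\<in>?\<Phi> N. \<bar>(\<integral>m. \<phi> (pi2 N m) \<partial>limit_law p) - (\<integral>m. \<phi> (pi2 N m) \<partial>(P_N p N))\<bar>)
          \<le> 2 / C.prob ?A * \<delta> N"
        by (rule cSUP_least) (use z[of N] in blast, use bound in blast)
    qed
  qed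
qed

section \<open>Absolute continuity of the projections\<close>

lemma null_sets_PiM_cgauss:
  assumes "finite K" "\<And>k. a k > 0" "S \<in> null_sets (Pi\<^sub>M K (\<lambda>_. lborel))"
  shows "S \<in> null_sets (Pi\<^sub>M K (\<lambda>k. cgauss (a k)))"
proof -
  have "null_sets (Pi\<^sub>M K (\<lambda>_. lborel)) \<subseteq> null_sets (Pi\<^sub>M K (\<lambda>k. cgauss (a k)))"
    unfolding PiM_cgauss[OF assms(1,2)] using absolutely_continuousI_density[OF measurable_cgauss_density]
    by (auto simp: absolutely_continuous_def)
  with assms(3) show ?thesis
    by blast
qed

text \<open>Rescaled Gaussians are Gaussians, so no change of variables for products of \<^term>\<open>lborel\<close> is
  needed to see that null sets are preserved.\<close>

lemma emeasure_cgauss_scale: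
  assumes a: "a > 0" and c: "c > 0" and B [measurable]: "B \<in> sets borel"
  shows "emeasure (cgauss a) {x. complex_of_real c * x \<in> B} = emeasure (cgauss (a / c\<^sup>2)) B"
proof -
  have ac: "a / c\<^sup>2 > 0"
    using a c by simp
  have Z: "cgauss_Z (a / c\<^sup>2) = c\<^sup>2 * cgauss_Z a"
    unfolding cgauss_Z(2)[OF ac] cgauss_Z(2)[OF a] using a c by (simp add: power_divide)
  have "{x \<in> space borel. complex_of_real c * x \<in> B} \<in> sets borel"
    by measurable
  then have S: "{x. complex_of_real c * x \<in> B} \<in> sets borel"
    by simp
  define g where "g z = ennreal (exp (- (a / c\<^sup>2 * (cmod z)\<^sup>2)) / cgauss_Z (a / c\<^sup>2)) * indicator B z" for z
  have g: "g \<in> borel_measurable borel"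
    unfolding g_def by measurable
  then have gc: "(\<lambda>z. g (c *\<^sub>R z)) \<in> borel_measurable borel"
    by (rule measurable_compose[rotated]) simp
  have "emeasure (cgauss (a / c\<^sup>2)) B = (\<integral>\<^sup>+z. g z \<partial>lborel)"
    unfolding cgauss_def g_def by (rule emeasure_density) auto
  also have "\<dots> = ennreal (c\<^sup>2) * (\<integral>\<^sup>+z. g (c *\<^sub>R z) \<partial>lborel)"
    using c g by (intro nn_integral_complex_scale)
  also have "\<dots> = (\<integral>\<^sup>+z. ennreal (c\<^sup>2) * g (c *\<^sub>R z) \<partial>lborel)"
    using gc by (intro nn_integral_cmult[symmetric]) simp
  also have "\<dots> = (\<integral>\<^sup>+z. ennreal (exp (- (a * (cmod z)\<^sup>2)) / cgauss_Z a) * indicator {x. complex_of_real c * x \<in> B} z \<partial>lborel)"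
  proof (rule nn_integral_cong)
    fix z
    have "ennreal (c\<^sup>2) * ennreal (exp (- (a / c\<^sup>2 * (cmod (c *\<^sub>R z))\<^sup>2)) / cgauss_Z (a / c\<^sup>2)) =
        ennreal (exp (- (a * (cmod z)\<^sup>2)) / cgauss_Z a)"
      using c cgauss_Z(3)[OF a] by (simp add: Z power_mult_distrib flip: ennreal_mult)
    then show "ennreal (c\<^sup>2) * g (c *\<^sub>R z) =
        ennreal (exp (- (a * (cmod z)\<^sup>2)) / cgauss_Z a) * indicator {x. complex_of_real c * x \<in> B} z"
      unfolding g_def by (simp add: scaleR_conv_of_real indicator_def flip: mult.assoc)
  qed
  also have "\<dots> = emeasure (cgauss a) {x. complex_of_real c * x \<in> B}"
    unfolding cgauss_def using S by (intro emeasure_density[symmetric]) auto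
  finally show ?thesis ..
qed

lemma measurable_scaled_coeffs:
  fixes c :: "'n::{finite,linorder} frequency \<Rightarrow> real"
  shows "(\<lambda>z. \<lambda>k\<in>Fplus N. complex_of_real (c k) * z k) \<in>
    coeff_law p \<rightarrow>\<^sub>M Pi\<^sub>M (Fplus N) (\<lambda>k. cgauss (a k))"
proof (rule measurable_restrict)
  fix k
  have "(\<lambda>z. complex_of_real (c k) * z k) \<in> borel_measurable borel"
    by measurable
  then show "(\<lambda>z. complex_of_real (c k) * z k) \<in> coeff_law p \<rightarrow>\<^sub>M cgauss (a k)"
    by (simp cong: measurable_cong_sets)
qed

lemma distr_coeff_law_scaled:
  fixes c :: "'n::{finite,linorder} frequency \<Rightarrow> real"
  assumes c: "\<And>k. c k > 0"
  shows "distr (coeff_law p) (Pi\<^sub>M (Fplus N) (\<lambda>k. cgauss (coeff_weight p k / (c k)\<^sup>2)))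
     (\<lambda>z. \<lambda>k\<in>Fplus N. complex_of_real (c k) * z k) = Pi\<^sub>M (Fplus N) (\<lambda>k. cgauss (coeff_weight p k / (c k)\<^sup>2))"
    (is "distr ?\<Omega> ?P ?s = _")
proof -
  interpret G: product_prob_space "\<lambda>k. cgauss (coeff_weight p k / (c k)\<^sup>2)" UNIV
    by (intro product_prob_spaceI prob_space_cgauss divide_pos_pos coeff_weight_pos zero_less_power c)
  interpret H: product_prob_space "\<lambda>k :: 'n frequency. cgauss (coeff_weight p k)" UNIV
    by (rule product_prob_space_cgauss)
  show ?thesis
  proof (rule G.PiM_eqI)
    fix A assume A: "\<And>k. k \<in> Fplus N \<Longrightarrow> A k \<in> sets (cgauss (coeff_weight p k / (c k)\<^sup>2))"
    then have box: "Pi\<^sub>E (Fplus N) A \<in> sets ?P"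
      by (intro sets_PiM_I_finite) auto
    have "emeasure (distr ?\<Omega> ?P ?s) (Pi\<^sub>E (Fplus N) A) = emeasure ?\<Omega> (?s -` Pi\<^sub>E (Fplus N) A \<inter> space ?\<Omega>)"
      by (rule emeasure_distr[OF measurable_scaled_coeffs box])
    also have "?s -` Pi\<^sub>E (Fplus N) A \<inter> space ?\<Omega> = {z \<in> space ?\<Omega>. \<forall>k\<in>Fplus N. z k \<in> {x. complex_of_real (c k) * x \<in> A k}}"
      by (auto simp: PiE_iff)
    also have "emeasure ?\<Omega> \<dots> = (\<Prod>k\<in>Fplus N. emeasure (cgauss (coeff_weight p k)) {x. complex_of_real (c k) * x \<in> A k})"
      unfolding coeff_law_def
    proof (rule H.emeasure_PiM_Collect)
      fix k :: "'n frequency" assume "k \<in> Fplus N"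
      then have [measurable]: "A k \<in> sets borel"
        using A by simp
      have "{x \<in> space borel. complex_of_real (c k) * x \<in> A k} \<in> sets borel"
        by measurable
      then show "{x. complex_of_real (c k) * x \<in> A k} \<in> sets (cgauss (coeff_weight p k))"
        by simp
    qed auto
    also have "\<dots> = (\<Prod>k\<in>Fplus N. emeasure (cgauss (coeff_weight p k / (c k)\<^sup>2)) (A k))"
      using A by (intro prod.cong refl emeasure_cgauss_scale coeff_weight_pos c) simp
    finally show "emeasure (distr ?\<Omega> ?P ?s) (Pi\<^sub>E (Fplus N) A) = (\<Prod>k\<in>Fplus N. emeasure (cgauss (coeff_weight p k / (c k)\<^sup>2)) (A k))" .
  qed simp_all
qed

text \<open>The scaled family is again Gaussian with a Lebesgue density. Used with the Fejer
  coefficients for \<open>pi1\<close> and with the constant 1 for \<open>pi2\<close>.\<close>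

lemma emeasure_scaled_coeffs_null:
  fixes c :: "'n::{finite,linorder} frequency \<Rightarrow> real"
  assumes c: "\<And>k. c k > 0" and S: "S \<in> null_sets (coeff_lebesgue N)"
  shows "{z. (\<lambda>k\<in>Fplus N. complex_of_real (c k) * z k) \<in> S} \<in> null_sets (coeff_law p)"
proof -
  let ?P = "Pi\<^sub>M (Fplus N) (\<lambda>k :: 'n frequency. cgauss (coeff_weight p k / (c k)\<^sup>2))"
  let ?s = "\<lambda>z :: 'n coefficients. \<lambda>k\<in>Fplus N. complex_of_real (c k) * z k"
  have "S \<in> null_sets ?P"
    using S unfolding coeff_lebesgue_def
    by (intro null_sets_PiM_cgauss divide_pos_pos coeff_weight_pos zero_less_power c) simp_all
  then have S': "S \<in> sets ?P" "emeasure (distr (coeff_law p) ?P ?s) S = 0"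
    unfolding distr_coeff_law_scaled[OF c] by auto
  show ?thesis
    using S' measurable_sets[OF measurable_scaled_coeffs[of c N p] S'(1)]
    by (simp add: emeasure_distr[OF measurable_scaled_coeffs] null_sets_def vimage_def)
qed

text \<open>Conditioning divides by a fixed number, so it is enough to place the Gaussian event
  inside a null set.\<close>

lemma null_sets_limit_law:
  fixes B :: "'n::{finite,linorder} torus_prob set"
  assumes "B \<in> sets borel" "E \<in> null_sets (coeff_law p)"
    "\<And>z. z \<in> limit_event \<Longrightarrow> limit_map z \<in> B \<Longrightarrow> z \<in> E"
  shows "emeasure (limit_law p) B = 0"
proof -
  have "limit_map -` B \<in> sets borel"
    using measurable_sets[OF measurable_limit_map assms(1)] by simp
  then have "limit_event \<inter> limit_map -` B \<in> null_sets (coeff_law p)"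
    using assms(3) by (intro null_sets_subset[OF assms(2)]) auto
  then show ?thesis
    by (simp add: emeasure_limit_law[OF assms(1)] null_sets_def)
qed

lemma null_sets_coeff_lebesgue_on_O:
  "S \<in> null_sets (coeff_lebesgue_on_O N) \<longleftrightarrow> S \<in> sets (coeff_lebesgue N) \<and> S \<inter> O_set N \<in> null_sets (coeff_lebesgue N)"
proof -
  have "S \<in> null_sets (coeff_lebesgue_on_O N) \<longleftrightarrow> S \<in> sets (coeff_lebesgue N) \<and>
      (AE z in coeff_lebesgue N. z \<notin> S \<inter> O_set N)"
    unfolding coeff_lebesgue_on_O_def
    by (subst null_sets_density_iff) (auto simp: indicator_def intro!: AE_cong conj_cong)
  then show ?thesis
    by (auto simp: AE_iff_null_sets)
qed

lemma sets_limit_law [simp, measurable_cong]: "sets (limit_law p) = sets borel"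
  and space_limit_law [simp]: "space (limit_law p) = UNIV"
  by (simp_all add: limit_law_def)

lemma pi1_limit_law_absolutely_continuous:
  assumes N: "N \<ge> 1"
  shows "absolutely_continuous (coeff_lebesgue_on_O N)
    (distr (limit_law p :: 'n::{finite,linorder} torus_prob measure) (coeff_lebesgue N) (pi1 N))"
  unfolding absolutely_continuous_def
proof
  let ?P = "limit_law p :: 'n::{finite,linorder} torus_prob measure"
  \<comment> \<open>Extended by 1 off \<open>Fplus N\<close>, since the scaling is stated for
    factors positive at every frequency.\<close>
  define c where "c k = (if k \<in> Fplus N then fejer_coeff N k else 1)" for k :: "'n::{finite,linorder} frequency"
  have c: "c k > 0" for k
    using fejer_coeff_pos[OF N, of k] by (auto simp: c_def Fplus_def)
  fix S :: "'n coefficients set"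
  assume "S \<in> null_sets (coeff_lebesgue_on_O N)"
  then have S: "S \<in> sets (coeff_lebesgue N)" "S \<inter> O_set N \<in> null_sets (coeff_lebesgue N)"
    by (simp_all add: null_sets_coeff_lebesgue_on_O)
  have meas: "pi1 N \<in> ?P \<rightarrow>\<^sub>M coeff_lebesgue N"
    by simp
  have "pi1 N -` S \<in> sets (borel :: 'n torus_prob measure)"
    using measurable_sets[OF measurable_pi1 S(1)] by simp
  then have "emeasure ?P (pi1 N -` S) = 0"
  proof (rule null_sets_limit_law[OF _ emeasure_scaled_coeffs_null[of c, OF c S(2)]])
    fix z :: "'n coefficients"
    assume z: "z \<in> limit_event" "limit_map z \<in> pi1 N -` S"
    have "pi1 N (limit_map z) = (\<lambda>k\<in>Fplus N. complex_of_real (c k) * z k)"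
      unfolding pi1_def
      by (rule restrict_ext)
         (use coeffs_limit_map[OF z(1)] in \<open>auto simp: coeffs_def fourier_fejer Fplus_def c_def mult.commute\<close>)
    moreover have "pi1 N (limit_map z) \<in> O_set N"
    proof -
      have sm: "smooth_coeffs z" and pos: "\<And>x. 0 < fourier_series z x"
        using z(1) by (auto simp: limit_event_def)
      show ?thesis
        using pi1_density_prob_in_O_set[OF N torus_density_fourier_series[OF sm pos] pos] z(1)
        by (simp add: limit_map_def)
    qed
    ultimately show "z \<in> {z. (\<lambda>k\<in>Fplus N. complex_of_real (c k) * z k) \<in> S \<inter> O_set N}"
      using z(2) by simp
  qed
  then show "S \<in> null_sets (distr ?P (coeff_lebesgue N) (pi1 N))"
    using S(1) by (simp add: null_sets_def emeasure_distr[OF meas])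
qed

text \<open>Serves both claims about \<open>pi2\<close>: for a set disjoint from
  \<open>O_set N\<close> the right-hand side is the measure of the empty set, and for a null set of
  Lebesgue measure on \<open>O_set N\<close> it is the quantity to be shown zero.\<close>

lemma emeasure_pi2_on_O_set:
  fixes P :: "'n::{finite,linorder} torus_prob measure"
  assumes P: "sets P = sets borel" and S: "S \<in> sets (coeff_lebesgue N)"
  shows "emeasure (distr (density P (indicator {m. pi2 N m \<in> O_set N})) (coeff_lebesgue N) (pi2 N)) S =
    emeasure P {m. pi2 N m \<in> S \<inter> O_set N}"
proof -
  have vimage: "pi2 N -` T \<in> sets P" if "T \<in> sets (coeff_lebesgue N)" for T
    using measurable_sets[OF measurable_pi2 that] P by simp
  have meas: "pi2 N \<in> density P (indicator {m. pi2 N m \<in> O_set N}) \<rightarrow>\<^sub>M coeff_lebesgue N"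
    using P by (simp cong: measurable_cong_sets)
  have O: "{m. pi2 N m \<in> O_set N} \<in> sets P"
    using vimage[OF sets_O_set] by (simp add: vimage_def)
  have "space P = UNIV"
    using sets_eq_imp_space_eq[OF P] by simp
  then have "emeasure (distr (density P (indicator {m. pi2 N m \<in> O_set N})) (coeff_lebesgue N) (pi2 N)) S =
      emeasure (density P (indicator {m. pi2 N m \<in> O_set N})) (pi2 N -` S)"
    by (simp add: emeasure_distr[OF meas S])
  also have "\<dots> = (\<integral>\<^sup>+m. indicator {m. pi2 N m \<in> O_set N} m * indicator (pi2 N -` S) m \<partial>P)"
    using O vimage[OF S] by (intro emeasure_density) auto
  also have "\<dots> = (\<integral>\<^sup>+m. indicator {m. pi2 N m \<in> S \<inter> O_set N} m \<partial>P)"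
    by (intro nn_integral_cong) (auto split: split_indicator)
  also have "\<dots> = emeasure P {m. pi2 N m \<in> S \<inter> O_set N}"
    using vimage[of "S \<inter> O_set N"] S sets_O_set by (intro nn_integral_indicator) (auto simp: vimage_def)
  finally show ?thesis .
qed

lemma pi2_limit_law_absolutely_continuous:
  "absolutely_continuous (coeff_lebesgue_on_O N)
    (distr (density (limit_law p :: 'n::{finite,linorder} torus_prob measure) (indicator {m. pi2 N m \<in> O_set N}))
      (coeff_lebesgue N) (pi2 N))"
  unfolding absolutely_continuous_def
proof
  let ?P = "limit_law p :: 'n::{finite,linorder} torus_prob measure"
  fix S :: "'n::{finite,linorder} coefficients set"
  assume "S \<in> null_sets (coeff_lebesgue_on_O N)"
  then have S: "S \<in> sets (coeff_lebesgue N)" "S \<inter> O_set N \<in> null_sets (coeff_lebesgue N)"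
    by (simp_all add: null_sets_coeff_lebesgue_on_O)
  have "{m :: 'n torus_prob. pi2 N m \<in> S \<inter> O_set N} \<in> sets borel"
    using measurable_sets[OF measurable_pi2, of "S \<inter> O_set N"] S(1) sets_O_set by (auto simp: vimage_def)
  then have "emeasure ?P {m. pi2 N m \<in> S \<inter> O_set N} = 0"
  proof (rule null_sets_limit_law[OF _ emeasure_scaled_coeffs_null[of "\<lambda>_. 1", OF zero_less_one S(2)]])
    fix z :: "'n coefficients"
    assume z: "z \<in> limit_event" "limit_map z \<in> {m. pi2 N m \<in> S \<inter> O_set N}"
    then show "z \<in> {z. (\<lambda>k\<in>Fplus N. complex_of_real 1 * z k) \<in> S \<inter> O_set N}"
      by (simp add: pi2_limit_map)
  qed
  then show "S \<in> null_sets (distr (density ?P (indicator {m. pi2 N m \<in> O_set N})) (coeff_lebesgue N) (pi2 N))"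
    using S(1) by (simp add: null_sets_def emeasure_pi2_on_O_set)
qed

theorem theorem3p5:
  fixes p :: real
  assumes "p \<ge> 5"
  shows "\<exists>P :: 'n::{finite,linorder} torus_prob measure.
    prob_space P \<and> sets P = sets borel \<and>
    weakly_converges (P_N p) P \<and>
    (measure_support P = UNIV \<and>
     (AE m in P. \<exists>h. C1_torus h \<and> (\<forall>x. h x > 0) \<and>
        measure_of_torus_prob m = density torus_lebesgue (\<lambda>x. ennreal (h x)))) \<and>
    (\<forall>N\<ge>1.
       absolutely_continuous (coeff_lebesgue_on_O N) (distr P (coeff_lebesgue N) (pi1 N)) \<and>
       (let Q = distr (density P (indicator {m. pi2 N m \<in> O_set N})) (coeff_lebesgue N) (pi2 N)
        in space Q - O_set N \<in> null_sets Q \<and>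
           absolutely_continuous (coeff_lebesgue_on_O N) Q)) \<and>
    (\<lambda>N. SUP \<phi>\<in>{\<phi> \<in> borel_measurable (coeff_lebesgue N).
                  \<forall>z\<in>space (coeff_lebesgue N). \<phi> z \<in> {-1..1 :: real}}.
        \<bar>(\<integral>m. \<phi> (pi2 N m) \<partial>P) - (\<integral>m. \<phi> (pi2 N m) \<partial>(P_N p N))\<bar>) \<longlonglongrightarrow> 0"
proof (intro exI[of _ "limit_law p"] conjI allI impI)
  fix N :: nat assume N: "N \<ge> 1"
  let ?Q = "distr (density (limit_law p :: 'n torus_prob measure) (indicator {m. pi2 N m \<in> O_set N})) (coeff_lebesgue N) (pi2 N)"
  show "absolutely_continuous (coeff_lebesgue_on_O N) (distr (limit_law p :: 'n torus_prob measure) (coeff_lebesgue N) (pi1 N))"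
    by (rule pi1_limit_law_absolutely_continuous[OF N])
  have sets: "space (coeff_lebesgue N) - O_set N \<in> sets (coeff_lebesgue N)"
    using sets_O_set by blast
  have "space ?Q - O_set N \<in> null_sets ?Q"
    using sets by (simp add: null_sets_def emeasure_pi2_on_O_set)
  then show "let Q = ?Q in space Q - O_set N \<in> null_sets Q \<and> absolutely_continuous (coeff_lebesgue_on_O N) Q"
    unfolding Let_def using pi2_limit_law_absolutely_continuous by blast
qed (fact prob_space_limit_law[OF assms] sets_limit_law P_N_weakly_converges[OF assms]
  measure_support_limit_law[OF assms] AE_limit_law_C1 total_variation_P_N[OF assms])+

end
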